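(* Consider the sequence of $N$-class, $n$-server queueing games described in the context, under either one of the two scheduling policies FP (fixed priority) or SLQ (serve the longest queue). For each $n\in\mathbb{N}$ let $\sigma^n=\{\sigma^n_{ij}\}_{i\in\{1,\dots,N\},\,j\in\mathbb{N}}$ be the strategy profile given by $$\sigma^n_{ij}(q)=\begin{cases}1,&\text{if } h_i\Big(\dfrac{q}{\sqrt n\,\lambda_i}\Big)\le r_i,\\ 0,&\text{otherwise,}\end{cases}\qquad q\in\mathbb{Z}_+ .$$ Then, for every $\varepsilon>0$ and under each of the two scheduling policies, the sequence $\{\sigma^n\}_{n\in\mathbb{N}}$ is an $\varepsilon$-Nash equilibrium with high probability. That is, there exist events $\hat\Omega^n$, $n\in\mathbb{N}$, with $\mathbb{P}(\hat\Omega^n)\to1$ as $n\to\infty$, such that for every $n$, on the event $\hat\Omega^n$, $$C^n_{ij}(\sigma^n_{ij},\sigma^{n,ij})\le C^n_{ij}(\tau,\sigma^{n,ij})+\varepsilon\qquad\text{for all }(i,j)\in\{1,\dots,N\}\times\mathbb{N}\text{ and all }\tau:\mathbb{Z}_+\to\{0,1\},$$ where $\sigma^{n,ij}=\{\sigma^n_{kl}:(k,l)\ne(i,j)\}$.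
   Context: Notation: $1$ also denotes the all-ones vector in $\mathbb{R}^N$ and $x\cdot y$ the scalar product, so $1\cdot x=\sum_i x_i$. $f(t-)$ is a left limit. Convention $\inf\emptyset=\infty$. Primitives. Fix $N\ge1$ (number of customer classes), $\lambda_i>0$, $\mu_i>0$, $\hat\lambda_i\in\mathbb{R}$, and $\rho_i=\lambda_i/\mu_i$ with $\sum_{i=1}^N\rho_i=1$. For $n\in\mathbb{N}$ the $n$th system has $N$ buffers and $n$ identical servers. The arrival rates $\lambda^n_i>0$ satisfy $\lambda^n_i=n\lambda_i+\sqrt n\,\hat\lambda_i+o(\sqrt n)$. On a probability space $(\Omega,\mathcal F,\mathbb P)$, $\{IA_i(l):l\in\mathbb{N}\}$, $i=1,\dots,N$, are independent sequences of strictly positive i.i.d. random variables with mean $1$ and finite variance $C^2_{IA_i}$; $E^n_i(t)=\sup\{l\ge0:\sum_{k=1}^l IA_i(k)/\lambda^n_i\le t\}$ counts class-$i$ arrivals. $S_1,\dots,S_N$ are mutually independent right-continuous Poisson processes with rates $\mu_1,\dots,\mu_N$. $Q^n(0),\Psi^n(0)$ are $\mathbb{Z}_+^N$-valued random variables (customers initially in the buffers and in service), with $1\cdot\Psi^n(0)\le n$, and $1\cdot Q^n(0)>0$ implies $1\cdot\Psi^n(0)=n$. For each $n$, $\{E^n_i\}_i$, $\{S_i\}_i$, $(Q^n(0),\Psi^n(0))$ are mutually independent. Moreover $\big(n^{-1/2}Q^n(0),\,n^{-1/2}(\Psi^n(0)-n\rho)\big)$ converges in distribution to $(0,\Psi(0))$,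 where $\rho=(\rho_i)_i$ and $\Psi(0)$ is an $\mathbb{R}^N$-valued random variable with $\sum_i\Psi_i(0)\le0$. Dynamics. Customer $(i,j)$ is the $j$th class-$i$ customer to arrive after time $0$. Given decisions $\delta=\{\delta_{ij}\}$, $\delta_{ij}\in\{0,1\}$ ($1$ = join, $0$ = leave), let $J^n_i(t)=\sum_{j=1}^{E^n_i(t)}\delta_{ij}$ and $R^n_i(t)=\sum_{j=1}^{E^n_i(t)}(1-\delta_{ij})$. The queue lengths $Q^n_i$, numbers in service $\Psi^n_i$, routing counts $B^n_i$ (number of class-$i$ customers routed to service by time $t$; nondecreasing, $B^n_i(0)=0$) and departure counts $D^n_i$ are right-continuous, $Q^n_i,\Psi^n_i$ are $\mathbb{Z}_+$-valued, $1\cdot\Psi^n\le n$, and $Q^n_i(t)=Q^n_i(0)+E^n_i(t)-B^n_i(t)-R^n_i(t)$, $\Psi^n_i(t)=\Psi^n_i(0)+B^n_i(t)-D^n_i(t)$, $D^n_i(t)=S_i\big(\int_0^t\Psi^n_i(u)\,du\big)$, together with the non-idling condition: for every $t$, $1\cdot Q^n(t)>0$ implies $1\cdot\Psi^n(t)=n$. (A joining customer enters service immediately if a server is free, otherwise joins its class's buffer; within each buffer customers are served in order of arrival.) The scheduling policy is one of: FP: $\int_{[0,\infty)}\sum_{k=1}^{i-1}Q^n_k(t)\,dB^n_i(t)=0$ for $i=2,\dots,N$ (a freed server takes from the nonempty buffer of least index); SLQ: $\int_{[0,\infty)}1_{\{Q^n_i(t-)<\max_kQ^n_k(t-)\}}\,dB^n_i(t)=0$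 for $i=1,\dots,N$ (a freed server takes from a longest queue, ties broken by an arbitrary fixed rule). Under each policy the processes are uniquely determined by the primitives and $\delta$. Times. With $J^n_i(0-)=0$: $JT^n_i(t)=\inf\{s\ge t:J^n_i(s)>J^n_i(t-)\}$ (joining time of the first class-$i$ customer to join at or after $t$), $RT^n_i(t)=\inf\{s>t:B^n_i(s)\ge B^n_i(JT^n_i(t))+Q^n_i(JT^n_i(t))\}$ (time that customer enters service), $WT^n_i(t)=RT^n_i(t)-JT^n_i(t)$ (its waiting time), $AT^n_{ij}=\inf\{t\ge0:E^n_i(t)\ge j\}$ (arrival time of customer $(i,j)$), $WT^n_{ij}=WT^n_i(AT^n_{ij})$, $\widehat{WT}^n_{ij}=\sqrt n\,WT^n_{ij}$. Game. A strategy is a map $\mathbb{Z}_+\to\{0,1\}$; a strategy profile is a family $\sigma=\{\sigma_{ij}\}$ of strategies indexed by $(i,j)\in\{1,\dots,N\}\times\mathbb{N}$. When $\sigma$ is played, the dynamics are those with decisions $\delta_{ij}=\Delta^n_i(j)$, where $\Delta^n_i(j)=\sigma_{ij}(Q^n_i(AT^n_{ij}-))$ and $Q^n$ is the queue length under these same decisions (this determines decisions and dynamics uniquely, by induction over arrival times). Fix $\bar T\in(0,\infty)$, constants $r_i>0$, and functions $h_i:\mathbb{R}_+\to\mathbb{R}_+$ that are continuous, strictly increasing, with $h_i(0)=0$, $i=1,\dots,N$. For a profile $\sigma$ write $\sigma^{ij}=\{\sigma_{kl}:(k,l)\neq(i,j)\}$. The (random) cost of customer $(i,j)$ when $\sigma=(\sigma_{ij},\sigma^{ij})$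 is played is $$C^n_{ij}(\sigma_{ij},\sigma^{ij})=\begin{cases}r_i,&\Delta^n_i(j)=0,\ AT^n_{ij}\le\bar T,\\ h_i(\widehat{WT}^n_{ij}),&\Delta^n_i(j)=1,\ AT^n_{ij}\le\bar T,\\ 0,&AT^n_{ij}>\bar T,\end{cases}$$ with $\Delta^n$ and $\widehat{WT}^n$ computed under $\sigma$. *)

theory Defs
  imports "HOL-Probability.Probability" "HOL-Library.Landau_Symbols"
begin

text \<open>
  Customer classes are the elements of a type \<open>'c\<close> of class \<open>{finite, linorder}\<close>, so the number
  of classes is the cardinality of \<open>'c\<close> and the priority order is the order of \<open>'c\<close>. Customers
  of a class are numbered from 1. Sample paths are functions on \<open>real\<close> of which only the values
  at times \<open>t \<ge> 0\<close> matter.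
\<close>

section \<open>Probabilistic notions\<close>

definition converges_in_distribution ::
    "(nat \<Rightarrow> 'a measure) \<Rightarrow> (nat \<Rightarrow> 'a \<Rightarrow> 'x::topological_space) \<Rightarrow> 'b measure \<Rightarrow> ('b \<Rightarrow> 'x) \<Rightarrow> bool"
  where "converges_in_distribution M X L Y \<longleftrightarrow>
    (\<forall>f :: 'x \<Rightarrow> real. continuous_on UNIV f \<longrightarrow> bounded (range f) \<longrightarrow>
       (\<lambda>n. \<integral>\<omega>. f (X n \<omega>) \<partial>M n) \<longlonglongrightarrow> (\<integral>\<omega>. f (Y \<omega>) \<partial>L))"

definition generated_sigma :: "'a measure \<Rightarrow> 'i set \<Rightarrow> ('i \<Rightarrow> 'a \<Rightarrow> nat) \<Rightarrow> 'a set set"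
  where "generated_sigma M I X =
    sigma_sets (space M) {X i -` A \<inter> space M | i A. i \<in> I}"

definition poisson_process :: "'a measure \<Rightarrow> real \<Rightarrow> (real \<Rightarrow> 'a \<Rightarrow> nat) \<Rightarrow> bool"
  where "poisson_process M r S \<longleftrightarrow>
    (\<forall>t\<ge>0. S t \<in> measurable M (count_space UNIV)) \<and>
    (AE \<omega> in M. S 0 \<omega> = 0 \<and> (\<forall>t\<ge>0. continuous (at_right t) (\<lambda>u. S u \<omega>))) \<and>
    (\<forall>s t k. 0 \<le> s \<longrightarrow> s < t \<longrightarrow>
       measure M {\<omega> \<in> space M. S t \<omega> = S s \<omega> + k} = pmf (poisson_pmf (r * (t - s))) k) \<and>
    (\<forall>t :: nat \<Rightarrow> real. 0 \<le> t 0 \<longrightarrow> mono t \<longrightarrow>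
       prob_space.indep_vars M (\<lambda>_. count_space UNIV)
         (\<lambda>k \<omega>. int (S (t (Suc k)) \<omega>) - int (S (t k) \<omega>)) UNIV)"


section \<open>Decisions and arrivals\<close>

type_synonym strategy = "nat \<Rightarrow> bool"  (* queue length to decision; True = join, False = leave *)
type_synonym 'c profile = "'c \<Rightarrow> nat \<Rightarrow> strategy"
type_synonym 'c counts = "'c \<Rightarrow> real \<Rightarrow> nat"

definition left_lim :: "(real \<Rightarrow> nat) \<Rightarrow> real \<Rightarrow> nat"
  where "left_lim f t = Lim (at_left t) f"

definition arrivals :: "('c \<Rightarrow> nat \<Rightarrow> 'a \<Rightarrow> real) \<Rightarrow> ('c \<Rightarrow> real) \<Rightarrow> 'a \<Rightarrow> 'c counts"
  where "arrivals IA rate \<omega> i t = Sup {l. (\<Sum>k=1..l. IA i k \<omega> / rate i) \<le> t}"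

definition joined :: "'c counts \<Rightarrow> ('c \<Rightarrow> nat \<Rightarrow> bool) \<Rightarrow> 'c counts"
  where "joined E \<delta> i t = (\<Sum>j=1..E i t. of_bool (\<delta> i j))"

definition reneged :: "'c counts \<Rightarrow> ('c \<Rightarrow> nat \<Rightarrow> bool) \<Rightarrow> 'c counts"
  where "reneged E \<delta> i t = (\<Sum>j=1..E i t. of_bool (\<not> \<delta> i j))"

text \<open>Random times take values in \<^typ>\<open>ereal\<close>, where \<open>Inf {} = \<infinity>\<close>.\<close>

definition arrival_time :: "'c counts \<Rightarrow> 'c \<Rightarrow> nat \<Rightarrow> ereal"
  where "arrival_time E i j = Inf (ereal ` {t. 0 \<le> t \<and> j \<le> E i t})"


section \<open>System dynamics\<close>

record 'c paths =
  queue :: "'c counts"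
  in_service :: "'c counts"
  routed :: "'c counts"
  departed :: "'c counts"

text \<open>
  A rule for breaking ties under SLQ is an arbitrary fixed non-anticipating function: it
  determines the routing counts at time \<open>t\<close> from the number of servers, the initial state, the
  time \<open>t\<close>, the arrivals, refusals and departures during \<open>[0,t]\<close>, and the routing during \<open>[0,t)\<close>.
  That it picks from a longest queue is imposed by the SLQ condition itself.
\<close>

type_synonym 'c tie_rule =
  "nat \<Rightarrow> ('c \<Rightarrow> nat) \<Rightarrow> ('c \<Rightarrow> nat) \<Rightarrow> real
     \<Rightarrow> (real \<Rightarrow> 'c \<Rightarrow> nat \<times> nat \<times> nat) \<Rightarrow> (real \<Rightarrow> 'c \<Rightarrow> nat) \<Rightarrow> 'c \<Rightarrow> nat"

datatype 'c policy = FP | SLQ "'c tie_rule"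

text \<open>The Lebesgue-Stieltjes measure of a counting path, with the convention \<open>f(0-) = 0\<close>.\<close>

definition stieltjes :: "(real \<Rightarrow> nat) \<Rightarrow> real measure"
  where "stieltjes f = interval_measure (\<lambda>t. if t < 0 then 0 else real (f t))"

definition fp_condition :: "'c::{finite,linorder} paths \<Rightarrow> bool"
  where "fp_condition X \<longleftrightarrow>
    (\<forall>i. (\<integral>\<^sup>+ t\<in>{0..}. (\<Sum>k\<in>{..<i}. ennreal (real (queue X k t))) \<partial>stieltjes (routed X i)) = 0)"

definition slq_condition :: "'c::finite paths \<Rightarrow> bool"
  where "slq_condition X \<longleftrightarrow>
    (\<forall>i. (\<integral>\<^sup>+ t\<in>{0..}.
        indicator {s. left_lim (queue X i) s < Max (range (\<lambda>k. left_lim (queue X k) s))} t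
        \<partial>stieltjes (routed X i)) = 0)"

definition follows_policy :: "'c::{finite,linorder} policy \<Rightarrow> nat \<Rightarrow> ('c \<Rightarrow> nat) \<Rightarrow> ('c \<Rightarrow> nat) \<Rightarrow>
    'c counts \<Rightarrow> ('c \<Rightarrow> nat \<Rightarrow> bool) \<Rightarrow> 'c paths \<Rightarrow> bool"
  where "follows_policy pol n q0 \<psi>0 E \<delta> X \<longleftrightarrow> (case pol of
      FP \<Rightarrow> fp_condition X
    | SLQ tie \<Rightarrow> slq_condition X \<and>
        (\<forall>t\<ge>0. \<forall>i. routed X i t = tie n q0 \<psi>0 t
           (\<lambda>s\<in>{0..t}. \<lambda>k. (E k s, reneged E \<delta> k s, departed X k s))
           (\<lambda>s\<in>{0..<t}. \<lambda>k. routed X k s) i))"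

definition dynamics :: "'c::{finite,linorder} policy \<Rightarrow> nat \<Rightarrow> ('c \<Rightarrow> nat) \<Rightarrow> ('c \<Rightarrow> nat) \<Rightarrow>
    'c counts \<Rightarrow> 'c counts \<Rightarrow> ('c \<Rightarrow> nat \<Rightarrow> bool) \<Rightarrow> 'c paths \<Rightarrow> bool"
  where "dynamics pol n q0 \<psi>0 E S \<delta> X \<longleftrightarrow>
    (\<forall>i. routed X i 0 = 0 \<and> mono_on {0..} (routed X i)) \<and>
    (\<forall>i. \<forall>t\<ge>0. continuous (at_right t) (queue X i) \<and> continuous (at_right t) (in_service X i) \<and>
       continuous (at_right t) (routed X i) \<and> continuous (at_right t) (departed X i)) \<and>
    (\<forall>i. \<forall>t\<ge>0.
       int (queue X i t) = int (q0 i) + int (E i t) - int (routed X i t) - int (reneged E \<delta> i t) \<and>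
       int (in_service X i t) = int (\<psi>0 i) + int (routed X i t) - int (departed X i t) \<and>
       departed X i t = S i (integral {0..t} (\<lambda>u. real (in_service X i u)))) \<and>
    (\<forall>t\<ge>0. (\<Sum>i\<in>UNIV. in_service X i t) \<le> n) \<and>
    (\<forall>t\<ge>0. 0 < (\<Sum>i\<in>UNIV. queue X i t) \<longrightarrow> (\<Sum>i\<in>UNIV. in_service X i t) = n) \<and>
    follows_policy pol n q0 \<psi>0 E \<delta> X"


section \<open>The game\<close>

definition decisions :: "'c counts \<Rightarrow> 'c paths \<Rightarrow> 'c profile \<Rightarrow> 'c \<Rightarrow> nat \<Rightarrow> bool"
  where "decisions E X \<sigma> i j = \<sigma> i j (left_lim (queue X i) (real_of_ereal (arrival_time E i j)))"

text \<open>The decisions entering the dynamics are read off the resulting queue lengths themselves.\<close>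

definition played :: "'c::{finite,linorder} policy \<Rightarrow> nat \<Rightarrow> ('c \<Rightarrow> nat) \<Rightarrow> ('c \<Rightarrow> nat) \<Rightarrow>
    'c counts \<Rightarrow> 'c counts \<Rightarrow> 'c profile \<Rightarrow> 'c paths \<Rightarrow> bool"
  where "played pol n q0 \<psi>0 E S \<sigma> X \<longleftrightarrow> dynamics pol n q0 \<psi>0 E S (decisions E X \<sigma>) X"

definition joining_time :: "(real \<Rightarrow> nat) \<Rightarrow> real \<Rightarrow> ereal"
  where "joining_time J t =
    Inf (ereal ` {s. t \<le> s \<and> (if t \<le> 0 then 0 else left_lim J t) < J s})"

definition routing_time :: "(real \<Rightarrow> nat) \<Rightarrow> (real \<Rightarrow> nat) \<Rightarrow> (real \<Rightarrow> nat) \<Rightarrow> real \<Rightarrow> ereal"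
  where "routing_time J B Q t = (case joining_time J t of
      ereal u \<Rightarrow> Inf (ereal ` {s. t < s \<and> B u + Q u \<le> B s})
    | _ \<Rightarrow> \<infinity>)"

definition waiting_time :: "(real \<Rightarrow> nat) \<Rightarrow> (real \<Rightarrow> nat) \<Rightarrow> (real \<Rightarrow> nat) \<Rightarrow> real \<Rightarrow> ereal"
  where "waiting_time J B Q t = routing_time J B Q t - joining_time J t"

text \<open>A waiting time may be infinite; a cost function takes its limiting value there.\<close>

definition extend_infinity :: "(real \<Rightarrow> real) \<Rightarrow> ereal \<Rightarrow> ereal"
  where "extend_infinity h x =
    (if x = \<infinity> then (SUP y\<in>{0..}. ereal (h y)) else ereal (h (real_of_ereal x)))"

definition cost :: "('c \<Rightarrow> real \<Rightarrow> real) \<Rightarrow> ('c \<Rightarrow> real) \<Rightarrow> real \<Rightarrow> nat \<Rightarrow> 'c counts \<Rightarrow> 'c profile \<Rightarrow>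
    'c paths \<Rightarrow> 'c \<Rightarrow> nat \<Rightarrow> ereal"
  where "cost h r Tbar n E \<sigma> X i j =
    (let \<delta> = decisions E X \<sigma>;
         WT = waiting_time (joined E \<delta> i) (routed X i) (queue X i)
                (real_of_ereal (arrival_time E i j))
     in if arrival_time E i j \<le> ereal Tbar
        then (if \<delta> i j then extend_infinity (h i) (ereal (sqrt (real n)) * WT) else ereal (r i))
        else 0)"

definition threshold_profile ::
    "('c \<Rightarrow> real \<Rightarrow> real) \<Rightarrow> ('c \<Rightarrow> real) \<Rightarrow> ('c \<Rightarrow> real) \<Rightarrow> nat \<Rightarrow> 'c profile"
  where "threshold_profile h r lam n i j q \<longleftrightarrow> h i (real q / (sqrt (real n) * lam i)) \<le> r i"

definition deviate :: "'c profile \<Rightarrow> 'c \<Rightarrow> nat \<Rightarrow> strategy \<Rightarrow> 'c profile"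
  where "deviate \<sigma> i j \<tau> = \<sigma>(i := (\<sigma> i)(j := \<tau>))"

end

theory Submission
  imports Defs "HOL-Real_Asymp.Real_Asymp"
begin

text \<open>
  A customer joining behind \<open>q\<close> customers of class \<open>i\<close> should wait about \<open>q / (n * lam i)\<close>, so that
  joining costs about \<open>h i (q / (sqrt n * lam i))\<close>: the threshold rule then compares the two costs
  correctly, up to an error, whatever the customer decides. The point is that over
  time windows of length of order \<open>1 / sqrt n\<close> the number of class-\<open>i\<close> customers routed to service is
  \<open>n * lam i\<close> times the length, up to an error \<open>o(sqrt n)\<close>. All randomness is put into one event of
  probability tending to 1, on which the increments of every arrival process and of every
  Poisson process over a window of length \<open>s\<close> deviate from their means by at most
  \<open>\<eta> * (sqrt n + n * s)\<close>; the rest is an analysis of single paths, valid for all deviations of a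
  single customer at once.

  On that event a reflection argument (customers refuse only when all servers are busy) and
  Gronwall's inequality give \<open>Psi i = n * lam i / mu i + o(n)\<close>, so the departures have rate
  \<open>n * lam i\<close> as well. Each policy serves some set of classes exclusively while its queues are too
  long compared with the others; hence the queue lengths are, up to \<open>o(sqrt n)\<close>, fixed
  multiples of the total queue (zero for all but the lowest class under FP, equal under SLQ). The
  total queue cannot exceed the smallest level at which some class refuses by more than \<open>o(sqrt n)\<close>,
  and refusals need the total queue to be near that level; therefore neither refusals nor queue
  lengths change by more than \<open>o(sqrt n)\<close> over a window.

  A deviating customer sees the same queue as under the original profile, since the paths agree up to
  the arrival time.
\<close>

section \<open>Partial sums of independent variables over windows\<close>

text \<open>No limit is taken along paths: every path estimate is an inequality for one fixed n with
  explicit small constants. The error form \<open>\<eta> * (sqrt n + n * s)\<close> serves two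
  scales. Over windows of fixed length it is of order \<open>\<eta> * n\<close>, enough for the
  fluid estimate. Over windows of length \<open>\<sigma> / sqrt n\<close> it is
  \<open>\<eta> * (1 + \<sigma>) * sqrt n\<close>, while an imbalance of rates of order n
  contributes order \<open>\<sigma> * sqrt n\<close>. So \<sigma> is fixed small enough that queues
  hardly move within a window, and \<eta> is then taken small against \<sigma>: drift beats noise in
  each window, and a quantity with negative drift above a level never exceeds it. The obstacle is
  circularity: departures depend on the numbers in service, these on the routing, and the routing on
  refusals and queues. Balance of total counts breaks the circle, since refusals and the total queue
  are bounded by the net input whatever the policy does. The policy enters only when departures are
  already under control on short windows.\<close>

lemma exp_le_quadratic:
  fixes x c :: real
  assumes "x \<le> c" "0 \<le> c"
  shows "exp x \<le> 1 + x + x\<^sup>2 * exp c"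
proof -
  \<comment> \<open>The starting point is \<open>exp x * (1 - x) \<le> 1\<close>, used twice if x is
    nonnegative. Since x is bounded from above only, the estimate suits variables truncated on one
    side.\<close>
  have "1 - x \<le> exp (- x)" using exp_ge_add_one_self[of "- x"] by simp
  then have "exp x * (1 - x) \<le> exp x * exp (- x)" by (intro mult_left_mono) auto
  then have 1: "exp x \<le> 1 + x * exp x" by (simp add: exp_minus algebra_simps)
  have c: "1 \<le> exp c" "exp x \<le> exp c" using assms by auto
  show ?thesis
  proof (cases "x \<ge> 0")
    case True
    have "x * exp x \<le> x * (1 + x * exp x)" using 1 True by (intro mult_left_mono)
    also have "\<dots> = x + x\<^sup>2 * exp x" by (simp add: power2_eq_square algebra_simps)
    also have "\<dots> \<le> x + x\<^sup>2 * exp c" using c by (intro add_left_mono mult_left_mono) auto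
    finally show ?thesis using 1 by simp
  next
    case False
    have "x * exp x \<le> x * (1 + x)" using False by (intro mult_left_mono_neg) (auto simp: exp_ge_add_one_self)
    moreover have "x\<^sup>2 * 1 \<le> x\<^sup>2 * exp c" using c by (intro mult_left_mono) auto
    ultimately show ?thesis using 1 by (simp add: power2_eq_square algebra_simps)
  qed
qed

section \<open>Chernoff bounds for truncated sums, uniformly over windows\<close>

context prob_space
begin

text \<open>Chebyshev's inequality with the square kept inside the tail event: by dominated
  convergence a finite second moment improves O(1/n) to o(1/n), which is what a union over order n
  terms requires.\<close>

lemma tail_square_integrable:
  fixes Y :: "'a \<Rightarrow> real"
  assumes Y[measurable]: "random_variable borel Y"
    and sq: "integrable M (\<lambda>\<omega>. (Y \<omega>)\<^sup>2)" and b: "b > 0"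
  shows "(\<lambda>n. real n * prob {\<omega>\<in>space M. Y \<omega> > b * sqrt (real n)}) \<longlonglongrightarrow> 0"
proof -
  let ?f = "\<lambda>n \<omega>. (Y \<omega>)\<^sup>2 / b\<^sup>2 * indicator {\<omega>. Y \<omega> > b * sqrt (real n)} \<omega>"
  have "(\<lambda>n. \<integral>\<omega>. ?f n \<omega> \<partial>M) \<longlonglongrightarrow> (\<integral>\<omega>. 0 \<partial>M)"
  proof (rule integral_dominated_convergence[where w="\<lambda>\<omega>. (Y \<omega>)\<^sup>2 / b\<^sup>2"])
    show "AE \<omega> in M. (\<lambda>n. ?f n \<omega>) \<longlonglongrightarrow> 0"
    proof (rule AE_I2)
      fix \<omega>
      have "filterlim (\<lambda>n. b * sqrt (real n)) at_top sequentially" using b by real_asymp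
      then have "\<forall>\<^sub>F n in sequentially. b * sqrt (real n) > Y \<omega>"
        by (simp add: filterlim_at_top_dense)
      then have "\<forall>\<^sub>F n in sequentially. ?f n \<omega> = 0" by eventually_elim auto
      then show "(\<lambda>n. ?f n \<omega>) \<longlonglongrightarrow> 0" by (rule tendsto_eventually)
    qed
    show "AE \<omega> in M. norm (?f n \<omega>) \<le> (Y \<omega>)\<^sup>2 / b\<^sup>2" for n
      by (auto simp: indicator_def)
    show "integrable M (\<lambda>\<omega>. (Y \<omega>)\<^sup>2 / b\<^sup>2)" using sq by auto
  qed auto
  then have lim: "(\<lambda>n. \<integral>\<omega>. ?f n \<omega> \<partial>M) \<longlonglongrightarrow> 0" by simp
  have le: "real n * prob {\<omega>\<in>space M. Y \<omega> > b * sqrt (real n)} \<le> (\<integral>\<omega>. ?f n \<omega> \<partial>M)" for n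
  proof -
    have "real n * prob {\<omega>\<in>space M. Y \<omega> > b * sqrt (real n)}
       = (\<integral>\<omega>. real n * indicator {\<omega>\<in>space M. Y \<omega> > b * sqrt (real n)} \<omega> \<partial>M)"
      by simp
    also have "\<dots> \<le> (\<integral>\<omega>. ?f n \<omega> \<partial>M)"
    proof (rule integral_mono)
      show "integrable M (?f n)"
        by (rule Bochner_Integration.integrable_bound[where f="\<lambda>\<omega>. (Y \<omega>)\<^sup>2 / b\<^sup>2"])
          (use sq in \<open>auto simp: indicator_def\<close>)
      fix \<omega> assume "\<omega> \<in> space M"
      show "real n * indicator {\<omega>\<in>space M. Y \<omega> > b * sqrt (real n)} \<omega> \<le> ?f n \<omega>"
      proof (cases "Y \<omega> > b * sqrt (real n)")
        case True
        have "(b * sqrt (real n))\<^sup>2 \<le> (Y \<omega>)\<^sup>2" using True b by (intro power_mono) auto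
        then have "real n * b\<^sup>2 \<le> (Y \<omega>)\<^sup>2" by (simp add: power_mult_distrib mult.commute)
        then show ?thesis using True b by (auto simp: indicator_def field_simps)
      qed auto
    qed (auto simp: integrable_real_indicator emeasure_eq_measure)
    finally show ?thesis .
  qed
  show ?thesis
    by (rule tendsto_sandwich[OF _ _ tendsto_const lim]) (use le in auto)
qed

text \<open>Truncating from above keeps the linear term of the exponential at most
  \<open>\<theta> * Y\<close>, whose mean is 0, and does not increase the square, so the truncated
  variables need no recentring. Large negative values do no harm to an upper bound.\<close>

lemma chernoff_truncated:
  fixes Y :: "nat \<Rightarrow> 'a \<Rightarrow> real"
  assumes indep: "indep_vars (\<lambda>_. borel) Y I" and I: "finite I"
    and int: "\<And>i. i \<in> I \<Longrightarrow> integrable M (Y i)" and mean: "\<And>i. i \<in> I \<Longrightarrow> expectation (Y i) = 0"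
    and sq: "\<And>i. i \<in> I \<Longrightarrow> integrable M (\<lambda>\<omega>. (Y i \<omega>)\<^sup>2)"
    and var: "\<And>i. i \<in> I \<Longrightarrow> expectation (\<lambda>\<omega>. (Y i \<omega>)\<^sup>2) \<le> v"
    and th: "\<theta> > 0" and c: "c > 0"
  shows "prob {\<omega>\<in>space M. (\<Sum>i\<in>I. min (Y i \<omega>) c) \<ge> a}
          \<le> exp (- \<theta> * a + real (card I) * (\<theta>\<^sup>2 * v * exp (\<theta> * c)))"
proof -
  have rv[measurable]: "random_variable borel (Y i)" if "i \<in> I" for i
    using indep that by (auto simp: indep_vars_def)
  have mgf: "(\<integral>\<^sup>+\<omega>. ennreal (exp (\<theta> * min (Y i \<omega>) c)) \<partial>M) \<le> ennreal (exp (\<theta>\<^sup>2 * v * exp (\<theta> * c)))"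
    if i: "i \<in> I" for i
  proof -
    note [measurable] = rv[OF i]
    let ?k = "exp (\<theta> * c)"
    let ?g = "\<lambda>\<omega>. 1 + \<theta> * Y i \<omega> + \<theta>\<^sup>2 * (Y i \<omega>)\<^sup>2 * ?k"
    have pt: "exp (\<theta> * min (Y i \<omega>) c) \<le> ?g \<omega>" for \<omega>
    proof -
      have "exp (\<theta> * min (Y i \<omega>) c) \<le> 1 + \<theta> * min (Y i \<omega>) c + (\<theta> * min (Y i \<omega>) c)\<^sup>2 * ?k"
        using th c by (intro exp_le_quadratic) auto
      also have "\<dots> \<le> 1 + \<theta> * Y i \<omega> + (\<theta> * Y i \<omega>)\<^sup>2 * ?k"
      proof (intro add_mono mult_left_mono mult_right_mono)
        have "\<bar>min (Y i \<omega>) c\<bar> \<le> \<bar>Y i \<omega>\<bar>" using c by (auto simp: min_def)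
        then show "(\<theta> * min (Y i \<omega>) c)\<^sup>2 \<le> (\<theta> * Y i \<omega>)\<^sup>2"
          using th by (simp add: power_mult_distrib abs_le_square_iff)
      qed (use th in auto)
      finally show ?thesis by (simp add: power_mult_distrib)
    qed
    have intg: "integrable M ?g" using int[OF i] sq[OF i] by auto
    have "(\<integral>\<^sup>+\<omega>. ennreal (exp (\<theta> * min (Y i \<omega>) c)) \<partial>M) \<le> (\<integral>\<^sup>+\<omega>. ennreal (?g \<omega>) \<partial>M)"
      using pt by (intro nn_integral_mono ennreal_leI)
    also have "\<dots> = ennreal (expectation ?g)"
      using pt intg by (intro nn_integral_eq_integral) (auto intro!: AE_I2 intro: order_trans[OF exp_ge_zero pt])
    also have "expectation ?g = 1 + \<theta>\<^sup>2 * expectation (\<lambda>\<omega>. (Y i \<omega>)\<^sup>2) * ?k"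
      using int[OF i] sq[OF i] mean[OF i] by (simp add: prob_space)
    also have "\<dots> \<le> 1 + \<theta>\<^sup>2 * v * ?k" using var[OF i] by (intro add_left_mono mult_right_mono mult_left_mono) auto
    also have "\<dots> \<le> exp (\<theta>\<^sup>2 * v * ?k)" by (rule exp_ge_add_one_self)
    finally show ?thesis by (simp add: ennreal_leI)
  qed
  have "emeasure M {\<omega>\<in>space M. (\<Sum>i\<in>I. min (Y i \<omega>) c) \<ge> a} \<le> ennreal (exp (- \<theta> * a)) *
      (\<integral>\<^sup>+\<omega>\<in>space M. ennreal (exp (\<theta> * (\<Sum>i\<in>I. min (Y i \<omega>) c))) \<partial>M)"
    using th by (intro Chernoff_ineq_nn_integral_ge) auto
  also have "(\<integral>\<^sup>+\<omega>\<in>space M. ennreal (exp (\<theta> * (\<Sum>i\<in>I. min (Y i \<omega>) c))) \<partial>M)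
      = (\<integral>\<^sup>+\<omega>. (\<Prod>i\<in>I. ennreal (exp (\<theta> * min (Y i \<omega>) c))) \<partial>M)"
    by (intro nn_integral_cong) (simp add: sum_distrib_left exp_sum I prod_ennreal)
  also have "\<dots> = (\<Prod>i\<in>I. (\<integral>\<^sup>+\<omega>. ennreal (exp (\<theta> * min (Y i \<omega>) c)) \<partial>M))"
    by (intro indep_vars_nn_integral I indep_vars_compose2[OF indep]) auto
  also have "\<dots> \<le> (\<Prod>i\<in>I. ennreal (exp (\<theta>\<^sup>2 * v * exp (\<theta> * c))))"
    using mgf by (intro prod_mono_ennreal)
  also have "\<dots> = ennreal (exp (real (card I) * (\<theta>\<^sup>2 * v * exp (\<theta> * c))))"
    by (simp add: prod_ennreal exp_of_nat_mult ennreal_power)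
  finally have "emeasure M {\<omega>\<in>space M. (\<Sum>i\<in>I. min (Y i \<omega>) c) \<ge> a}
     \<le> ennreal (exp (- \<theta> * a) * exp (real (card I) * (\<theta>\<^sup>2 * v * exp (\<theta> * c))))"
    by (simp add: ennreal_mult mult_left_mono)
  then show ?thesis by (simp add: emeasure_eq_measure exp_add[symmetric])
qed

text \<open>
  Truncation at \<open>b * sqrt n\<close> has probability \<open>o(1 / n)\<close> of changing a given term. With an exponent of
  order \<open>ln n / sqrt n\<close> the Chernoff bound for one window is \<open>n powr - 4\<close>, which survives the union over
  all windows.
\<close>

lemma partial_sums_upper:
  fixes Y :: "nat \<Rightarrow> 'a \<Rightarrow> real"
  assumes indep: "indep_vars (\<lambda>_. borel) Y {1..}"
    and ident: "\<And>j. j \<ge> 1 \<Longrightarrow> distr M borel (Y j) = distr M borel (Y 1)"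
    and int: "integrable M (Y 1)" and mean: "expectation (Y 1) = 0"
    and sq: "integrable M (\<lambda>\<omega>. (Y 1 \<omega>)\<^sup>2)" and eta: "\<eta> > 0"
  shows "(\<lambda>n. prob {\<omega>\<in>space M. \<exists>k m. k + m \<le> A * n \<and>
            (\<Sum>j\<in>{k<..k+m}. Y j \<omega>) > \<eta> * (sqrt (real n) + real m)}) \<longlonglongrightarrow> 0"
proof -
  \<comment> \<open>With \<open>\<theta> n = 4 / \<eta> * ln n / sqrt n\<close> the factor
    \<open>exp (- \<theta> n * \<eta> * sqrt n)\<close> is n to the power -4, and truncation at
    \<open>b * sqrt n\<close> keeps \<open>exp (\<theta> n * b * sqrt n)\<close> down to n to the
    power 1/4.\<close>
  define b where "b = \<eta> / 16"
  define v where "v = expectation (\<lambda>\<omega>. (Y 1 \<omega>)\<^sup>2)"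
  define \<theta> where "\<theta> n = 4 / \<eta> * ln (real n) / sqrt (real n)" for n
  have b: "b > 0" using eta by (simp add: b_def)
  have v: "v \<ge> 0" by (simp add: v_def)
  have rv[measurable]: "random_variable borel (Y j)" if "j \<ge> 1" for j
    using indep that by (auto simp: indep_vars_def)
  have ex: "expectation (\<lambda>\<omega>. f (Y j \<omega>)) = expectation (\<lambda>\<omega>. f (Y 1 \<omega>))"
     "integrable M (\<lambda>\<omega>. f (Y j \<omega>)) \<longleftrightarrow> integrable M (\<lambda>\<omega>. f (Y 1 \<omega>))"
    if "f \<in> borel_measurable borel" "j \<ge> 1" for j and f :: "real \<Rightarrow> real"
    using integral_distr[OF rv[OF that(2)] that(1)] integral_distr[OF rv[of 1] that(1)]
       integrable_distr_eq[OF rv[OF that(2)] that(1)] integrable_distr_eq[OF rv[of 1] that(1)] ident[OF that(2)]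
    by auto
  have pr: "prob {\<omega>\<in>space M. Y j \<omega> > x} = prob {\<omega>\<in>space M. Y 1 \<omega> > x}" if "j \<ge> 1" for j x
  proof -
    have "prob {\<omega>\<in>space M. Y j \<omega> > x} = measure (distr M borel (Y j)) {x<..}" if "j \<ge> 1" for j
      using rv[OF that] by (subst measure_distr) (auto intro!: arg_cong[where f=prob])
    then show ?thesis using ident[OF that] that by simp
  qed
  let ?P = "\<lambda>n. SIGMA k:{..A*n}. {..A*n}"
  define W where "W n k m = {\<omega>\<in>space M. (\<Sum>j\<in>{k<..k+m}. min (Y j \<omega>) (b * sqrt (real n))) \<ge> \<eta> * (sqrt (real n) + real m)}"
    for n k m :: nat
  define U where "U n j = {\<omega>\<in>space M. Y j \<omega> > b * sqrt (real n)}" for n j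
  have [measurable]: "W n k m \<in> events" for n k m unfolding W_def by measurable
  have [measurable]: "U n j \<in> events" if "j \<ge> 1" for n j unfolding U_def using that by measurable
  have UW: "(\<Union>(k,m)\<in>?P n. W n k m) \<in> events" "(\<Union>j\<in>{1..A*n}. U n j) \<in> events" for n
    by (intro sets.finite_UN; auto)+
  have sub: "{\<omega>\<in>space M. \<exists>k m. k + m \<le> A * n \<and> (\<Sum>j\<in>{k<..k+m}. Y j \<omega>) > \<eta> * (sqrt (real n) + real m)}
     \<subseteq> (\<Union>(k,m)\<in>?P n. W n k m) \<union> (\<Union>j\<in>{1..A*n}. U n j)" for n
  proof safe
    fix \<omega> k m assume w: "\<omega> \<in> space M" "k + m \<le> A * n" "(\<Sum>j\<in>{k<..k+m}. Y j \<omega>) > \<eta> * (sqrt (real n) + real m)"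
      and nU: "\<omega> \<notin> (\<Union>j\<in>{1..A*n}. U n j)"
    have "min (Y j \<omega>) (b * sqrt (real n)) = Y j \<omega>" if "j \<in> {k<..k+m}" for j
    proof -
      have "j \<in> {1..A*n}" using w that by auto
      then have "\<omega> \<notin> U n j" using nU by blast
      then show ?thesis using w by (auto simp: U_def)
    qed
    then have "(\<Sum>j\<in>{k<..k+m}. min (Y j \<omega>) (b * sqrt (real n))) = (\<Sum>j\<in>{k<..k+m}. Y j \<omega>)"
      by (intro sum.cong) auto
    then have "\<omega> \<in> W n k m" using w by (simp add: W_def)
    moreover have "(k, m) \<in> ?P n" using w by auto
    ultimately show "\<omega> \<in> (\<Union>(k,m)\<in>?P n. W n k m)" by blast
  qed
  have "\<forall>\<^sub>F n in sequentially. \<theta> n * (v * (real n powr (1/4))) \<le> \<eta>"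
  proof -
    have "(\<lambda>n::nat. \<theta> n * (v * (real n powr (1/4)))) \<longlonglongrightarrow> 0"
      unfolding \<theta>_def using eta by real_asymp
    from order_tendstoD(2)[OF this eta] show ?thesis by eventually_elim simp
  qed
  then have W: "\<forall>\<^sub>F n in sequentially. \<forall>k m. prob (W n k m) \<le> real n powr (-4)"
    using eventually_gt_at_top[of 1]
  proof eventually_elim
    case (elim n)
    have th: "\<theta> n > 0" using elim eta by (simp add: \<theta>_def)
    have "prob (W n k m) \<le> real n powr (-4)" for k m
    proof -
      have "prob (W n k m) \<le> exp (- \<theta> n * (\<eta> * (sqrt (real n) + real m))
          + real (card {k<..k+m}) * ((\<theta> n)\<^sup>2 * v * exp (\<theta> n * (b * sqrt (real n)))))"
        unfolding W_def
      proof (rule chernoff_truncated)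
        show "indep_vars (\<lambda>_. borel) Y {k<..k+m}" by (rule indep_vars_subset[OF indep]) auto
              fix i assume "i \<in> {k<..k+m}"
        then have i: "i \<ge> 1" by auto
        show "integrable M (Y i)" using ex(2)[of "\<lambda>x. x", OF _ i] int by simp
        show "expectation (Y i) = 0" using ex(1)[of "\<lambda>x. x", OF _ i] mean by simp
        show "integrable M (\<lambda>\<omega>. (Y i \<omega>)\<^sup>2)" using ex(2)[of "\<lambda>x. x\<^sup>2", OF _ i] sq by simp
        show "expectation (\<lambda>\<omega>. (Y i \<omega>)\<^sup>2) \<le> v" using ex(1)[of "\<lambda>x. x\<^sup>2", OF _ i] by (simp add: v_def)
      qed (use th b elim in auto)
      also have "exp (\<theta> n * (b * sqrt (real n))) = real n powr (1/4)"
        using elim eta by (simp add: \<theta>_def b_def powr_def)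
      also have "exp (- \<theta> n * (\<eta> * (sqrt (real n) + real m)) + real (card {k<..k+m}) * ((\<theta> n)\<^sup>2 * v * (real n powr (1/4))))
         \<le> exp (- \<theta> n * \<eta> * sqrt (real n))"
      proof -
        \<comment> \<open>The term \<open>\<eta> * m\<close> of the allowed deviation pays for the
          variance of the m summands; this is why the error grows with the window length.\<close>
        have "real m * \<theta> n * (\<theta> n * (v * (real n powr (1/4)))) \<le> real m * \<theta> n * \<eta>"
          using elim th by (intro mult_left_mono) auto
        then show ?thesis by (simp add: power2_eq_square algebra_simps)
      qed
      also have "\<dots> = real n powr (-4)" using elim eta by (simp add: \<theta>_def powr_def)
      finally show ?thesis .
    qed
    then show ?case by blast
  qed
  have le: "\<forall>\<^sub>F n in sequentially. prob {\<omega>\<in>space M. \<exists>k m. k + m \<le> A * n \<and> (\<Sum>j\<in>{k<..k+m}. Y j \<omega>) > \<eta> * (sqrt (real n) + real m)}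
     \<le> (real A * real n + 1)^2 * real n powr (-4) + real A * (real n * prob {\<omega>\<in>space M. Y 1 \<omega> > b * sqrt (real n)})"
    using W
  proof eventually_elim
    case (elim n)
    have "prob {\<omega>\<in>space M. \<exists>k m. k + m \<le> A * n \<and> (\<Sum>j\<in>{k<..k+m}. Y j \<omega>) > \<eta> * (sqrt (real n) + real m)}
       \<le> prob ((\<Union>(k,m)\<in>?P n. W n k m) \<union> (\<Union>j\<in>{1..A*n}. U n j))"
      by (rule finite_measure_mono[OF sub]) (intro sets.Un UW)
    also have "\<dots> \<le> prob (\<Union>(k,m)\<in>?P n. W n k m) + prob (\<Union>j\<in>{1..A*n}. U n j)"
      by (rule measure_Un_le) (rule UW)+
    also have "\<dots> \<le> (\<Sum>x\<in>?P n. prob (case x of (k, m) \<Rightarrow> W n k m)) + (\<Sum>j\<in>{1..A*n}. prob (U n j))"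
      by (intro add_mono finite_measure_subadditive_finite) auto
    also have "\<dots> \<le> (\<Sum>x\<in>?P n. real n powr (-4)) + (\<Sum>j\<in>{1..A*n}. prob {\<omega>\<in>space M. Y 1 \<omega> > b * sqrt (real n)})"
    proof (intro add_mono sum_mono)
      show "prob (U n j) \<le> prob {\<omega>\<in>space M. Y 1 \<omega> > b * sqrt (real n)}" if "j \<in> {1..A*n}" for j
        using pr[of j "b * sqrt (real n)"] that by (simp add: U_def)
    qed (use elim in auto)
    finally show ?case by (simp add: power2_eq_square algebra_simps)
  qed
  have lim: "(\<lambda>n. (real A * real n + 1)^2 * real n powr (-4) + real A * (real n * prob {\<omega>\<in>space M. Y 1 \<omega> > b * sqrt (real n)}))
     \<longlonglongrightarrow> 0 + real A * 0"
  proof (intro tendsto_add tendsto_mult tendsto_const tail_square_integrable sq b)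
    have 1: "(\<lambda>n. real n ^ 2 * real n powr (-4)) \<longlonglongrightarrow> 0" by real_asymp
    have 2: "(\<lambda>n. real n * real n powr (-4)) \<longlonglongrightarrow> 0" by real_asymp
    have 3: "(\<lambda>n. real n powr (-4)) \<longlonglongrightarrow> 0" by real_asymp
    show "(\<lambda>n. (real A * real n + 1)^2 * real n powr (-4)) \<longlonglongrightarrow> 0"
      using tendsto_add[OF tendsto_add[OF tendsto_mult[OF tendsto_const[of "(real A)\<^sup>2"] 1]
          tendsto_mult[OF tendsto_const[of "2 * real A"] 2]] 3]
      by (simp add: power2_eq_square algebra_simps)
  qed simp
  show ?thesis
    by (rule tendsto_sandwich[OF _ le tendsto_const]) (use lim in auto)
qed

text \<open>P need not be measurable: it will quantify over all customers and strategies, so a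
  measurable event on which P holds is asked for instead.\<close>

definition whp :: "(nat \<Rightarrow> 'a \<Rightarrow> bool) \<Rightarrow> bool"
  where "whp P \<longleftrightarrow> (\<exists>G. (\<forall>n. G n \<in> events) \<and> (\<lambda>n. prob (G n)) \<longlonglongrightarrow> 1 \<and> (\<forall>n. \<forall>\<omega>\<in>G n. P n \<omega>))"

lemma whp_mono: "whp P \<Longrightarrow> (\<And>n \<omega>. \<omega> \<in> space M \<Longrightarrow> P n \<omega> \<Longrightarrow> Q n \<omega>) \<Longrightarrow> whp Q"
  unfolding whp_def using sets.sets_into_space by blast

lemma whp_conj:
  assumes "whp P" "whp Q"
  shows "whp (\<lambda>n \<omega>. P n \<omega> \<and> Q n \<omega>)"
proof -
  obtain G where G: "\<And>n. G n \<in> events" "(\<lambda>n. prob (G n)) \<longlonglongrightarrow> 1" "\<And>n \<omega>. \<omega> \<in> G n \<Longrightarrow> P n \<omega>"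
    using assms(1) unfolding whp_def by auto
  obtain H where H: "\<And>n. H n \<in> events" "(\<lambda>n. prob (H n)) \<longlonglongrightarrow> 1" "\<And>n \<omega>. \<omega> \<in> H n \<Longrightarrow> Q n \<omega>"
    using assms(2) unfolding whp_def by auto
  have lower: "prob (G n) + prob (H n) - 1 \<le> prob (G n \<inter> H n)" for n
    using measure_Un3[of "G n" M "H n"] prob_le_1[of "G n \<union> H n"] G H
    by (simp add: fmeasurable_eq_sets)
  have "(\<lambda>n. prob (G n \<inter> H n)) \<longlonglongrightarrow> 1"
  proof (rule tendsto_sandwich[OF _ _ _ tendsto_const])
    show "(\<lambda>n. prob (G n) + prob (H n) - 1) \<longlonglongrightarrow> 1"
      using tendsto_diff[OF tendsto_add[OF G(2) H(2)] tendsto_const[of 1]] by simp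
  qed (use lower in auto)
  then show ?thesis
    unfolding whp_def using G H by (intro exI[of _ "\<lambda>n. G n \<inter> H n"]) auto
qed

lemma whp_True: "whp (\<lambda>n \<omega>. True)"
  unfolding whp_def by (intro exI[of _ "\<lambda>_. space M"]) (auto simp: prob_space)

lemma whp_all_finite:
  assumes "finite I" "\<And>i. i \<in> I \<Longrightarrow> whp (P i)"
  shows "whp (\<lambda>n \<omega>. \<forall>i\<in>I. P i n \<omega>)"
  using assms
proof (induction I)
  case (insert i I)
  then have "whp (\<lambda>n \<omega>. P i n \<omega> \<and> (\<forall>i\<in>I. P i n \<omega>))" by (intro whp_conj) auto
  then show ?case by simp
qed (simp add: whp_True)

lemma whp_AE:
  assumes "AE \<omega> in M. P \<omega>"
  shows "whp (\<lambda>n. P)"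
proof -
  obtain N where N: "{\<omega>\<in>space M. \<not> P \<omega>} \<subseteq> N" "N \<in> events" "prob N = 0"
    using assms by (auto elim!: AE_E simp: emeasure_eq_measure)
  show ?thesis unfolding whp_def
    using N by (intro exI[of _ "\<lambda>_. space M - N"]) (auto simp: prob_compl)
qed

lemma whp_eventually:
  assumes "whp P" "\<forall>\<^sub>F n in sequentially. \<forall>\<omega>. P n \<omega> \<longrightarrow> Q n \<omega>"
  shows "whp Q"
proof -
  obtain G where G: "\<And>n. G n \<in> events" "(\<lambda>n. prob (G n)) \<longlonglongrightarrow> 1" "\<And>n \<omega>. \<omega> \<in> G n \<Longrightarrow> P n \<omega>"
    using assms(1) unfolding whp_def by auto
  obtain n0 where n0: "\<And>n \<omega>. n \<ge> n0 \<Longrightarrow> P n \<omega> \<Longrightarrow> Q n \<omega>"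
    using assms(2) by (auto simp: eventually_at_top_linorder)
  \<comment> \<open>The finitely many n for which the implication may fail get the empty event,
    which leaves the limit unchanged.\<close>
  let ?G = "\<lambda>n. if n \<ge> n0 then G n else {}"
  have "(\<lambda>n. prob (?G n)) \<longlonglongrightarrow> 1"
    by (rule Lim_transform_eventually[OF G(2)])
      (rule eventually_mono[OF eventually_ge_at_top[of n0]], simp)
  then show ?thesis unfolding whp_def using G n0 by (intro exI[of _ ?G]) auto
qed

lemma whp_if_bad_to_0:
  assumes lim: "(\<lambda>n. prob {\<omega>\<in>space M. \<not> P n \<omega>}) \<longlonglongrightarrow> 0"
    and meas: "\<forall>\<^sub>F n in sequentially. {\<omega>\<in>space M. \<not> P n \<omega>} \<in> events"
  shows "whp P"
proof -
  obtain n0 where n0: "\<And>n. n \<ge> n0 \<Longrightarrow> {\<omega>\<in>space M. \<not> P n \<omega>} \<in> events"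
    using meas by (auto simp: eventually_at_top_linorder)
  let ?G = "\<lambda>n. if n \<ge> n0 then space M - {\<omega>\<in>space M. \<not> P n \<omega>} else {}"
  have "(\<lambda>n. prob (?G n)) \<longlonglongrightarrow> 1"
  proof (rule Lim_transform_eventually)
    show "(\<lambda>n. 1 - prob {\<omega>\<in>space M. \<not> P n \<omega>}) \<longlonglongrightarrow> 1"
      using tendsto_diff[OF tendsto_const[of 1] lim] by simp
    show "\<forall>\<^sub>F n in sequentially. 1 - prob {\<omega>\<in>space M. \<not> P n \<omega>} = prob (?G n)"
      using eventually_ge_at_top[of n0] by eventually_elim (simp add: n0 prob_compl)
  qed
  then show ?thesis unfolding whp_def using n0 by (intro exI[of _ ?G]) auto
qed

text \<open>The one-sided estimate is applied to the centred variables times s, for s = 1 and s =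
  -1.\<close>

lemma partial_sums_window:
  fixes Y :: "nat \<Rightarrow> 'a \<Rightarrow> real"
  assumes indep: "indep_vars (\<lambda>_. borel) Y {1..}"
    and ident: "\<And>j. j \<ge> 1 \<Longrightarrow> distr M borel (Y j) = distr M borel (Y 1)"
    and int: "integrable M (Y 1)" and mean: "expectation (Y 1) = m"
    and sq: "integrable M (\<lambda>\<omega>. (Y 1 \<omega>)\<^sup>2)" and eta: "\<eta> > 0"
  shows "whp (\<lambda>n \<omega>. \<forall>k l. k + l \<le> A * n \<longrightarrow>
            \<bar>(\<Sum>j\<in>{k<..k+l}. Y j \<omega>) - m * real l\<bar> \<le> \<eta> * (sqrt (real n) + real l))"
proof -
  have rv[measurable]: "random_variable borel (Y j)" if "j \<ge> 1" for j
    using indep that by (auto simp: indep_vars_def)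
  have one_sided: "whp (\<lambda>n \<omega>. \<forall>k l. k + l \<le> A * n \<longrightarrow>
            s * ((\<Sum>j\<in>{k<..k+l}. Y j \<omega>) - m * real l) \<le> \<eta> * (sqrt (real n) + real l))" for s :: real
  proof -
    define Z where "Z j \<omega> = s * (Y j \<omega> - m)" for j \<omega>
    have Z: "(\<Sum>j\<in>{k<..k+l}. Z j \<omega>) = s * ((\<Sum>j\<in>{k<..k+l}. Y j \<omega>) - m * real l)" for k l \<omega>
      by (simp add: Z_def sum_distrib_left[symmetric] sum_subtractf mult.commute)
    have [measurable]: "random_variable borel (Z j)" if "j \<ge> 1" for j
      unfolding Z_def[abs_def] using that by measurable
    show ?thesis
    proof (rule whp_if_bad_to_0)
      have "(\<lambda>n. prob {\<omega>\<in>space M. \<exists>k l. k + l \<le> A * n \<and>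
            (\<Sum>j\<in>{k<..k+l}. Z j \<omega>) > \<eta> * (sqrt (real n) + real l)}) \<longlonglongrightarrow> 0"
      proof (rule partial_sums_upper)
        show "indep_vars (\<lambda>_. borel) Z {1..}"
          unfolding Z_def[abs_def] by (rule indep_vars_compose2[OF indep]) auto
        show "distr M borel (Z j) = distr M borel (Z 1)" if "j \<ge> 1" for j
        proof -
          have "distr M borel (Z j) = distr (distr M borel (Y j)) borel (\<lambda>x. s * (x - m))" if "j \<ge> 1" for j
            using that by (subst distr_distr) (auto simp: Z_def[abs_def] comp_def)
          then show ?thesis using that ident[OF that] by simp
        qed
        show "integrable M (Z 1)" "expectation (Z 1) = 0"
          unfolding Z_def[abs_def] using int mean by (auto simp: prob_space)
        have "(Z 1 \<omega>)\<^sup>2 = s\<^sup>2 * ((Y 1 \<omega>)\<^sup>2 - 2 * m * Y 1 \<omega> + m\<^sup>2)" for \<omega>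
          by (simp add: Z_def power2_eq_square algebra_simps)
        then show "integrable M (\<lambda>\<omega>. (Z 1 \<omega>)\<^sup>2)" using int sq by simp
      qed (fact eta)
      then show "(\<lambda>n. prob {\<omega>\<in>space M. \<not> (\<forall>k l. k + l \<le> A * n \<longrightarrow>
            s * ((\<Sum>j\<in>{k<..k+l}. Y j \<omega>) - m * real l) \<le> \<eta> * (sqrt (real n) + real l))}) \<longlonglongrightarrow> 0"
        by (simp add: Z not_le)
      have [measurable]: "(\<lambda>\<omega>. \<Sum>j\<in>{k<..k+l}. Y j \<omega>) \<in> borel_measurable M" for k l :: nat
        by (intro borel_measurable_sum rv) auto
      show "\<forall>\<^sub>F n in sequentially. {\<omega>\<in>space M. \<not> (\<forall>k l. k + l \<le> A * n \<longrightarrow>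
            s * ((\<Sum>j\<in>{k<..k+l}. Y j \<omega>) - m * real l) \<le> \<eta> * (sqrt (real n) + real l))} \<in> events"
        by (intro always_eventually allI) measurable
    qed
  qed
  show ?thesis
    by (rule whp_mono[OF whp_conj[OF one_sided[of 1] one_sided[of "-1"]]]) (force simp: abs_le_iff)
qed

end

section \<open>Poisson and renewal processes\<close>

lemma sums_poisson_pmf:
  fixes \<mu> :: real
  assumes "\<mu> > 0"
  shows "pmf (poisson_pmf \<mu>) sums 1"
proof -
  have p: "pmf (poisson_pmf \<mu>) = (\<lambda>k. \<mu> ^ k / fact k * exp (- \<mu>))" using assms by auto
  show ?thesis
    using sums_mult2[OF exp_converges[of \<mu>], of "exp (- \<mu>)"]
    unfolding p by (simp add: exp_minus field_simps scaleR_conv_of_real)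
qed

lemma sums_poisson_mean:
  fixes \<mu> :: real
  assumes "\<mu> > 0"
  shows "(\<lambda>k. pmf (poisson_pmf \<mu>) k * real k) sums \<mu>"
    and "summable (\<lambda>k. pmf (poisson_pmf \<mu>) k * (real k)\<^sup>2)"
proof -
  let ?p = "\<lambda>k. \<mu> ^ k / fact k * exp (- \<mu>)"
  have p: "pmf (poisson_pmf \<mu>) = ?p" using assms by auto
  have e: "?p sums 1" using sums_poisson_pmf[OF assms] unfolding p .
  have suc: "?p (Suc k) * real (Suc k) = \<mu> * ?p k" for k
    by (simp add: field_simps del: of_nat_Suc)
  have "(\<lambda>k. ?p (Suc k) * real (Suc k)) sums (\<mu> * 1)"
    unfolding suc by (rule sums_mult[OF e])
  then have s1: "(\<lambda>k. ?p k * real k) sums \<mu>"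
    using sums_Suc[of "\<lambda>k. ?p k * real k" \<mu>] by simp
  then show "(\<lambda>k. pmf (poisson_pmf \<mu>) k * real k) sums \<mu>" unfolding p .
  have "?p (Suc k) * (real (Suc k))\<^sup>2 = \<mu> * (?p k * real k) + \<mu> * ?p k" for k
  proof -
    have distr: "a * q * real (Suc k) = a * (q * real k) + a * q" for a q :: real
      by (simp add: algebra_simps)
    have "?p (Suc k) * (real (Suc k))\<^sup>2 = ?p (Suc k) * real (Suc k) * real (Suc k)"
      by (simp only: power2_eq_square mult.assoc)
    also have "\<dots> = \<mu> * ?p k * real (Suc k)" by (simp only: suc)
    finally show ?thesis using distr[of \<mu> "?p k"] by simp
  qed
  moreover have "summable (\<lambda>k. \<mu> * (?p k * real k) + \<mu> * ?p k)"
    using s1 e by (intro summable_add summable_mult) (auto simp: sums_iff)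
  ultimately have "summable (\<lambda>k. ?p (Suc k) * (real (Suc k))\<^sup>2)" by simp
  then show "summable (\<lambda>k. pmf (poisson_pmf \<mu>) k * (real k)\<^sup>2)"
    unfolding p summable_Suc_iff[of "\<lambda>k. ?p k * (real k)\<^sup>2"] .
qed

lemma poisson_pmf_moments:
  fixes \<mu> :: real
  assumes "\<mu> > 0"
  shows "integrable (measure_pmf (poisson_pmf \<mu>)) real"
    and "measure_pmf.expectation (poisson_pmf \<mu>) real = \<mu>"
    and "integrable (measure_pmf (poisson_pmf \<mu>)) (\<lambda>k. (real k)\<^sup>2)"
proof -
  have i1: "integrable (count_space UNIV) (\<lambda>k. pmf (poisson_pmf \<mu>) k * real k)"
    using sums_poisson_mean[OF assms] by (auto simp: integrable_count_space_nat_iff sums_iff)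
  show "integrable (measure_pmf (poisson_pmf \<mu>)) real"
    using i1 by (simp add: measure_pmf_eq_density integrable_density)
  show "integrable (measure_pmf (poisson_pmf \<mu>)) (\<lambda>k. (real k)\<^sup>2)"
    using sums_poisson_mean(2)[OF assms]
    by (simp add: measure_pmf_eq_density integrable_density integrable_count_space_nat_iff)
  have "measure_pmf.expectation (poisson_pmf \<mu>) real = (\<integral>k. pmf (poisson_pmf \<mu>) k * real k \<partial>count_space UNIV)"
    by (simp add: measure_pmf_eq_density integral_density)
  also have "\<dots> = \<mu>"
    using sums_unique2[OF sums_integral_count_space_nat[OF i1] sums_poisson_mean(1)[OF assms]] .
  finally show "measure_pmf.expectation (poisson_pmf \<mu>) real = \<mu>" .
qed

section \<open>Monotone paths and increments of Poisson processes\<close>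

context prob_space
begin

lemma nat_shift_eq_event:
  assumes "X \<in> measurable M (count_space UNIV)" "Y \<in> measurable M (count_space UNIV)"
  shows "{\<omega>\<in>space M. X \<omega> = Y \<omega> + (k::nat)} \<in> events"
proof -
  have [measurable]: "(\<lambda>\<omega>. real (X \<omega>)) \<in> borel_measurable M" "(\<lambda>\<omega>. real (Y \<omega>)) \<in> borel_measurable M"
    using assms by measurable
  have "{\<omega>\<in>space M. X \<omega> = Y \<omega> + k} = {\<omega>\<in>space M. real (X \<omega>) = real (Y \<omega>) + real k}"
    by (auto simp flip: of_nat_add)
  also have "\<dots> \<in> events" by measurable
  finally show ?thesis .
qed

text \<open>Monotone paths are not part of \<open>poisson_process\<close>. They follow because the
  disjoint events \<open>S t = S s + k\<close> for natural k have the probabilities of a Poisson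
  law, which add up to 1.\<close>

lemma poisson_increment_nonneg:
  assumes S: "poisson_process M \<mu> S" and mu: "\<mu> > 0" and st: "0 \<le> s" "s < t"
  shows "AE \<omega> in M. S s \<omega> \<le> S t \<omega>"
proof -
  have [measurable]: "S t \<in> measurable M (count_space UNIV)" "S s \<in> measurable M (count_space UNIV)"
    using S st by (auto simp: poisson_process_def)
  let ?A = "\<lambda>k. {\<omega>\<in>space M. S t \<omega> = S s \<omega> + k}"
  have "prob (\<Union>k. ?A k) = 1"
  proof -
    have "(\<lambda>k. prob (?A k)) sums prob (\<Union>k. ?A k)"
      by (rule finite_measure_UNION) (auto simp: disjoint_family_on_def intro!: nat_shift_eq_event)
    moreover have "prob (?A k) = pmf (poisson_pmf (\<mu> * (t - s))) k" for k
      using S st by (auto simp: poisson_process_def)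
    moreover have "(pmf (poisson_pmf (\<mu> * (t - s)))) sums 1"
      using mu st by (intro sums_poisson_pmf) auto
    ultimately show ?thesis using sums_unique2 by fastforce
  qed
  then have "AE \<omega> in M. \<omega> \<in> (\<Union>k. ?A k)"
    by (subst AE_in_set_eq_1) (auto intro!: nat_shift_eq_event)
  then show ?thesis by eventually_elim auto
qed

lemma poisson_increment_distr:
  assumes S: "poisson_process M \<mu> S" and mu: "\<mu> > 0" and st: "0 \<le> s" "s < t"
  shows "distr M (count_space UNIV) (\<lambda>\<omega>. S t \<omega> - S s \<omega>) = measure_pmf (poisson_pmf (\<mu> * (t - s)))"
proof (rule measure_eqI_countable[where A=UNIV])
  have [measurable]: "S t \<in> measurable M (count_space UNIV)" "S s \<in> measurable M (count_space UNIV)"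
    using S st by (auto simp: poisson_process_def)
  fix k
  have "prob {\<omega>\<in>space M. S t \<omega> - S s \<omega> = k} = prob {\<omega>\<in>space M. S t \<omega> = S s \<omega> + k}"
    by (rule finite_measure_eq_AE)
      (use poisson_increment_nonneg[OF S mu st] in \<open>auto elim!: AE_mp intro!: nat_shift_eq_event\<close>)
  also have "\<dots> = pmf (poisson_pmf (\<mu> * (t - s))) k"
    using S st by (auto simp: poisson_process_def)
  finally have "emeasure M {\<omega>\<in>space M. S t \<omega> - S s \<omega> = k} = ennreal (pmf (poisson_pmf (\<mu> * (t - s))) k)"
    by (simp add: emeasure_eq_measure)
  then show "emeasure (distr M (count_space UNIV) (\<lambda>\<omega>. S t \<omega> - S s \<omega>)) {k} =
      emeasure (measure_pmf (poisson_pmf (\<mu> * (t - s)))) {k}"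
    by (simp add: emeasure_distr emeasure_pmf_single vimage_def Int_def conj_commute)
qed auto

text \<open>Countably many pairs of rational times give one common null set; right continuity
  carries the inequality over to real times.\<close>

lemma poisson_mono_AE:
  assumes S: "poisson_process M \<mu> S" and mu: "\<mu> > 0"
  shows "AE \<omega> in M. S 0 \<omega> = 0 \<and> mono_on {0..} (\<lambda>t. S t \<omega>)"
proof -
  have rc: "AE \<omega> in M. S 0 \<omega> = 0 \<and> (\<forall>t\<ge>0. continuous (at_right t) (\<lambda>u. S u \<omega>))"
    using S by (auto simp: poisson_process_def)
  have "AE \<omega> in M. \<forall>s\<in>\<rat>. \<forall>t\<in>\<rat>. 0 \<le> s \<longrightarrow> s < t \<longrightarrow> S s \<omega> \<le> S t \<omega>"
    using poisson_increment_nonneg[OF S mu] by (auto simp: AE_ball_countable countable_rat)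
  then show ?thesis using rc
  proof eventually_elim
    case (elim \<omega>)
    have right: "\<exists>d>t. \<forall>u. t < u \<and> u < d \<longrightarrow> S u \<omega> = S t \<omega>" if "t \<ge> 0" for t
    proof -
      have "continuous (at_right t) (\<lambda>u. S u \<omega>)" using elim that by auto
      then have "\<forall>\<^sub>F u in at_right t. S u \<omega> = S t \<omega>"
        by (simp add: continuous_within tendsto_discrete)
      then show ?thesis using eventually_at_right[of t "t + 1"] by auto
    qed
    have "S s \<omega> \<le> S t \<omega>" if st: "0 \<le> s" "s < t" for s t
    proof -
      obtain d where d: "d > s" "\<And>u. s < u \<Longrightarrow> u < d \<Longrightarrow> S u \<omega> = S s \<omega>" using right[OF st(1)] by blast
      obtain e where e: "e > t" "\<And>u. t < u \<Longrightarrow> u < e \<Longrightarrow> S u \<omega> = S t \<omega>" using right[of t] st by (meson less_imp_le order_trans)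
      obtain p where p: "p \<in> \<rat>" "s < p" "p < min d t" using Rats_dense_in_real[of s "min d t"] d st by auto
      obtain q where q: "q \<in> \<rat>" "t < q" "q < e" using Rats_dense_in_real[of t e] e by auto
      have "S p \<omega> \<le> S q \<omega>" using elim(1) p q st by auto
      then show ?thesis using d(2)[of p] e(2)[of q] p q by auto
    qed
    then show ?case using elim(2) by (auto simp: mono_on_def order_le_less)
  qed
qed

text \<open>Increments over unit intervals are i.i.d. with a Poisson law, so the estimate for
  partial sums covers integer end points with \<open>\<eta> / 2\<close>. The other half of \<eta>
  pays, for large n, for rounding the end points.\<close>

lemma poisson_window:
  assumes S: "poisson_process M \<mu> S" and mu: "\<mu> > 0" and eta: "\<eta> > 0"
  shows "whp (\<lambda>n \<omega>. \<forall>u v. 0 \<le> u \<longrightarrow> u \<le> v \<longrightarrow> v \<le> real (A * n) \<longrightarrow>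
            \<bar>real (S v \<omega>) - real (S u \<omega>) - \<mu> * (v - u)\<bar> \<le> \<eta> * (sqrt (real n) + (v - u)))"
proof -
  \<comment> \<open>\<open>Y 0 = 0\<close> by truncated subtraction; thus the times
    \<open>real (k - 1)\<close> form a monotone sequence with increments \<open>Y k\<close>, to
    which the independence clause applies.\<close>
  define Y where "Y j \<omega> = real (S (real j) \<omega>) - real (S (real (j - 1)) \<omega>)" for j \<omega>
  have Sm[measurable]: "S t \<in> measurable M (count_space UNIV)" if "t \<ge> 0" for t
    using S that by (auto simp: poisson_process_def)
  have Ym[measurable]: "random_variable borel (Y j)" for j unfolding Y_def[abs_def] by measurable
  have AEY: "AE \<omega> in M. Y j \<omega> = real (S (real j) \<omega> - S (real (j - 1)) \<omega>)" if "j \<ge> 1" for j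
    using poisson_increment_nonneg[OF S mu, of "real (j - 1)" "real j"] that
    by (auto simp: Y_def of_nat_diff elim!: AE_mp)
  have dist: "distr M borel (Y j) = distr (measure_pmf (poisson_pmf \<mu>)) borel real" if j: "j \<ge> 1" for j
  proof -
    have "distr M borel (Y j) = distr M borel (\<lambda>\<omega>. real (S (real j) \<omega> - S (real (j - 1)) \<omega>))"
      using AEY[OF j] by (intro distr_cong_AE) auto
    also have "\<dots> = distr (distr M (count_space UNIV) (\<lambda>\<omega>. S (real j) \<omega> - S (real (j - 1)) \<omega>)) borel real"
      by (subst distr_distr) (auto simp: comp_def)
    also have "\<dots> = distr (measure_pmf (poisson_pmf \<mu>)) borel real"
      using poisson_increment_distr[OF S mu, of "real (j - 1)" "real j"] j by (simp add: of_nat_diff)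
    finally show ?thesis .
  qed
  have "whp (\<lambda>n \<omega>. \<forall>k l. k + l \<le> A * n \<longrightarrow>
            \<bar>(\<Sum>j\<in>{k<..k+l}. Y j \<omega>) - \<mu> * real l\<bar> \<le> \<eta> / 2 * (sqrt (real n) + real l))"
  proof (rule partial_sums_window)
    have "indep_vars (\<lambda>_. count_space UNIV)
         (\<lambda>k \<omega>. int (S ((\<lambda>k. real (k - 1)) (Suc k)) \<omega>) - int (S ((\<lambda>k. real (k - 1)) k) \<omega>)) UNIV"
    proof -
      have "mono (\<lambda>k. real (k - 1))" by (auto simp: mono_def)
      then show ?thesis
        using S[unfolded poisson_process_def, THEN conjunct2, THEN conjunct2, THEN conjunct2,
            THEN spec, of "\<lambda>k. real (k - 1)"] by (simp only: mp of_nat_0_le_iff)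
    qed
    then have "indep_vars (\<lambda>_. borel) (\<lambda>k \<omega>. real_of_int (int (S (real k) \<omega>) - int (S (real (k - 1)) \<omega>))) UNIV"
      by (intro indep_vars_compose2[where Y="\<lambda>_. real_of_int"]) auto
    then show "indep_vars (\<lambda>_. borel) Y {1..}"
      using indep_vars_subset[of "\<lambda>_. borel" Y UNIV "{1..}"] by (simp add: Y_def[abs_def])
    show "distr M borel (Y j) = distr M borel (Y 1)" if "j \<ge> 1" for j using dist[OF that] dist[of 1] by simp
    show "integrable M (Y 1)"
      using integrable_distr_eq[OF Ym, of "\<lambda>x. x" 1] poisson_pmf_moments[OF mu]
      by (simp add: dist integrable_distr_eq)
    show "expectation (Y 1) = \<mu>"
      using integral_distr[OF Ym, of "\<lambda>x. x" 1] poisson_pmf_moments[OF mu]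
      by (simp add: dist integral_distr)
    show "integrable M (\<lambda>\<omega>. (Y 1 \<omega>)\<^sup>2)"
      using integrable_distr_eq[OF Ym, of "\<lambda>x. x\<^sup>2" 1] poisson_pmf_moments[OF mu]
      by (simp add: dist integrable_distr_eq)
  qed (use eta in auto)
  from whp_conj[OF this whp_AE[OF poisson_mono_AE[OF S mu]]] show ?thesis
  proof (rule whp_eventually)
    have "filterlim (\<lambda>n. \<eta> / 2 * sqrt (real n)) at_top sequentially" using eta by real_asymp
    then have "\<forall>\<^sub>F n in sequentially. \<eta> / 2 * sqrt (real n) \<ge> 2 * \<mu> + \<eta>"
      unfolding filterlim_at_top by blast
    then show "\<forall>\<^sub>F n in sequentially. \<forall>\<omega>. (\<forall>k l. k + l \<le> A * n \<longrightarrow>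
            \<bar>(\<Sum>j\<in>{k<..k+l}. Y j \<omega>) - \<mu> * real l\<bar> \<le> \<eta> / 2 * (sqrt (real n) + real l)) \<and>
            S 0 \<omega> = 0 \<and> mono_on {0..} (\<lambda>t. S t \<omega>) \<longrightarrow>
        (\<forall>u v. 0 \<le> u \<longrightarrow> u \<le> v \<longrightarrow> v \<le> real (A * n) \<longrightarrow>
            \<bar>real (S v \<omega>) - real (S u \<omega>) - \<mu> * (v - u)\<bar> \<le> \<eta> * (sqrt (real n) + (v - u)))"
    proof (eventually_elim, intro allI impI)
      fix n \<omega> u v
      assume n: "2 * \<mu> + \<eta> \<le> \<eta> / 2 * sqrt (real n)"
        and w: "(\<forall>k l. k + l \<le> A * n \<longrightarrow>
            \<bar>(\<Sum>j\<in>{k<..k+l}. Y j \<omega>) - \<mu> * real l\<bar> \<le> \<eta> / 2 * (sqrt (real n) + real l)) \<and>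
            S 0 \<omega> = 0 \<and> mono_on {0..} (\<lambda>t. S t \<omega>)"
        and uv: "0 \<le> u" "u \<le> v" "v \<le> real (A * n)"
      have tele: "(\<Sum>j\<in>{k<..k+l}. Y j \<omega>) = real (S (real (k+l)) \<omega>) - real (S (real k) \<omega>)" for k l
      proof (induction l)
        case (Suc l)
        have "{k<..k + Suc l} = insert (Suc (k + l)) {k<..k+l}" by auto
        then show ?case using Suc by (simp add: Y_def)
      qed simp
      have W: "\<bar>real (S (real b) \<omega>) - real (S (real a) \<omega>) - \<mu> * (real b - real a)\<bar> \<le> \<eta> / 2 * (sqrt (real n) + (real b - real a))"
        if "a \<le> b" "b \<le> A * n" for a b
        using w[THEN conjunct1, rule_format, of a "b - a"] that tele[of a "b - a"] by (simp add: of_nat_diff)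
      have mono: "S x \<omega> \<le> S y \<omega>" if "0 \<le> x" "x \<le> y" for x y
        using w that by (auto simp: mono_on_def)
      \<comment> \<open>By monotonicity the increment lies below that over the enclosing integer
        interval from a to b' and above that over the enclosed one from a' to b. The latter may be
        empty, and then \<open>v - u\<close> is at most 2.\<close>
      define a a' where "a = nat \<lfloor>u\<rfloor>" and "a' = nat \<lceil>u\<rceil>"
      define b b' where "b = nat \<lfloor>v\<rfloor>" and "b' = nat \<lceil>v\<rceil>"
      have a: "real a \<le> u" "u < real a + 1" "u \<le> real a'" "real a' < u + 1" "a \<le> a'"
        and b: "real b \<le> v" "v < real b + 1" "v \<le> real b'" "real b' < v + 1" "b \<le> b'" and ab: "a \<le> b'" "b' \<le> A * n"
        using uv unfolding a_def a'_def b_def b'_def by linarith+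
      have up: "real (S v \<omega>) - real (S u \<omega>) \<le> \<mu> * (v - u) + \<eta> * (sqrt (real n) + (v - u))"
      proof -
        have "real (S v \<omega>) - real (S u \<omega>) \<le> real (S (real b') \<omega>) - real (S (real a) \<omega>)"
          using mono[of v "real b'"] mono[of "real a" u] a b uv by (intro diff_mono) auto
        also have "\<dots> \<le> (\<mu> + \<eta> / 2) * (real b' - real a) + \<eta> / 2 * sqrt (real n)"
          using abs_le_D1[OF W[OF ab]] by (simp add: field_simps)
        also have "\<dots> \<le> (\<mu> + \<eta> / 2) * (v - u + 2) + \<eta> / 2 * sqrt (real n)"
          using a b mu eta by (intro add_right_mono mult_left_mono) auto
        also have "\<dots> \<le> \<mu> * (v - u) + \<eta> * (sqrt (real n) + (v - u))"
        proof -
          have "\<eta> / 2 * (v - u) \<ge> 0" using uv eta by simp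
          then show ?thesis using n by (simp add: field_simps)
        qed
        finally show ?thesis .
      qed
      have lo: "real (S v \<omega>) - real (S u \<omega>) \<ge> \<mu> * (v - u) - \<eta> * (sqrt (real n) + (v - u))"
      proof (cases "a' \<le> b")
        case True
        have "b \<le> A * n" using ab b by linarith
        have "\<mu> * (v - u - 2) \<le> \<mu> * (real b - real a')" using a b mu by (intro mult_left_mono) auto
        also have "\<dots> \<le> real (S (real b) \<omega>) - real (S (real a') \<omega>) + \<eta> / 2 * (sqrt (real n) + (real b - real a'))"
          using abs_le_D2[OF W[OF True \<open>b \<le> A * n\<close>]] by (simp add: field_simps)
        also have "\<dots> \<le> real (S v \<omega>) - real (S u \<omega>) + \<eta> / 2 * (sqrt (real n) + (v - u))"
          using mono[of "real b" v] mono[of u "real a'"] a b uv eta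
          by (intro add_mono diff_mono mult_left_mono) auto
        finally have "\<mu> * (v - u - 2) \<le> real (S v \<omega>) - real (S u \<omega>) + \<eta> / 2 * (sqrt (real n) + (v - u))" .
        moreover have "\<eta> / 2 * (v - u) \<ge> 0" using uv eta by simp
        ultimately show ?thesis using n eta unfolding right_diff_distrib distrib_left by linarith
      next
        case False
        then have "v - u \<le> 2" using a b by linarith
        then have "\<mu> * (v - u) \<le> \<mu> * 2" using mu by (intro mult_left_mono) auto
        moreover have "\<eta> * (v - u) \<ge> 0" using uv eta by simp
        moreover have "real (S v \<omega>) \<ge> real (S u \<omega>)" using mono uv by simp
        ultimately show ?thesis using n eta mu unfolding right_diff_distrib distrib_left by linarith
      qed
      from up lo show "\<bar>real (S v \<omega>) - real (S u \<omega>) - \<mu> * (v - u)\<bar> \<le> \<eta> * (sqrt (real n) + (v - u))"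
        by (simp add: abs_le_iff)
    qed
  qed
qed

end

section \<open>Renewal counting processes\<close>

locale renewal =
  fixes a :: "nat \<Rightarrow> real" and e :: "real \<Rightarrow> nat" and rate :: real
  defines "e \<equiv> \<lambda>t. Sup {l. (\<Sum>k=1..l. a k / rate) \<le> t}"
  assumes pos: "\<And>k. k \<ge> 1 \<Longrightarrow> a k > 0" and rate: "rate > 0"
    and unbounded: "\<And>x. \<exists>l. (\<Sum>k=1..l. a k) > x"
begin

lemma sum_mono: "k \<le> l \<Longrightarrow> (\<Sum>k=1..k. a k) \<le> (\<Sum>k=1..l. a k)"
  using pos by (intro sum_mono2) (auto intro: less_imp_le)

text \<open>Unbounded partial sums make the set of admissible counts finite, so that the supremum of
  natural numbers is attained. The equivalence turns statements on counts into statements on partial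
  sums, and the further properties of e are read off from it.\<close>

lemma le_count_iff:
  assumes "t \<ge> 0"
  shows "l \<le> e t \<longleftrightarrow> (\<Sum>k=1..l. a k) \<le> rate * t"
proof -
  let ?A = "{l. (\<Sum>k=1..l. a k) \<le> rate * t}"
  have A: "{l. (\<Sum>k=1..l. a k / rate) \<le> t} = ?A"
    using rate by (auto simp: sum_divide_distrib[symmetric] field_simps)
  obtain m where m: "(\<Sum>k=1..m. a k) > rate * t" using unbounded by blast
  have "?A \<subseteq> {..m}" proof
    fix l assume "l \<in> ?A"
    then have "\<not> (\<Sum>k=1..m. a k) \<le> (\<Sum>k=1..l. a k)" using m by simp
    then show "l \<in> {..m}" using sum_mono[of m l] by force
  qed
  then have fin: "finite ?A" by (rule finite_subset) simp
  have "0 \<in> ?A" using assms rate by simp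
  then have e: "e t \<in> ?A" "\<And>l. l \<in> ?A \<Longrightarrow> l \<le> e t"
    unfolding e_def A using fin Max_in[OF fin] Max_ge[OF fin] by (auto simp: Sup_nat_def)
  then show ?thesis using sum_mono[of l "e t"] by auto
qed

lemma count_bounds:
  assumes "t \<ge> 0"
  shows "(\<Sum>k=1..e t. a k) \<le> rate * t" and "rate * t < (\<Sum>k=1..Suc (e t). a k)"
  using le_count_iff[OF assms, of "e t"] le_count_iff[OF assms, of "Suc (e t)"] by auto

lemma count_0: "e 0 = 0"
  using le_count_iff[of 0 "Suc 0"] pos[of 1] by simp

lemma count_mono: "mono_on {0..} e"
proof (rule mono_onI)
  fix s t :: real assume "s \<in> {0..}" "t \<in> {0..}" "s \<le> t"
  moreover have "rate * s \<le> rate * t" using rate \<open>s \<le> t\<close> by simp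
  ultimately show "e s \<le> e t" using count_bounds(1)[of s] by (simp add: le_count_iff)
qed

lemma count_right_cont:
  assumes "t \<ge> 0"
  shows "continuous (at_right t) e"
proof -
  let ?d = "(\<Sum>k=1..Suc (e t). a k) / rate"
  have "t < ?d" using count_bounds(2)[OF assms] rate by (simp add: field_simps)
  moreover have "e u = e t" if "t < u" "u < ?d" for u
  proof (rule antisym)
    have "\<not> Suc (e t) \<le> e u"
      using that assms rate by (subst le_count_iff) (auto simp: field_simps)
    then show "e u \<le> e t" by simp
    show "e t \<le> e u" using count_mono that assms by (auto simp: mono_on_def)
  qed
  ultimately have "\<forall>\<^sub>F u in at_right t. e u = e t"
    unfolding eventually_at_right_field by blast
  then show ?thesis by (simp add: continuous_within tendsto_eventually)
qed

text \<open>A count over a window is the number of inter-arrival times that fit into the length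
  \<open>rate * (t - s)\<close>, so a bound on their sums can be inverted. Replacing
  \<open>rate\<close> by \<open>n * lam\<close> and dividing by \<open>1 - \<eta>\<close> cost the
  factor \<open>2 * lam + 5\<close>.\<close>

lemma count_window:
  fixes \<eta> lam T :: real and n A :: nat
  assumes window: "\<And>k l. k + l \<le> A * n \<Longrightarrow>
      \<bar>(\<Sum>j\<in>{k<..k+l}. a j) - real l\<bar> \<le> \<eta> * (sqrt (real n) + real l)"
    and eta: "0 < \<eta>" "\<eta> \<le> 1 / 4" and n: "n \<ge> 1" "1 \<le> \<eta> * sqrt (real n)"
    and rate_near: "\<bar>rate - real n * lam\<bar> \<le> \<eta> * real n" and lam: "lam > 0"
    and A: "real A > 2 * (lam + 1) * T" "A \<ge> 1" and st: "0 \<le> s" "s \<le> t" "t \<le> T"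
  shows "\<bar>real (e t) - real (e s) - real n * lam * (t - s)\<bar> \<le> (2 * lam + 5) * \<eta> * (sqrt (real n) + real n * (t - s))"
proof -
  have diff: "(\<Sum>j\<in>{k<..k+l}. a j) = (\<Sum>k=1..k+l. a k) - (\<Sum>k=1..k. a k)" for k l
  proof -
    have "{1..k+l} = {1..k} \<union> {k<..k+l}" by auto
    moreover have "sum a ({1..k} \<union> {k<..k+l}) = sum a {1..k} + sum a {k<..k+l}"
      by (rule sum.union_disjoint) auto
    ultimately show ?thesis by simp
  qed
  have rn: "rate \<le> real n * (lam + \<eta>)" using rate_near by (auto simp: abs_le_iff algebra_simps)
  have rate_le: "rate \<le> real n * (lam + 1)"
    using order_trans[OF rn mult_left_mono[of "lam + \<eta>" "lam + 1" "real n"]] eta by simp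
  have sqn: "sqrt (real n) \<le> real n" using n real_sqrt_le_mono[of "real n" "real n ^ 2"]
    by (simp add: power2_eq_square)
  \<comment> \<open>The window hypothesis covers the first \<open>A * n\<close> terms only. Their
    sum is at least half of \<open>A * n\<close>, which by the choice of A exceeds
    \<open>rate * T\<close>.\<close>
  have lt: "e t < A * n"
  proof (rule ccontr)
    assume "\<not> e t < A * n"
    then have "(\<Sum>k=1..A*n. a k) \<le> rate * t" using st by (simp add: le_count_iff not_less)
    also have "\<dots> \<le> rate * T" using st rate by simp
    also have "\<dots> \<le> real n * (lam + 1) * T" using rate_le st by (intro mult_right_mono) auto
    also have "\<dots> < real n * (real A / 2)"
      using mult_strict_left_mono[of "(lam + 1) * T" "real A / 2" "real n"] A n by (simp add: algebra_simps)
    finally have up: "(\<Sum>k=1..A*n. a k) < real (A * n) / 2" by (simp add: algebra_simps)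
    have "real (A * n) - (\<Sum>k=1..A*n. a k) \<le> \<eta> * (sqrt (real n) + real (A * n))"
      using abs_le_D2[OF window[of 0 "A*n"]] diff[of 0 "A*n"] by simp
    also have "\<dots> \<le> 1 / 4 * (real (A * n) + real (A * n))"
    proof (intro mult_mono add_mono)
      have "1 * real n \<le> real A * real n" using A by (intro mult_right_mono) auto
      then show "sqrt (real n) \<le> real (A * n)" using sqn by simp
    qed (use eta in auto)
    finally show False using up by simp
  qed
  have le: "e s \<le> e t" using count_mono st by (auto simp: mono_on_def)
  define x where "x = rate * (t - s)"
  define y where "y = real n * (t - s)"
  have y: "y \<ge> 0" using st by (simp add: y_def)
  have x: "x \<ge> 0" "\<bar>x - lam * y\<bar> \<le> \<eta> * y"
  proof -
    show "x \<ge> 0" using st rate by (simp add: x_def)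
    have "\<bar>x - lam * y\<bar> = \<bar>rate - real n * lam\<bar> * (t - s)"
    proof -
      have "x - lam * y = (rate - real n * lam) * (t - s)" by (simp add: x_def y_def algebra_simps)
      then show ?thesis using st by (simp add: abs_mult)
    qed
    also have "\<dots> \<le> \<eta> * real n * (t - s)" using rate_near st by (intro mult_right_mono) auto
    finally show "\<bar>x - lam * y\<bar> \<le> \<eta> * y" by (simp add: y_def algebra_simps)
  qed
  have x_le: "x \<le> (lam + 1) * y"
    using x(2) y eta mult_right_mono[of \<eta> 1 y] by (auto simp: abs_le_iff algebra_simps)
  have \<eta>x: "\<eta> * x \<le> (lam + 1) * (\<eta> * y)"
    using mult_left_mono[OF x_le, of \<eta>] eta by (simp add: algebra_simps)
  have pos_terms: "\<eta> * y \<ge> 0" "lam * (\<eta> * y) \<ge> 0" "lam * (\<eta> * sqrt (real n)) \<ge> 0" using y eta lam by auto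
  have up: "real (e t) - real (e s) \<le> lam * y + (2 * lam + 5) * \<eta> * (sqrt (real n) + y)"
  proof (cases "e s < e t")
    case True
    \<comment> \<open>The inter-arrival time with number \<open>Suc (e s)\<close> contains s and
      lies only partly in the window; without it there are \<open>e t - e s - 1\<close> complete
      ones.\<close>
    define m where "m = e t - e s - 1"
    have m: "Suc (e s) + m = e t" using True by (simp add: m_def)
    have "real m - ((\<Sum>k=1..e t. a k) - (\<Sum>k=1..Suc (e s). a k)) \<le> \<eta> * (sqrt (real n) + real m)"
      using abs_le_D2[OF window[of "Suc (e s)" m]] diff[of "Suc (e s)" m] lt unfolding m by simp
    moreover have "(\<Sum>k=1..e t. a k) - (\<Sum>k=1..Suc (e s). a k) \<le> x"
      using count_bounds(1)[of t] count_bounds(2)[of s] st by (simp add: x_def right_diff_distrib)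
    ultimately have *: "real m * (1 - \<eta>) \<le> x + \<eta> * sqrt (real n)" by (simp add: algebra_simps)
    have "1 \<le> (1 - \<eta>) * (1 + 2 * \<eta>)" using eta mult_left_mono[of \<eta> "1/4" \<eta>] by (simp add: algebra_simps)
    then have "real m * 1 \<le> real m * ((1 - \<eta>) * (1 + 2 * \<eta>))" by (intro mult_left_mono) auto
    also have "\<dots> \<le> (x + \<eta> * sqrt (real n)) * (1 + 2 * \<eta>)"
      using mult_right_mono[OF *, of "1 + 2 * \<eta>"] eta by (simp add: algebra_simps)
    also have "\<dots> \<le> x + 2 * (\<eta> * x) + 2 * (\<eta> * sqrt (real n))"
    proof -
      have "\<eta> * (\<eta> * sqrt (real n)) \<le> 1/4 * (\<eta> * sqrt (real n))"
        using eta by (intro mult_right_mono) auto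
      moreover have "\<eta> * sqrt (real n) \<ge> 0" using eta by simp
      moreover have "(x + \<eta> * sqrt (real n)) * (1 + 2 * \<eta>)
          = x + 2 * (\<eta> * x) + \<eta> * sqrt (real n) + 2 * (\<eta> * (\<eta> * sqrt (real n)))"
        by (simp add: algebra_simps)
      ultimately show ?thesis by linarith
    qed
    finally have "real (e t) - real (e s) \<le> 1 + x + 2 * (\<eta> * x) + 2 * (\<eta> * sqrt (real n))"
      using True by (simp add: m_def of_nat_diff)
    then show ?thesis using x(2) \<eta>x n pos_terms by (simp add: abs_le_iff algebra_simps)
  next
    case False
    moreover have "0 \<le> lam * y + (2 * lam + 5) * \<eta> * (sqrt (real n) + y)"
      using y lam eta by (intro add_nonneg_nonneg mult_nonneg_nonneg) auto
    ultimately show ?thesis by linarith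
  qed
  have lo: "real (e t) - real (e s) \<ge> lam * y - (2 * lam + 5) * \<eta> * (sqrt (real n) + y)"
  proof -
    \<comment> \<open>Here both incomplete inter-arrival times are included, so that the sum covers
      the whole window.\<close>
    define m where "m = Suc (e t - e s)"
    have m: "e s + m = Suc (e t)" using le by (simp add: m_def)
    have "((\<Sum>k=1..Suc (e t). a k) - (\<Sum>k=1..e s. a k)) - real m \<le> \<eta> * (sqrt (real n) + real m)"
      using abs_le_D1[OF window[of "e s" m]] diff[of "e s" m] lt unfolding m by simp
    moreover have "(\<Sum>k=1..Suc (e t). a k) - (\<Sum>k=1..e s. a k) \<ge> x"
      using count_bounds(2)[of t] count_bounds(1)[of s] st by (simp add: x_def right_diff_distrib)
    ultimately have *: "x - \<eta> * sqrt (real n) \<le> real m * (1 + \<eta>)" by (simp add: algebra_simps)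
    have "(x - \<eta> * sqrt (real n)) * (1 - \<eta>) \<le> real m * (1 + \<eta>) * (1 - \<eta>)"
      using mult_right_mono[OF *, of "1 - \<eta>"] eta by simp
    also have "\<dots> \<le> real m * 1"
      using mult_left_mono[of "(1 + \<eta>) * (1 - \<eta>)" 1 "real m"] eta by (simp add: algebra_simps)
    finally have "x - \<eta> * x - \<eta> * sqrt (real n) + \<eta> * (\<eta> * sqrt (real n)) \<le> real m" by (simp add: algebra_simps)
    moreover have "real m = 1 + (real (e t) - real (e s))" using le by (simp add: m_def of_nat_diff)
    moreover have "\<eta> * (\<eta> * sqrt (real n)) \<ge> 0" using eta by simp
    ultimately show ?thesis using x(2) \<eta>x n pos_terms by (simp add: abs_le_iff algebra_simps)
  qed
  show ?thesis using up lo by (simp add: y_def abs_le_iff algebra_simps)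
qed

end

section \<open>Unbounded arrival sums and the initial state\<close>

context prob_space
begin

text \<open>On events of probability tending to 1 the sum of the first n terms is at least n / 2.
  The event that some sum exceeds a given x does not depend on n, hence has probability 1.\<close>

lemma renewal_unbounded_AE:
  fixes Y :: "nat \<Rightarrow> 'a \<Rightarrow> real"
  assumes indep: "indep_vars (\<lambda>_. borel) Y {1..}"
    and ident: "\<And>j. j \<ge> 1 \<Longrightarrow> distr M borel (Y j) = distr M borel (Y 1)"
    and int: "integrable M (Y 1)" and mean: "expectation (Y 1) = 1"
    and sq: "integrable M (\<lambda>\<omega>. (Y 1 \<omega>)\<^sup>2)"
  shows "AE \<omega> in M. \<forall>x. \<exists>l. (\<Sum>k=1..l. Y k \<omega>) > x"
proof -
  have rv[measurable]: "random_variable borel (Y j)" if "j \<ge> 1" for j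
    using indep that by (auto simp: indep_vars_def)
  have [measurable]: "(\<lambda>\<omega>. \<Sum>k=1..l. Y k \<omega>) \<in> borel_measurable M" for l :: nat
    by (intro borel_measurable_sum rv) auto
  have "whp (\<lambda>n \<omega>. \<forall>k l. k + l \<le> 1 * n \<longrightarrow>
      \<bar>(\<Sum>j\<in>{k<..k+l}. Y j \<omega>) - 1 * real l\<bar> \<le> 1/4 * (sqrt (real n) + real l))"
    by (rule partial_sums_window[OF indep ident int mean sq]) auto
  then obtain G where G: "\<And>n. G n \<in> events" "(\<lambda>n. prob (G n)) \<longlonglongrightarrow> 1"
    and W: "\<And>n \<omega> k l. \<omega> \<in> G n \<Longrightarrow> k + l \<le> n \<Longrightarrow> \<bar>(\<Sum>j\<in>{k<..k+l}. Y j \<omega>) - real l\<bar> \<le> 1/4 * (sqrt (real n) + real l)"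
    unfolding whp_def mult_1 by metis
  have one: "AE \<omega> in M. \<exists>l. (\<Sum>k=1..l. Y k \<omega>) > real x" for x :: nat
  proof -
    let ?B = "{\<omega>\<in>space M. \<exists>l. (\<Sum>k=1..l. Y k \<omega>) > real x}"
    have "\<forall>\<^sub>F n in sequentially. prob (G n) \<le> prob ?B"
      using eventually_gt_at_top[of "2 * x"]
    proof eventually_elim
      case (elim n)
      have "G n \<subseteq> ?B"
      proof
        fix \<omega> assume w: "\<omega> \<in> G n"
        have "{0<..n} = {1..n}" by auto
        then have "real n - (\<Sum>k=1..n. Y k \<omega>) \<le> 1/4 * (sqrt (real n) + real n)"
          using abs_le_D2[OF W[OF w, of 0 n]] by simp
        moreover have "sqrt (real n) \<le> real n"
          using elim real_sqrt_le_mono[of "real n" "real n ^ 2"] by (simp add: power2_eq_square)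
        moreover have "2 * real x < real n" using elim by linarith
        moreover have "x' < v" if "n' - v \<le> 1/4 * (q + n')" "q \<le> n'" "2 * x' < n'" for x' v n' q :: real
          using that by (simp add: field_simps)
        ultimately have "(\<Sum>k=1..n. Y k \<omega>) > real x" by blast
        then show "\<omega> \<in> ?B" using w G(1) sets.sets_into_space by blast
      qed
      then show ?case by (intro finite_measure_mono) auto
    qed
    then have "1 \<le> prob ?B" by (intro tendsto_upperbound[OF G(2)]) auto
    then have "prob ?B = 1" using prob_le_1 by (rule antisym[rotated])
    then have "AE \<omega> in M. \<omega> \<in> ?B" by (subst AE_in_set_eq_1) auto
    then show ?thesis by eventually_elim auto
  qed
  have "AE \<omega> in M. \<forall>x::nat. \<exists>l. (\<Sum>k=1..l. Y k \<omega>) > real x"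
    using one by (simp add: AE_all_countable)
  then show ?thesis
  proof eventually_elim
    case (elim \<omega>)
    show ?case
    proof
      fix x :: real
      obtain m :: nat where "x \<le> real m" using real_arch_simple by blast
      then show "\<exists>l. (\<Sum>k=1..l. Y k \<omega>) > x" using elim by (meson le_less_trans)
    qed
  qed
qed

text \<open>A bounded continuous function that vanishes where the coordinate is 0 and dominates the
  indicator of a large queue turns convergence in distribution to 0 into convergence in
  probability.\<close>

lemma initial_queue_small:
  fixes X :: "nat \<Rightarrow> 'a \<Rightarrow> 'c::finite \<Rightarrow> nat"
    and V :: "nat \<Rightarrow> 'a \<Rightarrow> (real, 'c) vec" and L :: "'b measure"
  assumes conv: "converges_in_distribution (\<lambda>_. M)
      (\<lambda>n \<omega>. ((\<chi> i. real (X n \<omega> i) / sqrt (real n)) :: (real, 'c) vec, V n \<omega>)) L (\<lambda>\<omega>. (0, Z \<omega>))"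
    and meas: "\<And>n i. n \<ge> 1 \<Longrightarrow> (\<lambda>\<omega>. X n \<omega> i) \<in> measurable M (count_space UNIV)" and eta: "\<eta> > 0"
  shows "whp (\<lambda>n \<omega>. real (X n \<omega> i) \<le> \<eta> * sqrt (real n))"
proof (rule whp_if_bad_to_0)
  define f :: "(real, 'c) vec \<times> (real, 'c) vec \<Rightarrow> real" where "f p = min 1 (\<bar>fst p $ i\<bar> / \<eta>)" for p
  have "continuous_on UNIV f" unfolding f_def[abs_def] using eta by (intro continuous_intros) auto
  moreover have "bounded (range f)"
    unfolding bounded_iff f_def[abs_def] using eta by (intro exI[of _ 1]) auto
  ultimately have lim: "(\<lambda>n. \<integral>\<omega>. f ((\<chi> i. real (X n \<omega> i) / sqrt (real n)), V n \<omega>) \<partial>M) \<longlonglongrightarrow> 0"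
    using conv[unfolded converges_in_distribution_def, rule_format, of f] by (simp add: f_def)
  have le: "prob {\<omega>\<in>space M. \<not> real (X n \<omega> i) \<le> \<eta> * sqrt (real n)}
      \<le> (\<integral>\<omega>. f ((\<chi> i. real (X n \<omega> i) / sqrt (real n)), V n \<omega>) \<partial>M)" if n: "n \<ge> 1" for n
  proof -
    note [measurable] = meas[OF n]
    have "prob {\<omega>\<in>space M. \<not> real (X n \<omega> i) \<le> \<eta> * sqrt (real n)}
      = (\<integral>\<omega>. indicator {\<omega>\<in>space M. \<not> real (X n \<omega> i) \<le> \<eta> * sqrt (real n)} \<omega> \<partial>M)" by simp
    also have "\<dots> \<le> (\<integral>\<omega>. min 1 (\<bar>real (X n \<omega> i) / sqrt (real n)\<bar> / \<eta>) \<partial>M)"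
    proof (rule integral_mono)
      show "integrable M (\<lambda>\<omega>. min 1 (\<bar>real (X n \<omega> i) / sqrt (real n)\<bar> / \<eta>))"
        using eta by (intro integrable_const_bound[where B=1]) auto
      show "integrable M (indicator {\<omega>\<in>space M. \<not> real (X n \<omega> i) \<le> \<eta> * sqrt (real n)} :: 'a \<Rightarrow> real)"
        by (auto simp: integrable_real_indicator emeasure_eq_measure)
    qed (use n eta in \<open>auto simp: indicator_def field_simps\<close>)
    finally show ?thesis by (simp add: f_def)
  qed
  show "(\<lambda>n. prob {\<omega>\<in>space M. \<not> real (X n \<omega> i) \<le> \<eta> * sqrt (real n)}) \<longlonglongrightarrow> 0"
    by (rule tendsto_sandwich[OF _ _ tendsto_const lim])
      (auto intro!: always_eventually eventually_mono[OF eventually_ge_at_top[of 1]] le)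
  show "\<forall>\<^sub>F n in sequentially. {\<omega>\<in>space M. \<not> real (X n \<omega> i) \<le> \<eta> * sqrt (real n)} \<in> events"
    using eventually_ge_at_top[of 1]
  proof eventually_elim
    case (elim n)
    note [measurable] = meas[OF elim]
    show ?case by measurable
  qed
qed

text \<open>The reason is tightness of the limit law: its tail beyond K is small for large K, and
  \<open>\<eta> * sqrt n\<close> eventually exceeds \<open>K + 1\<close>. The deviation of order
  \<open>sqrt n\<close> is thereby weakened to \<open>\<eta> * n\<close>, enough for the fluid
  estimate.\<close>

lemma initial_service_near:
  fixes X :: "nat \<Rightarrow> 'a \<Rightarrow> 'c::finite \<Rightarrow> nat"
    and V :: "nat \<Rightarrow> 'a \<Rightarrow> (real, 'c) vec" and L :: "'b measure"
  assumes conv: "converges_in_distribution (\<lambda>_. M)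
      (\<lambda>n \<omega>. (V n \<omega>, (\<chi> i. (real (X n \<omega> i) - real n * \<rho> i) / sqrt (real n)) :: (real, 'c) vec)) L (\<lambda>\<omega>. (0, Z \<omega>))"
    and meas: "\<And>n i. n \<ge> 1 \<Longrightarrow> (\<lambda>\<omega>. X n \<omega> i) \<in> measurable M (count_space UNIV)" and eta: "\<eta> > 0"
    and L: "prob_space L" and Z: "Z \<in> borel_measurable L"
  shows "whp (\<lambda>n \<omega>. \<bar>real (X n \<omega> i) - real n * \<rho> i\<bar> \<le> \<eta> * real n)"
proof (rule whp_if_bad_to_0)
  interpret L: prob_space L by fact
  define f :: "nat \<Rightarrow> (real, 'c) vec \<times> (real, 'c) vec \<Rightarrow> real"
    where "f K p = min 1 (max 0 (\<bar>snd p $ i\<bar> - real K))" for K p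
  define c where "c K = (\<integral>\<omega>. f K (0, Z \<omega>) \<partial>L)" for K
  let ?p = "\<lambda>n. prob {\<omega>\<in>space M. \<not> \<bar>real (X n \<omega> i) - real n * \<rho> i\<bar> \<le> \<eta> * real n}"
  let ?I = "\<lambda>K n. \<integral>\<omega>. f K (V n \<omega>, \<chi> i. (real (X n \<omega> i) - real n * \<rho> i) / sqrt (real n)) \<partial>M"
  have lim: "?I K \<longlonglongrightarrow> c K" for K
  proof -
    have "continuous_on UNIV (f K)" unfolding f_def[abs_def] by (intro continuous_intros)
    moreover have "bounded (range (f K))"
      unfolding bounded_iff f_def[abs_def] by (intro exI[of _ 1]) auto
    ultimately show ?thesis
      using conv[unfolded converges_in_distribution_def, rule_format, of "f K"] by (simp add: c_def)
  qed
  have Zi[measurable]: "(\<lambda>\<omega>. Z \<omega> $ i) \<in> borel_measurable L"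
    using Z by (rule measurable_compose) (intro borel_measurable_continuous_onI continuous_intros)
  have c: "c \<longlonglongrightarrow> 0"
  proof -
    have "c \<longlonglongrightarrow> (\<integral>\<omega>. 0 \<partial>L)" unfolding c_def f_def snd_conv
    proof (rule integral_dominated_convergence[where w="\<lambda>_. 1"])
      show "AE \<omega> in L. (\<lambda>K. min 1 (max 0 (\<bar>Z \<omega> $ i\<bar> - real K))) \<longlonglongrightarrow> 0"
      proof (rule AE_I2)
        fix \<omega>
        obtain K0 :: nat where "\<bar>Z \<omega> $ i\<bar> \<le> real K0" using real_arch_simple by blast
        then have "\<forall>\<^sub>F K in sequentially. min 1 (max 0 (\<bar>Z \<omega> $ i\<bar> - real K)) = 0"
          by (intro eventually_mono[OF eventually_ge_at_top[of K0]]) auto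
        then show "(\<lambda>K. min 1 (max 0 (\<bar>Z \<omega> $ i\<bar> - real K))) \<longlonglongrightarrow> 0" by (rule tendsto_eventually)
      qed
    qed auto
    then show ?thesis by simp
  qed
  have le: "?p n \<le> ?I K n" if n: "n \<ge> 1" "\<eta> * sqrt (real n) \<ge> real K + 1" for n K
  proof -
    note [measurable] = meas[OF n(1)]
    have "?p n = (\<integral>\<omega>. indicator {\<omega>\<in>space M. \<not> \<bar>real (X n \<omega> i) - real n * \<rho> i\<bar> \<le> \<eta> * real n} \<omega> \<partial>M)" by simp
    also have "\<dots> \<le> (\<integral>\<omega>. min 1 (max 0 (\<bar>(real (X n \<omega> i) - real n * \<rho> i) / sqrt (real n)\<bar> - real K)) \<partial>M)"
    proof (rule integral_mono)
      show "integrable M (\<lambda>\<omega>. min 1 (max 0 (\<bar>(real (X n \<omega> i) - real n * \<rho> i) / sqrt (real n)\<bar> - real K)))"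
        by (intro integrable_const_bound[where B=1]) auto
      fix \<omega> assume "\<omega> \<in> space M"
      show "indicator {\<omega>\<in>space M. \<not> \<bar>real (X n \<omega> i) - real n * \<rho> i\<bar> \<le> \<eta> * real n} \<omega>
        \<le> min 1 (max 0 (\<bar>(real (X n \<omega> i) - real n * \<rho> i) / sqrt (real n)\<bar> - real K))"
      proof (cases "\<bar>real (X n \<omega> i) - real n * \<rho> i\<bar> \<le> \<eta> * real n")
        case False
        then have "\<eta> * sqrt (real n) * sqrt (real n) \<le> \<bar>real (X n \<omega> i) - real n * \<rho> i\<bar>"
            by (simp only: mult.assoc real_sqrt_mult_self abs_of_nat not_le)
        then have "\<eta> * sqrt (real n) \<le> \<bar>(real (X n \<omega> i) - real n * \<rho> i) / sqrt (real n)\<bar>"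
          using n by (simp add: field_simps)
        then show ?thesis using n(2) by (auto simp: indicator_def)
      qed auto
    qed (auto simp: integrable_real_indicator emeasure_eq_measure)
    finally show ?thesis by (simp add: f_def)
  qed
  show "?p \<longlonglongrightarrow> 0"
  proof (rule LIMSEQ_I)
    fix \<epsilon> :: real assume "\<epsilon> > 0"
    then obtain K where K: "c K < \<epsilon>"
      using order_tendstoD(2)[OF c] eventually_happens'[OF sequentially_bot] by blast
    have "filterlim (\<lambda>n. \<eta> * sqrt (real n)) at_top sequentially" using eta by real_asymp
    then have "\<forall>\<^sub>F n in sequentially. \<eta> * sqrt (real n) \<ge> real K + 1"
      unfolding filterlim_at_top by blast
    then have "\<forall>\<^sub>F n in sequentially. norm (?p n - 0) < \<epsilon>"
      using order_tendstoD(2)[OF lim K] eventually_ge_at_top[of 1]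
    proof eventually_elim
      case (elim n)
      then show ?case using le[of n K] by simp
    qed
    then show "\<exists>no. \<forall>n\<ge>no. norm (?p n - 0) < \<epsilon>" by (simp add: eventually_at_top_linorder)
  qed
  show "\<forall>\<^sub>F n in sequentially. {\<omega>\<in>space M. \<not> \<bar>real (X n \<omega> i) - real n * \<rho> i\<bar> \<le> \<eta> * real n} \<in> events"
    using eventually_ge_at_top[of 1]
  proof eventually_elim
    case (elim n)
    note [measurable] = meas[OF elim]
    show ?case by measurable
  qed
qed

end

section \<open>Counting paths\<close>

lemma nat_right_const:
  fixes f :: "real \<Rightarrow> nat"
  assumes "continuous (at_right t) f"
  obtains d where "d > t" "\<And>u. t \<le> u \<Longrightarrow> u < d \<Longrightarrow> f u = f t"
proof -
  have "\<forall>\<^sub>F u in at_right t. f u = f t"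
    using assms by (simp add: continuous_within tendsto_discrete)
  then obtain d where "d > t" "\<And>u. t < u \<Longrightarrow> u < d \<Longrightarrow> f u = f t"
    by (auto simp: eventually_at_right_field)
  then show ?thesis using that[of d] by (metis order_le_less)
qed

text \<open>A monotone path takes finitely many values before t, so it attains their maximum and
  keeps it up to t. This is where left limits come from.\<close>

lemma nat_left_const:
  fixes f :: "real \<Rightarrow> nat"
  assumes mono: "mono_on {0..} f" and t: "t > 0"
  obtains s where "0 \<le> s" "s < t" "\<And>u. s \<le> u \<Longrightarrow> u < t \<Longrightarrow> f u = f s"
proof -
  let ?A = "f ` {0..<t}"
  have "?A \<subseteq> {..f t}" using mono t by (auto simp: mono_on_def)
  then have fin: "finite ?A" by (rule finite_subset) simp
  moreover have "?A \<noteq> {}" using t by auto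
  ultimately obtain s where s: "0 \<le> s" "s < t" "f s = Max ?A"
    using Max_in[of ?A] by fastforce
  have "f u = f s" if "s \<le> u" "u < t" for u
  proof (rule antisym)
    show "f u \<le> f s" unfolding s(3) using fin that s by (intro Max_ge) auto
    show "f s \<le> f u" using mono that s(1) unfolding mono_on_def by simp
  qed
  then show ?thesis using that s by blast
qed

lemma left_lim_const:
  assumes "s < t" "\<And>u. s \<le> u \<Longrightarrow> u < t \<Longrightarrow> f u = c"
  shows "left_lim f t = c"
proof -
  have "\<forall>\<^sub>F u in at_left t. f u = c"
    using assms by (auto simp: eventually_at_left_field intro!: exI[of _ s])
  then have "(f \<longlongrightarrow> c) (at_left t)" by (rule tendsto_eventually)
  then show ?thesis unfolding left_lim_def by (intro tendsto_Lim) auto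
qed

lemma finite_common_right:
  fixes P :: "'i::finite \<Rightarrow> real \<Rightarrow> bool"
  assumes "\<And>i. \<exists>d>t. \<forall>u. t \<le> u \<longrightarrow> u < d \<longrightarrow> P i u"
  shows "\<exists>d>t. \<forall>i u. t \<le> u \<longrightarrow> u < d \<longrightarrow> P i u"
proof -
  obtain d where d: "\<And>i. d i > t" "\<And>i u. t \<le> u \<Longrightarrow> u < d i \<Longrightarrow> P i u" using assms by metis
  then show ?thesis by (intro exI[of _ "Min (range d)"]) auto
qed

lemma finite_common_left:
  fixes P :: "'i::finite \<Rightarrow> real \<Rightarrow> bool"
  assumes "\<And>i. \<exists>s\<ge>0. s < t \<and> (\<forall>u. s \<le> u \<longrightarrow> u < t \<longrightarrow> P i u)"
  shows "\<exists>s\<ge>0. s < t \<and> (\<forall>i u. s \<le> u \<longrightarrow> u < t \<longrightarrow> P i u)"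
proof -
  obtain s where s: "\<And>i. s i \<ge> 0" "\<And>i. s i < t" "\<And>i u. s i \<le> u \<Longrightarrow> u < t \<Longrightarrow> P i u" using assms by metis
  have "Max (range s) \<in> range s" by (rule Max_in) auto
  then obtain j where j: "Max (range s) = s j" by (elim rangeE)
  have "s i \<le> s j" for i unfolding j[symmetric] by (rule Max_ge) auto
  then have "P i u" if "s j \<le> u" "u < t" for i u using s(3)[of i u] that order_trans by blast
  then show ?thesis using s(1,2)[of j] by blast
qed

section \<open>Lebesgue-Stieltjes integrals of counting paths\<close>

locale counting_path =
  fixes f :: "real \<Rightarrow> nat"
  assumes f_mono: "mono_on {0..} f" and f_0: "f 0 = 0"
    and f_right_cont: "\<And>t. t \<ge> 0 \<Longrightarrow> continuous (at_right t) f"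
begin

lemma stieltjes_Ioc:
  assumes "0 \<le> a" "a \<le> b"
  shows "emeasure (stieltjes f) {a<..b} = ennreal (real (f b) - real (f a))"
proof -
  let ?F = "\<lambda>t. if t < 0 then 0 else real (f t)"
  have "emeasure (interval_measure ?F) {a<..b} = ennreal (?F b - ?F a)"
  proof (rule emeasure_interval_measure_Ioc)
    show "?F x \<le> ?F y" if "x \<le> y" for x y using that f_mono by (auto simp: mono_on_def)
    show "continuous (at_right x) ?F" for x
    proof -
      have "\<exists>d>x. \<forall>u. x < u \<longrightarrow> u < d \<longrightarrow> ?F u = ?F x"
      proof (cases "x < 0")
        case False
        then obtain d where "d > x" "\<And>u. x \<le> u \<Longrightarrow> u < d \<Longrightarrow> f u = f x"
          using nat_right_const[OF f_right_cont[of x]] by (metis not_less)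
        have "f u = f x" if "x < u" "u < d" for u
          using \<open>\<And>u. x \<le> u \<Longrightarrow> u < d \<Longrightarrow> f u = f x\<close>[of u] that by simp
        then show ?thesis using False \<open>d > x\<close> by (intro exI[of _ d] conjI allI impI) simp_all
      qed (auto intro: exI[of _ 0])
      then have "\<forall>\<^sub>F u in at_right x. ?F u = ?F x" by (auto simp: eventually_at_right_field)
      then show ?thesis by (simp only: continuous_within tendsto_eventually)
    qed
  qed fact
  then show ?thesis using assms by (simp add: stieltjes_def)
qed

lemma stieltjes_null:
  assumes zero: "(\<integral>\<^sup>+t\<in>{0..}. g t \<partial>stieltjes f) = 0"
    and A: "A \<in> sets borel" "A \<subseteq> {0..}" "\<And>t. t \<in> A \<Longrightarrow> 1 \<le> g t"
  shows "emeasure (stieltjes f) A = 0"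
proof -
  have "A \<in> sets (stieltjes f)" using A by (simp add: stieltjes_def)
  then have "emeasure (stieltjes f) A = (\<integral>\<^sup>+t. indicator A t \<partial>stieltjes f)" by simp
  also have "\<dots> \<le> (\<integral>\<^sup>+t\<in>{0..}. g t \<partial>stieltjes f)"
    using A by (intro nn_integral_mono) (auto simp: indicator_def)
  finally show ?thesis using zero by simp
qed

lemma const_if_integral_0:
  assumes zero: "(\<integral>\<^sup>+t\<in>{0..}. g t \<partial>stieltjes f) = 0"
    and ab: "0 \<le> a" "a \<le> b" and g: "\<And>t. a < t \<Longrightarrow> t \<le> b \<Longrightarrow> 1 \<le> g t"
  shows "f b = f a"
proof -
  have "emeasure (stieltjes f) {a<..b} = 0" using ab g by (intro stieltjes_null[OF zero]) auto
  then have "f b \<le> f a" using stieltjes_Ioc[OF ab] by (simp add: ennreal_eq_0_iff)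
  then show ?thesis using f_mono ab by (auto simp: mono_on_def intro: antisym)
qed

text \<open>The integrand is known at the single instant u, so the atom of the measure at u has to
  be isolated: the rest of the interval is null because f is constant there, and it is exhausted by
  half-open intervals.\<close>

lemma no_jump_if_integral_0:
  assumes zero: "(\<integral>\<^sup>+t\<in>{0..}. g t \<partial>stieltjes f) = 0"
    and s: "0 \<le> s" "s < u" and const: "\<And>v. s \<le> v \<Longrightarrow> v < u \<Longrightarrow> f v = f s" and g: "1 \<le> g u"
  shows "f u = f s"
proof -
  have "emeasure (stieltjes f) {s<..u - (u - s) / real (Suc m)} = 0" for m
  proof -
    have 1: "(u - s) / real (Suc m) \<le> u - s" "0 < (u - s) / real (Suc m)"
      using s divide_left_mono[of 1 "real (Suc m)" "u - s"] by auto
    then show ?thesis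
      using stieltjes_Ioc[of s "u - (u - s) / real (Suc m)"] const[of "u - (u - s) / real (Suc m)"] s by simp
  qed
  then have "(\<Union>m. {s<..u - (u - s) / real (Suc m)}) \<in> null_sets (stieltjes f)"
    by (intro null_sets_UN) (auto simp: null_sets_def stieltjes_def)
  moreover have "{u} \<in> null_sets (stieltjes f)"
    using stieltjes_null[OF zero, of "{u}"] g s by (auto simp: null_sets_def stieltjes_def)
  ultimately have "(\<Union>m. {s<..u - (u - s) / real (Suc m)}) \<union> {u} \<in> null_sets (stieltjes f)"
    by (rule null_sets.Un)
  moreover have "{s<..u} \<subseteq> (\<Union>m. {s<..u - (u - s) / real (Suc m)}) \<union> {u}"
  proof
    fix x assume x: "x \<in> {s<..u}"
    show "x \<in> (\<Union>m. {s<..u - (u - s) / real (Suc m)}) \<union> {u}"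
    proof (cases "x = u")
      case False
      then obtain m where "inverse (real (Suc m)) < (u - x) / (u - s)"
        using x reals_Archimedean[of "(u - x) / (u - s)"] by auto
      then have "(u - s) / real (Suc m) \<le> u - x" using s by (simp add: field_simps)
      then show ?thesis using x by (intro UnI1 UN_I[of m]) auto
    qed simp
  qed
  ultimately have "{s<..u} \<in> null_sets (stieltjes f)"
    using null_sets_subset[of _ "stieltjes f" "{s<..u}"] by (simp add: stieltjes_def)
  then have "f u \<le> f s" using stieltjes_Ioc[of s u] s by (simp add: null_sets_def ennreal_eq_0_iff)
  then show ?thesis using f_mono s by (auto simp: mono_on_def intro: antisym)
qed

end

section \<open>Pathwise dynamics\<close>

locale arrival_path =
  fixes E :: "'c::{finite,linorder} counts"
  assumes E_mono: "\<And>i. mono_on {0..} (E i)"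
    and E_right_cont: "\<And>i t. t \<ge> 0 \<Longrightarrow> continuous (at_right t) (E i)"
    and E_0: "\<And>i. E i 0 = 0"
begin

lemma E_le: "0 \<le> s \<Longrightarrow> s \<le> t \<Longrightarrow> E i s \<le> E i t"
  using E_mono[of i] by (auto simp: mono_on_def)

text \<open>Right continuity makes the infimum a minimum; it is positive because nobody has arrived
  at time 0.\<close>

lemma arrival_timeE:
  assumes "1 \<le> j" "0 \<le> t" "j \<le> E i t"
  obtains v where "arrival_time E i j = ereal v" "0 < v" "v \<le> t" "j \<le> E i v"
    "\<And>u. 0 \<le> u \<Longrightarrow> u < v \<Longrightarrow> E i u < j"
proof -
  define A where "A = {t. 0 \<le> t \<and> j \<le> E i t}"
  define v where "v = Inf A"
  have A: "t \<in> A" "bdd_below A" using assms by (auto simp: A_def bdd_below_def)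
  have v0: "0 \<le> v" unfolding v_def using A by (intro cInf_greatest) (auto simp: A_def)
  have vt: "v \<le> t" unfolding v_def using A by (intro cInf_lower)
  have before: "E i u < j" if "0 \<le> u" "u < v" for u
  proof (rule ccontr)
    assume "\<not> E i u < j"
    then have "u \<in> A" using that by (simp add: A_def)
    then show False using cInf_lower[of u A] A that by (simp add: v_def)
  qed
  have at: "j \<le> E i v"
  proof -
    obtain d where d: "d > v" "\<And>u. v \<le> u \<Longrightarrow> u < d \<Longrightarrow> E i u = E i v"
      using nat_right_const[OF E_right_cont[OF v0]] by blast
    obtain u where "u \<in> A" "u < d" using cInf_lessD[of A d] A d by (auto simp: v_def)
    moreover have "v \<le> u" unfolding v_def using A \<open>u \<in> A\<close> by (intro cInf_lower)
    ultimately show ?thesis using d(2)[of u] by (simp add: A_def)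
  qed
  have "v > 0" using v0 at assms E_0[of i] by (cases "v = 0") auto
  moreover have "arrival_time E i j = ereal v"
    unfolding arrival_time_def A_def[symmetric]
  proof (rule antisym)
    show "Inf (ereal ` A) \<le> ereal v" using at v0 by (intro Inf_lower imageI) (simp add: A_def)
    show "ereal v \<le> Inf (ereal ` A)" unfolding v_def using A by (intro Inf_greatest) (auto intro!: cInf_lower)
  qed
  ultimately show ?thesis using that vt at before by blast
qed

lemma reneged_diff:
  assumes "0 \<le> s" "s \<le> t"
  shows "reneged E \<delta> i t = reneged E \<delta> i s + card {j\<in>{E i s<..E i t}. \<not> \<delta> i j}"
proof -
  have "{1..E i t} = {1..E i s} \<union> {E i s<..E i t}" using E_le[OF assms, of i] by auto
  then have "reneged E \<delta> i t = reneged E \<delta> i s + (\<Sum>j\<in>{E i s<..E i t}. of_bool (\<not> \<delta> i j))"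
    unfolding reneged_def by (simp only:) (rule sum.union_disjoint, auto)
  moreover have "(\<Sum>j\<in>{E i s<..E i t}. of_bool (\<not> \<delta> i j)) = card {j\<in>{E i s<..E i t}. \<not> \<delta> i j}"
    by (simp add: sum_of_bool_eq Int_def conj_commute)
  ultimately show ?thesis by simp
qed

lemma reneged_le: "0 \<le> s \<Longrightarrow> s \<le> t \<Longrightarrow> reneged E \<delta> i s \<le> reneged E \<delta> i t"
  using reneged_diff[of s t \<delta> i] by simp

lemma reneged_incr_le:
  assumes "0 \<le> s" "s \<le> t"
  shows "reneged E \<delta> i t + E i s \<le> reneged E \<delta> i s + E i t"
proof -
  have "card {j\<in>{E i s<..E i t}. \<not> \<delta> i j} \<le> card {E i s<..E i t}" by (intro card_mono) auto
  then show ?thesis using reneged_diff[OF assms, of \<delta> i] E_le[OF assms, of i] by simp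
qed

end

section \<open>Paths of the queueing system: left limits and the two policies\<close>

locale queueing_path = arrival_path E for E :: "'c::{finite,linorder} counts" +
  fixes pol :: "'c policy" and n :: nat and q0 \<psi>0 :: "'c \<Rightarrow> nat" and S :: "'c counts"
    and \<delta> :: "'c \<Rightarrow> nat \<Rightarrow> bool" and X :: "'c paths"
  assumes dyn: "dynamics pol n q0 \<psi>0 E S \<delta> X"
begin

abbreviation "Q \<equiv> queue X"
abbreviation "P \<equiv> in_service X"
abbreviation "B \<equiv> routed X"
abbreviation "D \<equiv> departed X"
abbreviation "R \<equiv> reneged E \<delta>"

sublocale B: counting_path "B i" for i
  using dyn by unfold_locales (auto simp: dynamics_def)

lemma right_cont:
  assumes "t \<ge> 0"
  shows "continuous (at_right t) (Q i)" "continuous (at_right t) (P i)" "continuous (at_right t) (D i)"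
  using dyn assms by (auto simp: dynamics_def)

lemma queue_int: "t \<ge> 0 \<Longrightarrow> int (Q i t) = int (q0 i) + int (E i t) - int (B i t) - int (R i t)"
  and service_int: "t \<ge> 0 \<Longrightarrow> int (P i t) = int (\<psi>0 i) + int (B i t) - int (D i t)"
  and departed_eq: "t \<ge> 0 \<Longrightarrow> D i t = S i (integral {0..t} (\<lambda>u. real (P i u)))"
  and servers: "t \<ge> 0 \<Longrightarrow> (\<Sum>i\<in>UNIV. P i t) \<le> n"
  and nonidling: "t \<ge> 0 \<Longrightarrow> 0 < (\<Sum>i\<in>UNIV. Q i t) \<Longrightarrow> (\<Sum>i\<in>UNIV. P i t) = n"
  and policy: "follows_policy pol n q0 \<psi>0 E \<delta> X"
  using dyn by (auto simp: dynamics_def)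

lemma queue_real: "t \<ge> 0 \<Longrightarrow> real (Q i t) = real (q0 i) + real (E i t) - real (B i t) - real (R i t)"
  using queue_int[of t i] by linarith

lemma service_real: "t \<ge> 0 \<Longrightarrow> real (P i t) = real (\<psi>0 i) + real (B i t) - real (D i t)"
  using service_int[of t i] by linarith

lemma B_le: "0 \<le> s \<Longrightarrow> s \<le> t \<Longrightarrow> B i s \<le> B i t"
  using B.f_mono[of i] by (auto simp: mono_on_def)

lemma B_0: "B i 0 = 0" by (rule B.f_0)

text \<open>Queues go up and down, but they are combinations of the monotone counts E and B and of
  R, which is a function of E. Hence all of them are constant shortly before t, with a common
  starting point for all classes.\<close>

lemma left_const:
  assumes "t > 0"
  obtains s where "0 \<le> s" "s < t" "\<And>i u. s \<le> u \<Longrightarrow> u < t \<Longrightarrow> E i u = E i s \<and> B i u = B i s \<and> Q i u = Q i s \<and> R i u = R i s"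
    "\<And>i u. s \<le> u \<Longrightarrow> u < t \<Longrightarrow> left_lim (Q i) t = Q i u"
proof -
  have "\<exists>s\<ge>0. s < t \<and> (\<forall>u. s \<le> u \<longrightarrow> u < t \<longrightarrow> E i u = left_lim (E i) t \<and> B i u = left_lim (B i) t)" for i
  proof -
    obtain s1 where s1: "0 \<le> s1" "s1 < t" "\<And>u. s1 \<le> u \<Longrightarrow> u < t \<Longrightarrow> E i u = E i s1"
      using nat_left_const[OF E_mono assms] by metis
    obtain s2 where s2: "0 \<le> s2" "s2 < t" "\<And>u. s2 \<le> u \<Longrightarrow> u < t \<Longrightarrow> B i u = B i s2"
      using nat_left_const[OF B.f_mono assms] by metis
    have lim: "left_lim (E i) t = E i s1" "left_lim (B i) t = B i s2"
      by (rule left_lim_const[OF s1(2)], erule (1) s1(3)) (rule left_lim_const[OF s2(2)], erule (1) s2(3))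
    have "E i u = left_lim (E i) t \<and> B i u = left_lim (B i) t" if "max s1 s2 \<le> u" "u < t" for u
      unfolding lim using s1(3)[of u] s2(3)[of u] that by linarith
    then show ?thesis using s1(1,2) s2(1,2) by (metis max_def)
  qed
  then obtain s where s: "0 \<le> s" "s < t"
    "\<And>i u. s \<le> u \<Longrightarrow> u < t \<Longrightarrow> E i u = left_lim (E i) t \<and> B i u = left_lim (B i) t"
    using finite_common_left[of t "\<lambda>i u. E i u = left_lim (E i) t \<and> B i u = left_lim (B i) t"] by metis
  have EB: "E i u = E i s \<and> B i u = B i s" if "s \<le> u" "u < t" for i u using s(3)[OF that] s(3)[of s] s(2) by auto
  have RR: "R i u = R i s" if "s \<le> u" "u < t" for i u using EB[OF that, of i] by (simp add: reneged_def)
  have QQ: "Q i u = Q i s" if "s \<le> u" "u < t" for i u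
  proof -
    have "0 \<le> u" using s(1) that by simp
    then show ?thesis
      using queue_int[of u i] queue_int[OF s(1), of i] EB[OF that, of i] RR[OF that, of i] by linarith
  qed
  have "left_lim (Q i) t = Q i u" if "s \<le> u" "u < t" for i u
    unfolding QQ[OF that] by (rule left_lim_const[OF s(2)]) (rule QQ)
  then show ?thesis using that s(1,2) EB RR QQ by blast
qed

text \<open>A queue length is a natural number, so one nonempty queue of higher priority already
  makes the integrand at least 1.\<close>

lemma priority_const:
  assumes "pol = FP" "0 \<le> a" "a \<le> b" "\<And>t. a < t \<Longrightarrow> t \<le> b \<Longrightarrow> \<exists>k<i. 0 < Q k t"
  shows "B i b = B i a"
proof (rule B.const_if_integral_0)
  show "(\<integral>\<^sup>+ t\<in>{0..}. (\<Sum>k\<in>{..<i}. ennreal (real (Q k t))) \<partial>stieltjes (B i)) = 0"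
    using policy assms(1) by (simp add: follows_policy_def fp_condition_def)
  fix t assume "a < t" "t \<le> b"
  then obtain k where k: "k < i" "0 < Q k t" using assms by blast
  have "(1::ennreal) \<le> ennreal (real (Q k t))" using k by (metis One_nat_def Suc_leI ennreal_1 ennreal_leI of_nat_1 of_nat_le_iff)
  also have "\<dots> \<le> (\<Sum>k\<in>{..<i}. ennreal (real (Q k t)))" using k by (intro member_le_sum) auto
  finally show "1 \<le> (\<Sum>k\<in>{..<i}. ennreal (real (Q k t)))" .
qed fact+

lemma priority_no_jump:
  assumes "pol = FP" "0 \<le> s" "s < u" "\<And>v. s \<le> v \<Longrightarrow> v < u \<Longrightarrow> B i v = B i s" "k < i" "0 < Q k u"
  shows "B i u = B i s"
proof (rule B.no_jump_if_integral_0)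
  show "(\<integral>\<^sup>+ t\<in>{0..}. (\<Sum>k\<in>{..<i}. ennreal (real (Q k t))) \<partial>stieltjes (B i)) = 0"
    using policy assms(1) by (simp add: follows_policy_def fp_condition_def)
  have "(1::ennreal) \<le> ennreal (real (Q k u))" using assms by (metis One_nat_def Suc_leI ennreal_1 ennreal_leI of_nat_1 of_nat_le_iff)
  also have "\<dots> \<le> (\<Sum>k\<in>{..<i}. ennreal (real (Q k u)))" using assms by (intro member_le_sum) auto
  finally show "1 \<le> (\<Sum>k\<in>{..<i}. ennreal (real (Q k u)))" .
qed (fact assms)+

lemma longest_const:
  assumes "pol = SLQ tie" "0 \<le> a" "a \<le> b"
    "\<And>t. a < t \<Longrightarrow> t \<le> b \<Longrightarrow> \<exists>k. left_lim (Q i) t < left_lim (Q k) t"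
  shows "B i b = B i a"
proof (rule B.const_if_integral_0)
  show "(\<integral>\<^sup>+ t\<in>{0..}. indicator {s. left_lim (Q i) s < Max (range (\<lambda>k. left_lim (Q k) s))} t \<partial>stieltjes (B i)) = 0"
    using policy assms(1) by (simp add: follows_policy_def slq_condition_def)
  fix t assume "a < t" "t \<le> b"
  then obtain k where k: "left_lim (Q i) t < left_lim (Q k) t" using assms by blast
  also have "\<dots> \<le> Max (range (\<lambda>k. left_lim (Q k) t))" by (rule Max_ge) auto
  finally show "(1::ennreal) \<le> indicator {s. left_lim (Q i) s < Max (range (\<lambda>k. left_lim (Q k) s))} t" by simp
qed fact+

end

section \<open>Uniqueness of paths up to a given time\<close>

definition agree :: "'c paths \<Rightarrow> 'c paths \<Rightarrow> real \<Rightarrow> bool"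
  where "agree X Y t \<longleftrightarrow> (\<forall>i. queue X i t = queue Y i t \<and> in_service X i t = in_service Y i t \<and>
    routed X i t = routed Y i t \<and> departed X i t = departed Y i t)"

text \<open>At one instant, \<open>b i\<close> of the \<open>avail i\<close> customers of class i
  enter service and \<open>q i\<close> remain; p is the number in service apart from these. The
  total is forced: the smaller of two totals would leave a customer waiting, hence all servers busy,
  so the larger would exceed n. At the first class where two allocations differ, the smaller one
  leaves somebody waiting and so routes nobody of a later class, which contradicts equal
  totals.\<close>

lemma priority_allocation_unique:
  fixes b b' avail q q' :: "'c::{finite,linorder} \<Rightarrow> nat"
  assumes q: "\<And>i. q i + b i = avail i" and q': "\<And>i. q' i + b' i = avail i"
    and cap: "p + int (sum b UNIV) \<le> n" "p + int (sum b' UNIV) \<le> n"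
    and busy: "0 < sum q UNIV \<Longrightarrow> p + int (sum b UNIV) = n" "0 < sum q' UNIV \<Longrightarrow> p + int (sum b' UNIV) = n"
    and prio: "\<And>i k. k < i \<Longrightarrow> 0 < b i \<Longrightarrow> q k = 0" "\<And>i k. k < i \<Longrightarrow> 0 < b' i \<Longrightarrow> q' k = 0"
  shows "b = b'"
proof -
  have sums: "sum q UNIV + sum b UNIV = sum avail UNIV" "sum q' UNIV + sum b' UNIV = sum avail UNIV"
    using q q' by (simp_all add: sum.distrib[symmetric])
  have tot: "sum b UNIV = sum b' UNIV"
  proof (cases "sum b UNIV" "sum b' UNIV" rule: linorder_cases)
    case less
    then have "p + int (sum b UNIV) = n" using sums busy(1) by linarith
    then show ?thesis using cap(2) less by linarith
  next
    case greater
    then have "p + int (sum b' UNIV) = n" using sums busy(2) by linarith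
    then show ?thesis using cap(1) greater by linarith
  qed
  have less_False: False if "sum c UNIV = sum d UNIV" "c i < d i" "\<And>k. k < i \<Longrightarrow> c k = d k"
    "\<And>i. r i + c i = avail i" "\<And>i. r' i + d i = avail i" "\<And>i k. k < i \<Longrightarrow> 0 < c i \<Longrightarrow> r k = 0"
    for c d r r' :: "'c \<Rightarrow> nat" and i
  proof -
    have "r i > 0" using that(2) that(4)[of i] that(5)[of i] by simp
    then have "c k = 0" if "i < k" for k using \<open>\<And>i k. k < i \<Longrightarrow> 0 < c i \<Longrightarrow> r k = 0\<close>[OF that] by fastforce
    then have "sum c UNIV < sum d UNIV"
      using that(2,3) by (intro sum_strict_mono_ex1) (auto, metis le_eq_less_or_eq linorder_neqE zero_le)
    then show False using that(1) by simp
  qed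
  show ?thesis
  proof (rule ccontr)
    assume "b \<noteq> b'"
    then have ne: "{i. b i \<noteq> b' i} \<noteq> {}" by (auto simp: fun_eq_iff)
    define i where "i = Min {i. b i \<noteq> b' i}"
    have i: "b i \<noteq> b' i" "\<And>k. k < i \<Longrightarrow> b k = b' k"
      using Min_in[OF _ ne] Min_le[of "{i. b i \<noteq> b' i}"] by (auto simp: i_def not_less[symmetric])
    show False
    proof (cases "b i" "b' i" rule: linorder_cases)
      case less
      show False by (rule less_False[OF tot less i(2) q q']) (assumption | erule (1) prio(1))+
    next
      case greater
      show False
        by (rule less_False[OF tot[symmetric] greater i(2)[symmetric] q' q]) (assumption | erule (1) prio(2))+
    qed (use i(1) in simp)
  qed
qed

text \<open>
  At the infimum of the times of disagreement the departures still agree, as they depend on the past only,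
  and the policy then determines the routing; right continuity propagates the agreement.
\<close>

lemma dynamics_unique:
  fixes E :: "'c::{finite,linorder} counts"
  assumes path: "queueing_path E pol n q0 \<psi>0 S \<delta> X" and path': "queueing_path E pol n q0 \<psi>0 S \<delta>' X'"
    and same: "\<And>u i j. 0 \<le> u \<Longrightarrow> ereal u < T \<Longrightarrow> \<forall>v\<in>{0..<u}. agree X X' v \<Longrightarrow> 1 \<le> j \<Longrightarrow> j \<le> E i u
        \<Longrightarrow> \<delta> i j = \<delta>' i j"
    and t: "0 \<le> t" "ereal t < T"
  shows "agree X X' t"
proof -
  interpret X: queueing_path E pol n q0 \<psi>0 S \<delta> X by fact
  interpret X': queueing_path E pol n q0 \<psi>0 S \<delta>' X' by fact
  have step: "agree X X' u" if u: "0 \<le> u" "ereal u < T" and before: "\<forall>v\<in>{0..<u}. agree X X' v" for u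
  proof -
    have \<delta>: "\<delta> i j = \<delta>' i j" if "1 \<le> j" "j \<le> E i u" for i j using same[OF u before that] .
    have R: "X.R i v = X'.R i v" if "0 \<le> v" "v \<le> u" for i v
      using \<delta> X.E_le[OF that, of i] unfolding reneged_def by (intro sum.cong) auto
    have D: "X.D i v = X'.D i v" if "0 \<le> v" "v \<le> u" for i v
    proof -
      \<comment> \<open>Agreement at v itself is not known yet, but a single point does not affect
        the integral that determines the departures.\<close>
      have "integral {0..v} (\<lambda>w. real (X.P i w)) = integral {0..v} (\<lambda>w. real (X'.P i w))"
        using before that by (intro integral_spike[where S="{v}"]) (auto simp: agree_def)
      then show ?thesis using X.departed_eq[OF that(1)] X'.departed_eq[OF that(1)] by simp
    qed
    have B: "X.B i u = X'.B i u" for i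
    proof (cases pol)
      case (SLQ tie)
      have "X.B i u = tie n q0 \<psi>0 u (\<lambda>s\<in>{0..u}. \<lambda>k. (E k s, X.R k s, X.D k s)) (\<lambda>s\<in>{0..<u}. \<lambda>k. X.B k s) i"
        using X.policy u by (simp add: SLQ follows_policy_def)
      also have "(\<lambda>s\<in>{0..u}. \<lambda>k. (E k s, X.R k s, X.D k s)) = (\<lambda>s\<in>{0..u}. \<lambda>k. (E k s, X'.R k s, X'.D k s))"
        using R D by (intro restrict_ext) auto
      also have "(\<lambda>s\<in>{0..<u}. \<lambda>k. X.B k s) = (\<lambda>s\<in>{0..<u}. \<lambda>k. X'.B k s)"
        using before by (intro restrict_ext) (auto simp: agree_def)
      also have "tie n q0 \<psi>0 u (\<lambda>s\<in>{0..u}. \<lambda>k. (E k s, X'.R k s, X'.D k s)) (\<lambda>s\<in>{0..<u}. \<lambda>k. X'.B k s) i = X'.B i u"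
        using X'.policy u by (simp add: SLQ follows_policy_def)
      finally show ?thesis .
    next
      case FP
      show ?thesis
      proof (cases "u = 0")
        case True
        then show ?thesis by (simp add: X.B_0 X'.B_0)
      next
        case False
        then have "u > 0" using u by simp
        obtain s1 where s1: "0 \<le> s1" "s1 < u" "\<And>i w. s1 \<le> w \<Longrightarrow> w < u \<Longrightarrow> X.B i w = X.B i s1"
          using X.left_const[OF \<open>u > 0\<close>] by metis
        obtain s2 where s2: "0 \<le> s2" "s2 < u" "\<And>i w. s2 \<le> w \<Longrightarrow> w < u \<Longrightarrow> X'.B i w = X'.B i s2"
          using X'.left_const[OF \<open>u > 0\<close>] by metis
        define s where "s = max s1 s2"
        have s: "0 \<le> s" "s < u" using s1 s2 by (auto simp: s_def)
        have cB: "X.B i w = X.B i s" "X'.B i w = X'.B i s" if "s \<le> w" "w < u" for i w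
          using s1(3)[of w i] s1(3)[of s i] s2(3)[of w i] s2(3)[of s i] that s by (auto simp: s_def)
        have BB: "X.B i s = X'.B i s" for i using before s by (auto simp: agree_def)
        have le: "X.B i s \<le> X.B i u" "X'.B i s \<le> X'.B i u" for i
          using X.B_le[of s u i] X'.B_le[of s u i] s by auto
        \<comment> \<open>Since routing is constant shortly before u, b and b' count the customers
          routed at the instant u.\<close>
        define b where "b i = X.B i u - X.B i s" for i
        define b' where "b' i = X'.B i u - X'.B i s" for i
        have Pb: "int (X.P i u) = int (\<psi>0 i) + int (X.B i s) + int (b i) - int (X.D i u)"
          "int (X'.P i u) = int (\<psi>0 i) + int (X.B i s) + int (b' i) - int (X.D i u)" for i
          using X.service_int[OF u(1), of i] X'.service_int[OF u(1), of i] le[of i] BB[of i] D[of u i] u(1)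
          by (auto simp: b_def b'_def of_nat_diff)
        define c where "c = (\<Sum>i\<in>UNIV. int (\<psi>0 i) + int (X.B i s) - int (X.D i u))"
        have "int (\<Sum>i\<in>UNIV. X.P i u) = (\<Sum>i\<in>UNIV. (int (\<psi>0 i) + int (X.B i s) - int (X.D i u)) + int (b i))"
          unfolding of_nat_sum by (intro sum.cong refl) (simp add: Pb)
        then have c1: "int (\<Sum>i\<in>UNIV. X.P i u) = c + int (sum b UNIV)" by (simp add: sum.distrib c_def)
        have "int (\<Sum>i\<in>UNIV. X'.P i u) = (\<Sum>i\<in>UNIV. (int (\<psi>0 i) + int (X.B i s) - int (X.D i u)) + int (b' i))"
          unfolding of_nat_sum by (intro sum.cong refl) (simp add: Pb)
        then have c2: "int (\<Sum>i\<in>UNIV. X'.P i u) = c + int (sum b' UNIV)" by (simp add: sum.distrib c_def)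
        have avail: "X.Q i u + b i = X'.Q i u + b' i" for i
          using X.queue_int[OF u(1), of i] X'.queue_int[OF u(1), of i] le[of i] BB[of i] R[of u i] u(1)
          by (simp add: b_def b'_def)
        have "b = b'"
        proof (rule priority_allocation_unique[where q="\<lambda>i. X.Q i u" and q'="\<lambda>i. X'.Q i u" and p=c and n="int n"])
          show "X.Q i u + b i = X.Q i u + b i" "X'.Q i u + b' i = X.Q i u + b i" for i using avail by auto
          show "c + int (sum b UNIV) \<le> int n" "c + int (sum b' UNIV) \<le> int n"
            using X.servers[OF u(1)] X'.servers[OF u(1)] c1 c2 by linarith+
          show "c + int (sum b UNIV) = int n" if "0 < (\<Sum>i\<in>UNIV. X.Q i u)"
            using X.nonidling[OF u(1) that] c1 by simp
          show "c + int (sum b' UNIV) = int n" if "0 < (\<Sum>i\<in>UNIV. X'.Q i u)"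
            using X'.nonidling[OF u(1) that] c2 by simp
          show "X.Q k u = 0" if "k < i" "0 < b i" for i k
            using X.priority_no_jump[OF FP s, of i k, OF cB(1)] that unfolding b_def by fastforce
          show "X'.Q k u = 0" if "k < i" "0 < b' i" for i k
            using X'.priority_no_jump[OF FP s, of i k, OF cB(2)] that unfolding b'_def by fastforce
        qed
        then have "b i = b' i" by simp
        then show ?thesis using le[of i] BB[of i] by (simp add: b_def b'_def)
      qed
    qed
    show ?thesis unfolding agree_def
    proof (intro allI conjI)
      fix i
      show "X.B i u = X'.B i u" "X.D i u = X'.D i u" using B D u by auto
      then show "X.Q i u = X'.Q i u" "X.P i u = X'.P i u"
        using X.queue_int[OF u(1), of i] X'.queue_int[OF u(1), of i] X.service_int[OF u(1), of i]
          X'.service_int[OF u(1), of i] R[of u i] u by auto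
    qed
  qed
  show ?thesis
  proof (rule ccontr)
    assume "\<not> agree X X' t"
    define A where "A = {u. 0 \<le> u \<and> ereal u < T \<and> \<not> agree X X' u}"
    have A: "t \<in> A" "bdd_below A" using t \<open>\<not> agree X X' t\<close> by (auto simp: A_def bdd_below_def)
    define s where "s = Inf A"
    have "s \<le> t" unfolding s_def using A by (intro cInf_lower)
    have s0: "0 \<le> s" unfolding s_def using A by (intro cInf_greatest) (auto simp: A_def)
    have sT: "ereal s < T" using \<open>s \<le> t\<close> t(2) by (meson ereal_less_eq(3) le_less_trans)
    have before: "agree X X' v" if "0 \<le> v" "v < s" for v
    proof (rule ccontr)
      assume "\<not> agree X X' v"
      moreover have "ereal v < T" using that sT by (meson ereal_less_eq(3) le_less_trans less_imp_le)
      ultimately have "v \<in> A" using that by (simp add: A_def)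
      then show False using cInf_lower[of v A] A that by (simp add: s_def)
    qed
    have at: "agree X X' s" using step[OF s0 sT] before by simp
    have "\<exists>d>s. \<forall>u. s \<le> u \<longrightarrow> u < d \<longrightarrow>
      f u = f s" if "continuous (at_right s) f" for f :: "real \<Rightarrow> nat"
      using nat_right_const[OF that] by metis
    note rc = this
    have "\<exists>d>s. \<forall>u. s \<le> u \<longrightarrow> u < d \<longrightarrow>
      queue X i u = queue X' i u \<and> in_service X i u = in_service X' i u \<and>
      routed X i u = routed X' i u \<and> departed X i u = departed X' i u" for i
    proof -
      have "\<exists>d>s. \<forall>u. s \<le> u \<longrightarrow> u < d \<longrightarrow> f u = g u"
        if fg: "continuous (at_right s) f" "continuous (at_right s) g" "f s = g s" for f g :: "real \<Rightarrow> nat"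
      proof -
        obtain d1 where d1: "d1 > s" "\<forall>u. s \<le> u \<longrightarrow> u < d1 \<longrightarrow> f u = f s" using rc[OF fg(1)] by blast
        obtain d2 where d2: "d2 > s" "\<forall>u. s \<le> u \<longrightarrow> u < d2 \<longrightarrow> g u = g s" using rc[OF fg(2)] by blast
        have "f u = g u" if "s \<le> u" "u < min d1 d2" for u
          using d1(2)[rule_format, of u] d2(2)[rule_format, of u] fg(3) that by linarith
        then show ?thesis using d1(1) d2(1) by (intro exI[of _ "min d1 d2"]) simp
      qed
      note two = this
      have at_eq: "X.Q i s = X'.Q i s" "X.P i s = X'.P i s" "X.B i s = X'.B i s" "X.D i s = X'.D i s"
        using at by (simp_all add: agree_def)
      obtain d1 where d1: "d1 > s" "\<forall>u. s \<le> u \<longrightarrow> u < d1 \<longrightarrow> X.Q i u = X'.Q i u"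
        using two[OF X.right_cont(1)[OF s0] X'.right_cont(1)[OF s0] at_eq(1)] by blast
      obtain d2 where d2: "d2 > s" "\<forall>u. s \<le> u \<longrightarrow> u < d2 \<longrightarrow> X.P i u = X'.P i u"
        using two[OF X.right_cont(2)[OF s0] X'.right_cont(2)[OF s0] at_eq(2)] by blast
      obtain d3 where d3: "d3 > s" "\<forall>u. s \<le> u \<longrightarrow> u < d3 \<longrightarrow> X.B i u = X'.B i u"
        using two[OF X.B.f_right_cont[OF s0] X'.B.f_right_cont[OF s0] at_eq(3)] by blast
      obtain d4 where d4: "d4 > s" "\<forall>u. s \<le> u \<longrightarrow> u < d4 \<longrightarrow> X.D i u = X'.D i u"
        using two[OF X.right_cont(3)[OF s0] X'.right_cont(3)[OF s0] at_eq(4)] by blast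
      show ?thesis using d1 d2 d3 d4 by (intro exI[of _ "min (min d1 d2) (min d3 d4)"]) simp
    qed
    from finite_common_right[of s "\<lambda>i u. queue X i u = queue X' i u \<and> in_service X i u = in_service X' i u \<and>
      routed X i u = routed X' i u \<and> departed X i u = departed X' i u", OF this]
    obtain d where d: "d > s" "\<And>u. s \<le> u \<Longrightarrow> u < d \<Longrightarrow> agree X X' u"
      unfolding agree_def by blast
    obtain u where "u \<in> A" "u < d" using cInf_lessD[of A d] A d by (auto simp: s_def)
    moreover have "s \<le> u" unfolding s_def using A \<open>u \<in> A\<close> by (intro cInf_lower)
    ultimately show False using d(2)[of u] by (simp add: A_def)
  qed
qed

section \<open>Total counts and refusals\<close>

definition total :: "'c::finite counts \<Rightarrow> real \<Rightarrow> real"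
  where "total f t = (\<Sum>i\<in>UNIV. real (f i t))"

lemma total_nonneg: "0 \<le> total f t"
  by (simp add: total_def sum_nonneg)

lemma total_pos_iff: "0 < total f t \<longleftrightarrow> (\<exists>i. 0 < f i t)"
proof -
  have "total f t = 0 \<longleftrightarrow> (\<forall>i. f i t = 0)"
    unfolding total_def by (subst sum_nonneg_eq_0_iff) auto
  moreover have "0 < total f t \<longleftrightarrow> total f t \<noteq> 0" using total_nonneg[of f t] by linarith
  ultimately show ?thesis by simp
qed

lemma le_total: "real (f i t) \<le> total f t"
  unfolding total_def by (rule member_le_sum) auto

text \<open>The decisions are those of the threshold profile except possibly for the customer \<open>dev\<close>.\<close>

locale game_path = queueing_path E pol n q0 \<psi>0 S \<delta> X
  for E :: "'c::{finite,linorder} counts" and pol n q0 \<psi>0 S \<delta> X +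
  fixes thr :: "'c \<Rightarrow> nat \<Rightarrow> bool" and dev :: "'c \<times> nat"
  assumes decide: "\<And>i j t. 1 \<le> j \<Longrightarrow> 0 \<le> t \<Longrightarrow> j \<le> E i t \<Longrightarrow> (i, j) \<noteq> dev \<Longrightarrow>
      \<delta> i j = thr i (left_lim (queue X i) (real_of_ereal (arrival_time E i j)))"
    and thr_0: "\<And>i. thr i 0"
begin

lemma total_R_le: "0 \<le> s \<Longrightarrow> s \<le> t \<Longrightarrow> total R s \<le> total R t"
  unfolding total_def using reneged_le[of s t \<delta>] by (intro sum_mono) simp

lemma balance:
  assumes "t \<ge> 0"
  shows "total Q t + total P t = (\<Sum>i\<in>UNIV. real (q0 i) + real (\<psi>0 i)) + total E t - total D t - total R t"
  using queue_real[OF assms] service_real[OF assms] unfolding total_def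
  by (simp add: sum.distrib sum_subtractf)

lemma total_P_le: "t \<ge> 0 \<Longrightarrow> total P t \<le> real n"
  using servers[of t] by (simp add: total_def flip: of_nat_sum)

lemma total_P_busy:
  assumes "t \<ge> 0" "0 < total Q t"
  shows "total P t = real n"
proof -
  have "0 < (\<Sum>i\<in>UNIV. Q i t)" using assms(2) unfolding total_def by (simp flip: of_nat_sum)
  then show ?thesis using nonidling[OF assms(1)] by (simp add: total_def flip: of_nat_sum)
qed

text \<open>Non-idling in reflection form: the total queue is the positive part of the number in the
  system minus n, hence a Lipschitz function of that number.\<close>

lemma total_Q_eq: "t \<ge> 0 \<Longrightarrow> total Q t = max 0 (total Q t + total P t - real n)"
  using total_P_le[of t] total_P_busy[of t] total_nonneg[of Q t] by (cases "0 < total Q t") auto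

lemma few_reneged:
  assumes vt: "0 \<le> v" "v \<le> t"
    and dev: "\<And>k j. E k v < j \<Longrightarrow> j \<le> E k t \<Longrightarrow> \<not> \<delta> k j \<Longrightarrow> (k, j) = dev"
  shows "total R t \<le> total R v + 1"
proof -
  have "real (R k t) \<le> real (R k v) + (if k = fst dev then 1 else 0)" for k
  proof -
    have "{j\<in>{E k v<..E k t}. \<not> \<delta> k j} \<subseteq> (if k = fst dev then {snd dev} else {})"
    proof
      fix j assume "j \<in> {j\<in>{E k v<..E k t}. \<not> \<delta> k j}"
      then have "(k, j) = dev" using dev[of k j] by simp
      then show "j \<in> (if k = fst dev then {snd dev} else {})" by auto
    qed
    then have "card {j\<in>{E k v<..E k t}. \<not> \<delta> k j} \<le> card (if k = fst dev then {snd dev} else {})"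
      by (intro card_mono) auto
    then show ?thesis using reneged_diff[OF vt, of \<delta> k] by (auto split: if_splits)
  qed
  then have "total R t \<le> (\<Sum>k\<in>UNIV. real (R k v) + (if k = fst dev then 1 else 0))"
    unfolding total_def by (intro sum_mono)
  also have "\<dots> = total R v + 1" by (simp add: total_def sum.distrib)
  finally show ?thesis .
qed

text \<open>After the last refusal that obeys the threshold rule, only the customer
  \<open>dev\<close> can refuse, whence the 1. Refusals over a window can thereby be bounded from
  the state just before a single time v, when some queue was above its threshold.\<close>

lemma last_renege:
  assumes st: "0 \<le> s" "s \<le> t"
  shows "total R t \<le> total R s + 1 \<or>
    (\<exists>v k. s < v \<and> v \<le> t \<and> \<not> thr k (left_lim (Q k) v) \<and> total R t \<le> total R v + 1)"
proof -
  define A where "A = {v. s < v \<and> v \<le> t \<and> (\<exists>k j. 1 \<le> j \<and> j \<le> E k t \<and> (k, j) \<noteq> dev \<and> \<not> \<delta> k j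
    \<and> arrival_time E k j = ereal v)}"
  have "A \<subseteq> (\<lambda>(k, j). real_of_ereal (arrival_time E k j)) ` (SIGMA k:UNIV. {..E k t})"
  proof
    fix v assume "v \<in> A"
    then obtain k j where "j \<le> E k t" "arrival_time E k j = ereal v" unfolding A_def by blast
    then show "v \<in> (\<lambda>(k, j). real_of_ereal (arrival_time E k j)) ` (SIGMA k:UNIV. {..E k t})"
      by (intro image_eqI[of _ _ "(k, j)"]) auto
  qed
  then have fin: "finite A" by (rule finite_subset) auto
  have few: "total R t \<le> total R v + 1" if v: "s \<le> v" "v \<le> t" "\<And>w. w \<in> A \<Longrightarrow> w \<le> v" for v
  proof (rule few_reneged)
    fix k j assume j: "E k v < j" "j \<le> E k t" "\<not> \<delta> k j"
    show "(k, j) = dev"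
    proof (rule ccontr)
      assume ne: "(k, j) \<noteq> dev"
      have "1 \<le> j" "0 \<le> t" using j st by auto
      then obtain w where w: "arrival_time E k j = ereal w" "0 < w" "w \<le> t" "j \<le> E k w"
        using arrival_timeE[OF _ _ j(2)] by blast
      have "v < w"
      proof (rule ccontr)
        assume "\<not> v < w"
        then have "E k w \<le> E k v" using w by (intro E_le) auto
        then show False using w j by simp
      qed
      then have "s < w" using v by simp
      then have "w \<in> A" using w(1,3) \<open>1 \<le> j\<close> j ne unfolding A_def by blast
      then show False using v(3) \<open>v < w\<close> by force
    qed
  qed (use st v in auto)
  show ?thesis
  proof (cases "A = {}")
    case True
    then show ?thesis using few[of s] st by simp
  next
    case False
    define v where "v = Max A"
    have v: "v \<in> A" "\<And>w. w \<in> A \<Longrightarrow> w \<le> v" using fin False by (auto simp: v_def)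
    then obtain k j where kj: "s < v" "v \<le> t" "1 \<le> j" "j \<le> E k t" "(k, j) \<noteq> dev" "\<not> \<delta> k j"
      "arrival_time E k j = ereal v" unfolding A_def by blast
    have "\<not> thr k (left_lim (Q k) v)" using decide[of j t k] kj st by auto
    then show ?thesis using few[of v] v kj by (intro disjI2 exI[of _ v] exI[of _ k]) auto
  qed
qed

text \<open>The customer \<open>dev\<close> may join although the rule says otherwise, whence the
  -1.\<close>

lemma all_renege:
  assumes st: "0 \<le> s" "s \<le> t" and no: "\<And>u. s \<le> u \<Longrightarrow> u < t \<Longrightarrow> \<not> thr k (Q k u)"
  shows "real (R k t) \<ge> real (R k s) + (real (E k t) - real (E k s)) - 1"
proof -
  have "{E k s<..E k t} - {snd dev} \<subseteq> {j\<in>{E k s<..E k t}. \<not> \<delta> k j}"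
  proof
    fix j assume "j \<in> {E k s<..E k t} - {snd dev}"
    then have j: "E k s < j" "j \<le> E k t" "(k, j) \<noteq> dev" by auto
    have "1 \<le> j" "0 \<le> t" using j st by auto
    then obtain v where v: "arrival_time E k j = ereal v" "0 < v" "v \<le> t" "j \<le> E k v"
      using arrival_timeE[OF _ _ j(2)] by blast
    have "s < v"
    proof (rule ccontr)
      assume "\<not> s < v"
      then have "E k v \<le> E k s" using v by (intro E_le) auto
      then show False using v j by simp
    qed
    obtain s' where s': "0 \<le> s'" "s' < v" "\<And>i u. s' \<le> u \<Longrightarrow> u < v \<Longrightarrow> left_lim (Q i) v = Q i u"
      using left_const[OF v(2)] by metis
    have "left_lim (Q k) v = Q k (max s s')" using \<open>s < v\<close> s' by (intro s'(3)) auto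
    moreover have "\<not> thr k (Q k (max s s'))" using no[of "max s s'"] \<open>s < v\<close> s' v by auto
    ultimately have "\<not> \<delta> k j" using decide[OF \<open>1 \<le> j\<close> \<open>0 \<le> t\<close> j(2,3)] v by simp
    then show "j \<in> {j\<in>{E k s<..E k t}. \<not> \<delta> k j}" using j by simp
  qed
  then have "card ({E k s<..E k t} - {snd dev}) \<le> card {j\<in>{E k s<..E k t}. \<not> \<delta> k j}"
    by (intro card_mono) auto
  moreover have "card {E k s<..E k t} \<le> card ({E k s<..E k t} - {snd dev}) + 1"
    by (simp only: card_Diff_singleton_if) auto
  ultimately show ?thesis using reneged_diff[OF st, of \<delta> k] E_le[OF st, of k] by simp
qed

end

section \<open>Measurability and Gronwall's inequality\<close>

text \<open>The points \<open>g m x\<close> lie on a grid of mesh \<open>1 / (m + 1)\<close>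
  strictly to the right of x and converge to x; along them f takes countably many values and
  converges by right continuity.\<close>

lemma right_continuous_measurable:
  fixes f :: "real \<Rightarrow> real"
  assumes rc: "\<And>x. continuous (at_right x) f"
  shows "f \<in> borel_measurable borel"
proof (rule borel_measurable_LIMSEQ_real)
  define g where "g m x = (real_of_int \<lfloor>x * real (Suc m)\<rfloor> + 1) / real (Suc m)" for m x
  show "(\<lambda>x. f (g m x)) \<in> borel_measurable borel" for m
  proof -
    have "(\<lambda>k::int. f ((real_of_int k + 1) / real (Suc m))) \<in> measurable (count_space UNIV) borel" by simp
    moreover have "(\<lambda>x::real. \<lfloor>x * real (Suc m)\<rfloor>) \<in> measurable borel (count_space UNIV)" by measurable
    ultimately show ?thesis unfolding g_def by (rule measurable_compose[rotated])
  qed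
  show "(\<lambda>m. f (g m x)) \<longlonglongrightarrow> f x" for x
  proof -
    have gt: "g m x > x" for m
    proof -
      have "x * real (Suc m) < real_of_int \<lfloor>x * real (Suc m)\<rfloor> + 1" by linarith
      then show ?thesis by (simp add: g_def pos_less_divide_eq del: of_nat_Suc)
    qed
    have le: "g m x \<le> x + 1 / real (Suc m)" for m
    proof -
      have "real_of_int \<lfloor>x * real (Suc m)\<rfloor> + 1 \<le> x * real (Suc m) + 1" by simp
      then have "g m x \<le> (x * real (Suc m) + 1) / real (Suc m)"
        unfolding g_def by (intro divide_right_mono) auto
      then show ?thesis by (simp add: add_divide_distrib del: of_nat_Suc)
    qed
    have "(\<lambda>m. g m x) \<longlonglongrightarrow> x"
    proof (rule tendsto_sandwich[of "\<lambda>_. x" _ _ "\<lambda>m. x + 1 / real (Suc m)"])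
      show "(\<lambda>m. x + 1 / real (Suc m)) \<longlonglongrightarrow> x"
        using tendsto_add[OF tendsto_const[of x] LIMSEQ_inverse_real_of_nat] by (simp add: inverse_eq_divide)
    qed (use gt le in \<open>auto intro!: always_eventually less_imp_le\<close>)
    then have "filterlim (\<lambda>m. g m x) (at_right x) sequentially"
      using gt by (intro filterlim_at_withinI always_eventually) auto
    then show ?thesis using rc[of x] by (auto simp: continuous_within intro: filterlim_compose)
  qed
qed

lemma right_continuous_integrable:
  fixes f :: "real \<Rightarrow> real"
  assumes rc: "\<And>x. x \<ge> 0 \<Longrightarrow> continuous (at_right x) f" and bd: "\<And>x. x \<ge> 0 \<Longrightarrow> \<bar>f x\<bar> \<le> K"
    and ab: "0 \<le> a"
  shows "f integrable_on {a..b}"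
proof -
  let ?g = "\<lambda>x. if x < 0 then 0 else f x"
  have "continuous (at_right x) ?g" for x
  proof (cases "x < 0")
    case True
    have "\<forall>\<^sub>F u in at_right x. ?g u = ?g x"
      using True by (auto simp: eventually_at_right_field intro!: exI[of _ 0])
    then show ?thesis by (simp only: continuous_within tendsto_eventually)
  next
    case False
    then have "(f \<longlongrightarrow> f x) (at_right x)" using rc[of x] by (simp add: continuous_within)
    moreover have "\<forall>\<^sub>F u in at_right x. f u = ?g u"
      using False by (auto simp: eventually_at_right_field intro!: exI[of _ "x + 1"])
    ultimately have "(?g \<longlongrightarrow> f x) (at_right x)" by (rule Lim_transform_eventually)
    then show ?thesis using False by (simp add: continuous_within)
  qed
  then have "?g \<in> borel_measurable borel" by (rule right_continuous_measurable)
  then have "?g \<in> borel_measurable (lebesgue_on {a..b})"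
    by (simp add: measurable_completion measurable_restrict_space1)
  then have "?g integrable_on {a..b}"
    by (rule measurable_bounded_by_integrable_imp_integrable[where g="\<lambda>_. \<bar>K\<bar>"])
      (use bd ab in \<open>auto intro: order_trans[OF _ abs_ge_self]\<close>)
  then show ?thesis by (rule integrable_eq) (use ab in auto)
qed

text \<open>The weight \<open>exp (- (2 * b * t))\<close> makes the integral operator a contraction
  with factor 1/2 in the supremum norm, hence \<open>m \<le> a + m / 2\<close>. This works for
  functions with jumps, at the price of the factors 2 in the bound.\<close>

lemma gronwall:
  fixes g :: "real \<Rightarrow> real"
  assumes int: "\<And>t. 0 \<le> t \<Longrightarrow> t \<le> T \<Longrightarrow> g integrable_on {0..t}"
    and bd: "\<And>t. 0 \<le> t \<Longrightarrow> t \<le> T \<Longrightarrow> g t \<le> K" and nonneg: "\<And>t. 0 \<le> t \<Longrightarrow> t \<le> T \<Longrightarrow> 0 \<le> g t"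
    and le: "\<And>t. 0 \<le> t \<Longrightarrow> t \<le> T \<Longrightarrow> g t \<le> a + b * integral {0..t} g"
    and b: "b > 0" and a: "a \<ge> 0" and t: "0 \<le> t" "t \<le> T"
  shows "g t \<le> 2 * a * exp (2 * b * t)"
proof -
  let ?w = "\<lambda>t. g t * exp (- (2 * b * t))"
  define m where "m = Sup (?w ` {0..T})"
  have bdd: "bdd_above (?w ` {0..T})"
  proof (rule bdd_aboveI2)
    fix t assume t: "t \<in> {0..T}"
    have "?w t \<le> g t * 1" using t b nonneg by (intro mult_left_mono) auto
    then show "?w t \<le> K" using bd[of t] t by simp
  qed
  have wm: "?w t \<le> m" if "0 \<le> t" "t \<le> T" for t
    unfolding m_def using bdd that by (intro cSup_upper) auto
  have gm: "g t \<le> m * exp (2 * b * t)" if "0 \<le> t" "t \<le> T" for t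
    using mult_right_mono[OF wm[OF that], of "exp (2 * b * t)"] by (simp add: exp_minus field_simps)
  have m0: "0 \<le> m" using wm[of 0] nonneg[of 0] t by simp
  have half: "?w t \<le> a + m / 2" if "0 \<le> t" "t \<le> T" for t
  proof -
    have "((\<lambda>u. m * exp (2 * b * u)) has_integral m * exp (2 * b * t) / (2 * b) - m * exp (2 * b * 0) / (2 * b)) {0..t}"
      using that b by (intro fundamental_theorem_of_calculus)
        (auto intro!: derivative_eq_intros simp flip: has_real_derivative_iff_has_vector_derivative)
    then have "integral {0..t} g \<le> m * exp (2 * b * t) / (2 * b) - m * exp (2 * b * 0) / (2 * b)"
      using gm that by (intro has_integral_le[OF integrable_integral[OF int[OF that]]]) auto
    also have "\<dots> \<le> m * exp (2 * b * t) / (2 * b)" using m0 b by simp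
    finally have "b * integral {0..t} g \<le> b * (m * exp (2 * b * t) / (2 * b))"
      using b by (intro mult_left_mono) auto
    also have "\<dots> = m / 2 * exp (2 * b * t)" using b by simp
    finally have "g t \<le> a + m / 2 * exp (2 * b * t)" using le[OF that] by simp
    then have "?w t \<le> (a + m / 2 * exp (2 * b * t)) * exp (- (2 * b * t))"
      by (rule mult_right_mono) simp
    also have "\<dots> = a * exp (- (2 * b * t)) + m / 2" by (simp add: exp_minus field_simps)
    also have "\<dots> \<le> a * 1 + m / 2" using a b that by (intro add_right_mono mult_left_mono) auto
    finally show ?thesis by simp
  qed
  have "m \<le> a + m / 2" unfolding m_def
    using half t by (intro cSup_least) (auto simp: m_def)
  then have "m \<le> 2 * a" by simp
  then have "m * exp (2 * b * t) \<le> 2 * a * exp (2 * b * t)" by (rule mult_right_mono) simp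
  then show ?thesis using gm[OF t] by linarith
qed

section \<open>Fluid estimates\<close>

text \<open>The condition \<open>1 \<le> \<eta> * sqrt n\<close> lets the error of a single
  customer, in particular the one caused by \<open>dev\<close>, disappear in
  \<open>\<eta> * sqrt n\<close>.\<close>

locale noisy_path = game_path E pol n q0 \<psi>0 S \<delta> X thr dev
  for E :: "'c::{finite,linorder} counts" and pol n q0 \<psi>0 S \<delta> X thr dev +
  fixes lam :: "'c \<Rightarrow> real" and \<eta> T :: real
  assumes lam: "\<And>i. lam i > 0" and eta: "0 < \<eta>" "\<eta> \<le> 1" and n: "1 \<le> n" "1 \<le> \<eta> * sqrt (real n)" and T: "1 \<le> T"
    and E_near: "\<And>i s t. 0 \<le> s \<Longrightarrow> s \<le> t \<Longrightarrow> t \<le> T \<Longrightarrow>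
      \<bar>real (E i t) - real (E i s) - real n * lam i * (t - s)\<bar> \<le> \<eta> * (sqrt (real n) + real n * (t - s))"
    and q0_small: "\<And>i. real (q0 i) \<le> \<eta> * sqrt (real n)"
begin

abbreviation "sq \<equiv> sqrt (real n)"

lemma sq: "1 \<le> sq" "sq \<le> real n" "real n = sq * sq"
  using n(1) real_sqrt_le_mono[of "real n" "real n ^ 2"] by (auto simp: power2_eq_square)

lemma c_ge_1: "1 \<le> real CARD('c)"
  using zero_less_card_finite[where 'a='c] by linarith

text \<open>Applying the window bound to ever shorter windows ending in v leaves only the term
  \<open>\<eta> * sqrt n\<close>.\<close>

lemma E_jump:
  assumes s: "0 \<le> s" "s < v" "v \<le> T" and const: "\<And>u. s \<le> u \<Longrightarrow> u < v \<Longrightarrow> E i u = E i s"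
  shows "real (E i v) - real (E i s) \<le> \<eta> * sq"
proof (rule field_le_epsilon)
  fix e :: real assume e: "e > 0"
  define k where "k = real n * lam i + \<eta> * real n"
  have k: "k > 0" using lam n eta by (simp add: k_def add_pos_pos)
  define u where "u = max s (v - e / k)"
  have u: "s \<le> u" "u < v" "v - u \<le> e / k" using s e k by (auto simp: u_def)
  have "real (E i v) - real (E i s) = real (E i v) - real (E i u)" using const[OF u(1,2)] by simp
  also have "\<dots> \<le> k * (v - u) + \<eta> * sq"
    using abs_le_D1[OF E_near[of u v i]] u s by (simp add: k_def algebra_simps)
  also have "k * (v - u) \<le> e" using u(3) k by (simp add: field_simps)
  finally show "real (E i v) - real (E i s) \<le> \<eta> * sq + e" by simp
qed

lemma total_E_near:
  assumes "0 \<le> s" "s \<le> t" "t \<le> T"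
  shows "\<bar>total E t - total E s - real n * sum lam UNIV * (t - s)\<bar> \<le> real CARD('c) * (\<eta> * (sq + real n * (t - s)))"
proof -
  have "total E t - total E s - real n * sum lam UNIV * (t - s)
      = (\<Sum>i\<in>UNIV. real (E i t) - real (E i s) - real n * lam i * (t - s))"
    by (simp add: total_def sum_subtractf sum_distrib_left sum_distrib_right)
  also have "\<bar>\<dots>\<bar> \<le> (\<Sum>i\<in>(UNIV::'c set). \<eta> * (sq + real n * (t - s)))"
    by (rule order_trans[OF sum_abs]) (intro sum_mono E_near assms)
  finally show ?thesis by simp
qed

lemma R_jump:
  assumes "0 \<le> s" "s < v" "v \<le> T" and const: "\<And>i u. s \<le> u \<Longrightarrow> u < v \<Longrightarrow> E i u = E i s"
  shows "total R v \<le> total R s + real CARD('c) * (\<eta> * sq)"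
proof -
  have "total R v - total R s = (\<Sum>i\<in>UNIV. real (R i v) - real (R i s))"
    by (simp add: total_def sum_subtractf)
  also have "\<dots> \<le> (\<Sum>i\<in>(UNIV::'c set). \<eta> * sq)"
  proof (rule sum_mono)
    fix i
    show "real (R i v) - real (R i s) \<le> \<eta> * sq"
      using reneged_incr_le[of s v \<delta> i] E_jump[OF assms(1-3) const, of i] assms by linarith
  qed
  finally show ?thesis by simp
qed

lemma total_0: "total Q 0 \<le> real CARD('c) * (\<eta> * sq)"
proof -
  have "real (Q i 0) \<le> \<eta> * sq" for i
    using queue_real[of 0 i] q0_small[of i] E_0[of i] by simp
  then have "total Q 0 \<le> (\<Sum>i\<in>(UNIV::'c set). \<eta> * sq)" unfolding total_def by (intro sum_mono)
  then show ?thesis by simp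
qed

lemma R_0: "R i 0 = 0"
  by (simp add: reneged_def E_0)

end

locale fluid_path = noisy_path E pol n q0 \<psi>0 S \<delta> X thr dev lam \<eta> T
  for E :: "'c::{finite,linorder} counts" and pol n q0 \<psi>0 S \<delta> X thr dev lam \<eta> T +
  fixes mu :: "'c \<Rightarrow> real"
  assumes mu: "\<And>i. mu i > 0" and critical: "(\<Sum>i\<in>UNIV. lam i / mu i) = 1"
    and S_0: "\<And>i. S i 0 = 0"
    and S_near: "\<And>i u v. 0 \<le> u \<Longrightarrow> u \<le> v \<Longrightarrow> v \<le> real n * T \<Longrightarrow>
      \<bar>real (S i v) - real (S i u) - mu i * (v - u)\<bar> \<le> \<eta> * (sqrt (real n) + (v - u))"
    and \<psi>0_near: "\<And>i. \<bar>real (\<psi>0 i) - real n * (lam i / mu i)\<bar> \<le> \<eta> * real n"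
begin

abbreviation "\<rho> i \<equiv> real n * (lam i / mu i)"

lemma P_le: "t \<ge> 0 \<Longrightarrow> real (P i t) \<le> real n"
  using total_P_le[of t] le_total[of P i t] by linarith

lemma P_right_cont:
  assumes "x \<ge> 0"
  shows "continuous (at_right x) (\<lambda>u. f (P i u) :: real)"
proof -
  have "\<forall>\<^sub>F u in at_right x. P i u = P i x"
    using right_cont(2)[OF assms] by (simp add: continuous_within tendsto_discrete)
  then have "\<forall>\<^sub>F u in at_right x. f (P i u) = f (P i x)" by eventually_elim simp
  then show ?thesis by (simp only: continuous_within tendsto_eventually)
qed

lemma P_integrable: "0 \<le> a \<Longrightarrow> (\<lambda>u. real (P i u)) integrable_on {a..b}"
  by (rule right_continuous_integrable[where K="real n"]) (use P_right_cont P_le in auto)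

definition dev_P :: "real \<Rightarrow> real"
  where "dev_P t = (\<Sum>i\<in>UNIV. \<bar>real (P i t) - \<rho> i\<bar>)"

lemma \<rho>: "0 \<le> \<rho> i" "\<rho> i \<le> real n" "(\<Sum>i\<in>UNIV. \<rho> i) = real n"
proof -
  show "0 \<le> \<rho> i" using lam[of i] mu[of i] by simp
  have "lam i / mu i \<le> (\<Sum>i\<in>UNIV. lam i / mu i)"
    using lam mu by (intro member_le_sum) (auto intro: less_imp_le)
  then have "lam i / mu i \<le> 1" using critical by simp
  then show "\<rho> i \<le> real n" using mult_left_mono[of "lam i / mu i" 1 "real n"] by simp
  show "(\<Sum>i\<in>UNIV. \<rho> i) = real n" by (simp only: sum_distrib_left[symmetric] critical mult_1_right)
qed

lemma dev_P_term_le: "t \<ge> 0 \<Longrightarrow> \<bar>real (P i t) - \<rho> i\<bar> \<le> real n"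
  using P_le[of t i] \<rho>(1,2)[of i] by (simp add: abs_le_iff)

lemma dev_P_integrable:
  assumes "0 \<le> a"
  shows "dev_P integrable_on {a..b}"
proof -
  have 1: "(\<lambda>u. \<bar>real (P i u) - \<rho> i\<bar>) integrable_on {a..b}" for i
    by (rule right_continuous_integrable[where K="real n"])
      (use P_right_cont[of _ "\<lambda>x. \<bar>real x - \<rho> i\<bar>" i] dev_P_term_le[of _ i] assms in auto)
  show "dev_P integrable_on {a..b}" unfolding dev_P_def by (intro integrable_sum 1) auto
qed

lemma integral_P_le:
  assumes "0 \<le> s" "s \<le> t"
  shows "integral {0..t} (\<lambda>u. real (P i u)) - integral {0..s} (\<lambda>u. real (P i u)) = integral {s..t} (\<lambda>u. real (P i u))"
    and "0 \<le> integral {s..t} (\<lambda>u. real (P i u))" "integral {s..t} (\<lambda>u. real (P i u)) \<le> real n * (t - s)"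
    and "\<bar>integral {s..t} (\<lambda>u. real (P i u)) - \<rho> i * (t - s)\<bar> \<le> integral {s..t} dev_P"
proof -
  show "integral {0..t} (\<lambda>u. real (P i u)) - integral {0..s} (\<lambda>u. real (P i u)) = integral {s..t} (\<lambda>u. real (P i u))"
    using Henstock_Kurzweil_Integration.integral_combine[of 0 s t "\<lambda>u. real (P i u)"] P_integrable[of 0 i t] assms by simp
  show "0 \<le> integral {s..t} (\<lambda>u. real (P i u))" by (rule integral_nonneg) (use P_integrable assms in auto)
  have "integral {s..t} (\<lambda>u. real (P i u)) \<le> integral {s..t} (\<lambda>u. real n)"
    using P_integrable[of s i t] P_le assms by (intro integral_le) auto
  then show "integral {s..t} (\<lambda>u. real (P i u)) \<le> real n * (t - s)" using assms by (simp add: mult.commute)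
  have "integral {s..t} (\<lambda>u. real (P i u)) - \<rho> i * (t - s) = integral {s..t} (\<lambda>u. real (P i u) - \<rho> i)"
    using P_integrable[of s i t] assms by (subst integral_diff) (auto simp: mult.commute)
  also have "\<bar>\<dots>\<bar> \<le> integral {s..t} dev_P"
    unfolding real_norm_def[symmetric]
  proof (rule integral_norm_bound_integral)
    show "(\<lambda>u. real (P i u) - \<rho> i) integrable_on {s..t}"
      using P_integrable[of s i t] assms by (intro integrable_diff) auto
    show "dev_P integrable_on {s..t}" using dev_P_integrable assms by simp
    show "norm (real (P i u) - \<rho> i) \<le> dev_P u" if "u \<in> {s..t}" for u
      unfolding dev_P_def real_norm_def by (rule member_le_sum) auto
  qed
  finally show "\<bar>integral {s..t} (\<lambda>u. real (P i u)) - \<rho> i * (t - s)\<bar> \<le> integral {s..t} dev_P" .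
qed

text \<open>Departures are a Poisson process with the integrated number in service as its clock. At
  \<open>P i = \<rho> i\<close> the clock gives exactly the rate \<open>n * lam i\<close>; the error
  of the clock is at most the integral of \<open>dev_P\<close>.\<close>

lemma D_near_integral:
  assumes "0 \<le> s" "s \<le> t" "t \<le> T"
  shows "\<bar>real (D i t) - real (D i s) - real n * lam i * (t - s)\<bar>
    \<le> \<eta> * (sq + real n * (t - s)) + mu i * integral {s..t} dev_P"
proof -
  let ?I = "\<lambda>a b. integral {a..b} (\<lambda>u. real (P i u))"
  have I: "?I 0 t - ?I 0 s = ?I s t" "0 \<le> ?I s t" "?I s t \<le> real n * (t - s)"
    "\<bar>?I s t - \<rho> i * (t - s)\<bar> \<le> integral {s..t} dev_P"
    using integral_P_le[OF assms(1,2)] by auto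
  have I0: "0 \<le> ?I 0 s" using integral_P_le(2)[of 0 s] assms by simp
  have "?I 0 t \<le> real n * t" using integral_P_le(3)[of 0 t] assms by simp
  also have "\<dots> \<le> real n * T" using assms by (intro mult_left_mono) auto
  finally have "\<bar>real (S i (?I 0 t)) - real (S i (?I 0 s)) - mu i * (?I 0 t - ?I 0 s)\<bar> \<le> \<eta> * (sqrt (real n) + (?I 0 t - ?I 0 s))"
    using I I0 by (intro S_near) auto
  then have "\<bar>real (D i t) - real (D i s) - mu i * ?I s t\<bar> \<le> \<eta> * (sq + ?I s t)"
    using departed_eq[of t i] departed_eq[of s i] assms I(1) by simp
  also have "\<dots> \<le> \<eta> * (sq + real n * (t - s))" using I eta by (intro mult_left_mono) auto
  finally have 1: "\<bar>real (D i t) - real (D i s) - mu i * ?I s t\<bar> \<le> \<eta> * (sq + real n * (t - s))" .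
  have "mu i * ?I s t - real n * lam i * (t - s) = mu i * (?I s t - \<rho> i * (t - s))"
  proof -
    have "mu i * (\<rho> i * (t - s)) = real n * lam i * (t - s)" using mu[of i] by simp
    then show ?thesis by (simp only: right_diff_distrib)
  qed
  then have "\<bar>mu i * ?I s t - real n * lam i * (t - s)\<bar> = mu i * \<bar>?I s t - \<rho> i * (t - s)\<bar>"
    using mu[of i] by (simp add: abs_mult)
  also have "\<dots> \<le> mu i * integral {s..t} dev_P" using I(4) mu[of i] by (intro mult_left_mono) auto
  finally show ?thesis using 1 by linarith
qed

lemma D_0: "D i 0 = 0"
  using departed_eq[of 0 i] S_0 by simp

text \<open>Bounds the number in the system beyond n that would result without refusals: one share
  \<open>\<eta> * n * (1 + T)\<close> per class from each of \<open>q0\<close>,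
  \<open>\<psi>0\<close>, E and D, and the errors of the service clocks.\<close>

definition fluid_bound :: "real \<Rightarrow> real"
  where "fluid_bound t = 4 * real CARD('c) * (\<eta> * real n * (1 + T)) + sum mu UNIV * integral {0..t} dev_P"

lemma sum_near:
  assumes "0 \<le> t" "t \<le> T"
  shows "\<bar>real (E i t) - real n * lam i * t\<bar> \<le> \<eta> * real n * (1 + T)"
    and "(\<Sum>i\<in>UNIV. \<bar>real (D i t) - real n * lam i * t\<bar>) \<le> real CARD('c) * (\<eta> * real n * (1 + T)) + sum mu UNIV * integral {0..t} dev_P"
proof -
  have bd: "\<eta> * (sq + real n * t) \<le> \<eta> * real n * (1 + T)"
  proof -
    have "sq + real n * t \<le> real n * (1 + T)"
      using add_mono[OF sq(2) mult_left_mono[OF assms(2), of "real n"]] by (simp add: distrib_left)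
    then show ?thesis using eta mult_left_mono[of _ _ \<eta>] by (simp add: mult.assoc)
  qed
  show "\<bar>real (E i t) - real n * lam i * t\<bar> \<le> \<eta> * real n * (1 + T)"
    using E_near[of 0 t i] E_0[of i] assms bd by simp
  have "(\<Sum>i\<in>UNIV. \<bar>real (D i t) - real n * lam i * t\<bar>)
    \<le> (\<Sum>i\<in>UNIV. \<eta> * real n * (1 + T) + mu i * integral {0..t} dev_P)"
  proof (rule sum_mono)
    fix i
    show "\<bar>real (D i t) - real n * lam i * t\<bar> \<le> \<eta> * real n * (1 + T) + mu i * integral {0..t} dev_P"
      using D_near_integral[of 0 t i] D_0[of i] assms bd by simp
  qed
  also have "\<dots> = real CARD('c) * (\<eta> * real n * (1 + T)) + sum mu UNIV * integral {0..t} dev_P"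
    by (simp add: sum.distrib sum_distrib_right)
  finally show "(\<Sum>i\<in>UNIV. \<bar>real (D i t) - real n * lam i * t\<bar>) \<le> real CARD('c) * (\<eta> * real n * (1 + T)) + sum mu UNIV * integral {0..t} dev_P" .
qed

lemma sum_\<psi>0: "(\<Sum>i\<in>UNIV. \<bar>real (\<psi>0 i) - \<rho> i\<bar>) \<le> real CARD('c) * (\<eta> * real n)"
  using sum_mono[of UNIV "\<lambda>i. \<bar>real (\<psi>0 i) - \<rho> i\<bar>" "\<lambda>_. \<eta> * real n"] \<psi>0_near by simp

lemma sum_q0: "(\<Sum>i\<in>UNIV. real (q0 i)) \<le> real CARD('c) * (\<eta> * real n)"
proof -
  have "real (q0 i) \<le> \<eta> * real n" for i
    using order_trans[OF q0_small[of i] mult_left_mono[OF sq(2), of \<eta>]] eta by simp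
  then show ?thesis using sum_mono[of UNIV "\<lambda>i. real (q0 i)" "\<lambda>_. \<eta> * real n"] by simp
qed

lemma \<eta>n: "0 \<le> \<eta> * real n" "\<eta> * real n \<le> \<eta> * real n * (1 + T)" "1 \<le> \<eta> * real n"
proof -
  show 0: "0 \<le> \<eta> * real n" using eta by simp
  show "\<eta> * real n \<le> \<eta> * real n * (1 + T)" using mult_left_mono[OF _ 0, of 1 "1 + T"] T by simp
  show "1 \<le> \<eta> * real n" using order_trans[OF n(2) mult_left_mono[OF sq(2), of \<eta>]] eta by simp
qed

lemma excess_le:
  assumes "0 \<le> t" "t \<le> T"
  shows "(\<Sum>i\<in>UNIV. real (q0 i) + real (\<psi>0 i)) - real n + total E t - total D t \<le> fluid_bound t"
proof -
  have "(\<Sum>i\<in>UNIV. real (\<psi>0 i)) - real n = (\<Sum>i\<in>UNIV. real (\<psi>0 i) - \<rho> i)"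
    by (simp only: sum_subtractf \<rho>(3))
  also have "\<dots> \<le> (\<Sum>i\<in>UNIV. \<bar>real (\<psi>0 i) - \<rho> i\<bar>)" by (intro sum_mono abs_ge_self)
  finally have 1: "(\<Sum>i\<in>UNIV. real (\<psi>0 i)) - real n \<le> real CARD('c) * (\<eta> * real n)" using sum_\<psi>0 by simp
  have "total E t - total D t = (\<Sum>i\<in>UNIV. (real (E i t) - real n * lam i * t) - (real (D i t) - real n * lam i * t))"
    by (simp add: total_def sum_subtractf)
  also have "\<dots> \<le> (\<Sum>i\<in>UNIV. \<eta> * real n * (1 + T) + \<bar>real (D i t) - real n * lam i * t\<bar>)"
    using sum_near(1)[OF assms] by (intro sum_mono) (smt (verit))
  also have "\<dots> = real CARD('c) * (\<eta> * real n * (1 + T)) + (\<Sum>i\<in>UNIV. \<bar>real (D i t) - real n * lam i * t\<bar>)"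
    by (simp add: sum.distrib)
  finally have 2: "total E t - total D t \<le> 2 * (real CARD('c) * (\<eta> * real n * (1 + T))) + sum mu UNIV * integral {0..t} dev_P"
    using sum_near(2)[OF assms] by simp
  have "real CARD('c) * (\<eta> * real n) \<le> real CARD('c) * (\<eta> * real n * (1 + T))" using \<eta>n by (intro mult_left_mono) auto
  then show ?thesis using 1 2 sum_q0 unfolding fluid_bound_def sum.distrib by linarith
qed

lemma fluid_bound_mono: "0 \<le> s \<Longrightarrow> s \<le> t \<Longrightarrow> fluid_bound s \<le> fluid_bound t"
  and fluid_bound_nonneg: "0 \<le> t \<Longrightarrow> 0 \<le> fluid_bound t"
proof -
  have nonneg: "0 \<le> integral {a..b} dev_P" if "0 \<le> a" for a b
    by (rule integral_nonneg) (use dev_P_integrable that in \<open>auto simp: dev_P_def sum_nonneg\<close>)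
  have m: "0 \<le> sum mu UNIV" using mu by (intro sum_nonneg) (auto intro: less_imp_le)
  show "0 \<le> fluid_bound t" if "0 \<le> t"
    unfolding fluid_bound_def using nonneg[of 0 t] m eta T by (intro add_nonneg_nonneg mult_nonneg_nonneg) auto
  show "fluid_bound s \<le> fluid_bound t" if "0 \<le> s" "s \<le> t"
  proof -
    have "integral {0..s} dev_P + integral {s..t} dev_P = integral {0..t} dev_P"
      using that dev_P_integrable[of 0 t] by (intro Henstock_Kurzweil_Integration.integral_combine) auto
    then have "integral {0..s} dev_P \<le> integral {0..t} dev_P" using nonneg[of s t] that by simp
    then show ?thesis unfolding fluid_bound_def using m by (intro add_left_mono mult_left_mono)
  qed
qed

text \<open>
  Just before a refusal the queue is nonempty, so all servers are busy; the number of refusals so far is then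
  at most the excess that there would be without refusals.
\<close>

lemma total_R_fluid:
  assumes "0 \<le> t" "t \<le> T"
  shows "total R t \<le> fluid_bound t + real CARD('c) * (\<eta> * real n) + 1"
proof -
  have sq_le: "real CARD('c) * (\<eta> * sq) \<le> real CARD('c) * (\<eta> * real n)" using sq eta by (intro mult_left_mono) auto
  have R0: "total R 0 = 0" by (simp add: total_def R_0)
  from last_renege[of 0 t] assms consider "total R t \<le> total R 0 + 1"
    | v k where "0 < v" "v \<le> t" "\<not> thr k (left_lim (Q k) v)" "total R t \<le> total R v + 1" by blast
  then show ?thesis
  proof cases
    case 1
    moreover have "0 \<le> real CARD('c) * (\<eta> * real n)" using \<eta>n(1) by (intro mult_nonneg_nonneg[OF _ \<eta>n(1)]) auto
    ultimately show ?thesis using R0 fluid_bound_nonneg[OF assms(1)] by linarith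
  next
    case 2
    obtain s where s: "0 \<le> s" "s < v"
      and const: "\<And>i u. s \<le> u \<Longrightarrow> u < v \<Longrightarrow> E i u = E i s \<and> B i u = B i s \<and> Q i u = Q i s \<and> R i u = R i s"
      and lim: "\<And>i u. s \<le> u \<Longrightarrow> u < v \<Longrightarrow> left_lim (Q i) v = Q i u"
      by (rule left_const[OF 2(1)], rule that)
    have "left_lim (Q k) v = Q k s" using lim s(2) by blast
    then have "Q k s > 0" using 2(3) thr_0[of k] by (cases "Q k s = 0") auto
    then have pos: "0 < total Q s" by (auto simp: total_pos_iff)
    then have "total P s = real n" using total_P_busy s by simp
    then have "total R s \<le> fluid_bound s"
      using balance[OF s(1)] pos excess_le[of s] s 2 assms by simp
    also have "\<dots> \<le> fluid_bound t" using s 2 by (intro fluid_bound_mono) auto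
    finally have "total R s \<le> fluid_bound t" .
    moreover have "total R v \<le> total R s + real CARD('c) * (\<eta> * sq)"
      by (rule R_jump) (use s 2 assms const in \<open>blast intro: order_trans\<close>)+
    ultimately show ?thesis using 2(4) sq_le by linarith
  qed
qed

lemma total_Q_fluid:
  assumes "0 \<le> t" "t \<le> T"
  shows "total Q t \<le> fluid_bound t"
proof -
  have "total Q t + total P t - real n \<le> fluid_bound t"
    using balance[OF assms(1)] excess_le[OF assms] total_nonneg[of R t] by simp
  then show ?thesis using total_Q_eq[OF assms(1)] fluid_bound_nonneg[OF assms(1)] by simp
qed

text \<open>Solving the balance equations for P leaves initial values, arrivals, departures,
  refusals and queues. Each of the last three contributes the integral of \<open>dev_P\<close> once,
  through \<open>sum_near\<close> and \<open>fluid_bound\<close>; so the inequality closes on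
  \<open>dev_P\<close> itself.\<close>

lemma dev_P_le:
  assumes t: "0 \<le> t" "t \<le> T"
  shows "dev_P t \<le> 16 * real CARD('c) * (\<eta> * real n * (1 + T)) + 3 * sum mu UNIV * integral {0..t} dev_P"
proof -
  define b where "b = \<eta> * real n * (1 + T)"
  define G where "G = sum mu UNIV * integral {0..t} dev_P"
  have "dev_P t \<le> (\<Sum>i\<in>UNIV. \<bar>real (\<psi>0 i) - \<rho> i\<bar> + real (q0 i) + b
      + \<bar>real (D i t) - real n * lam i * t\<bar> + real (R i t) + real (Q i t))"
    unfolding dev_P_def
  proof (rule sum_mono)
    fix i
    have "real (P i t) - \<rho> i = (real (\<psi>0 i) - \<rho> i) + real (q0 i) + (real (E i t) - real n * lam i * t)
       - (real (D i t) - real n * lam i * t) - real (R i t) - real (Q i t)"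
      using service_real[OF t(1), of i] queue_real[OF t(1), of i] by simp
    then show "\<bar>real (P i t) - \<rho> i\<bar> \<le> \<bar>real (\<psi>0 i) - \<rho> i\<bar> + real (q0 i) + b
      + \<bar>real (D i t) - real n * lam i * t\<bar> + real (R i t) + real (Q i t)"
      using sum_near(1)[OF t, of i] unfolding b_def by linarith
  qed
  also have "\<dots> = (\<Sum>i\<in>UNIV. \<bar>real (\<psi>0 i) - \<rho> i\<bar>) + (\<Sum>i\<in>UNIV. real (q0 i)) + real CARD('c) * b
      + (\<Sum>i\<in>UNIV. \<bar>real (D i t) - real n * lam i * t\<bar>) + total R t + total Q t"
    by (simp add: sum.distrib total_def)
  also have "\<dots> \<le> real CARD('c) * (\<eta> * real n) + real CARD('c) * (\<eta> * real n) + real CARD('c) * b + (real CARD('c) * b + G)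
      + (fluid_bound t + real CARD('c) * (\<eta> * real n) + 1) + fluid_bound t"
    using sum_\<psi>0 sum_q0 sum_near(2)[OF t] total_R_fluid[OF t] total_Q_fluid[OF t]
    unfolding G_def b_def by linarith
  also have "\<dots> = 3 * (real CARD('c) * (\<eta> * real n)) + 10 * (real CARD('c) * b) + 3 * G + 1"
    by (simp add: fluid_bound_def b_def G_def)
  also have "\<dots> \<le> 16 * (real CARD('c) * b) + 3 * G"
  proof -
    have 1: "real CARD('c) * (\<eta> * real n) \<le> real CARD('c) * b" unfolding b_def using \<eta>n by (intro mult_left_mono) auto
    have "1 * 1 \<le> real CARD('c) * (\<eta> * real n)" using c_ge_1 \<eta>n by (intro mult_mono) auto
    then show ?thesis using 1 by linarith
  qed
  finally show ?thesis unfolding b_def G_def by (simp add: mult.assoc)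
qed

lemma dev_P_small:
  assumes t: "0 \<le> t" "t \<le> T"
  shows "dev_P t \<le> 32 * real CARD('c) * (1 + T) * exp (6 * sum mu UNIV * T) * (\<eta> * real n)"
proof -
  define m where "m = sum mu UNIV"
  have m: "0 < m" unfolding m_def using mu by (intro sum_pos) auto
  define a where "a = 16 * real CARD('c) * (\<eta> * real n * (1 + T))"
  have a: "a \<ge> 0" unfolding a_def using eta T by (intro mult_nonneg_nonneg) auto
  have "dev_P t \<le> 2 * a * exp (2 * (3 * m) * t)"
  proof (rule gronwall[where K="real CARD('c) * real n" and T=T])
    show "dev_P u \<le> real CARD('c) * real n" if "0 \<le> u" for u
    proof -
      have "dev_P u \<le> (\<Sum>i\<in>(UNIV::'c set). real n)"
        unfolding dev_P_def using dev_P_term_le[OF that] by (intro sum_mono)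
      then show ?thesis by simp
    qed
    show "dev_P u \<le> a + 3 * m * integral {0..u} dev_P" if "0 \<le> u" "u \<le> T" for u
      using dev_P_le[OF that] by (simp add: a_def m_def)
    show "0 \<le> dev_P u" for u by (simp add: dev_P_def sum_nonneg)
  qed (use dev_P_integrable m a t in auto)
  also have "\<dots> \<le> 2 * a * exp (6 * m * T)" using a m t by (intro mult_left_mono) auto
  finally show ?thesis by (simp add: a_def m_def algebra_simps)
qed

text \<open>Over a window the integral of \<open>dev_P\<close> is of order
  \<open>\<eta> * n * (t - s)\<close>, so departures obey the same kind of bound as arrivals, with K
  times the error.\<close>

lemma D_near:
  assumes st: "0 \<le> s" "s \<le> t" "t \<le> T"
    and K: "K = 1 + sum mu UNIV * (32 * real CARD('c) * (1 + T) * exp (6 * sum mu UNIV * T))"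
  shows "\<bar>real (D i t) - real (D i s) - real n * lam i * (t - s)\<bar> \<le> K * \<eta> * (sq + real n * (t - s))"
proof -
  define k where "k = 32 * real CARD('c) * (1 + T) * exp (6 * sum mu UNIV * T)"
  have k: "k \<ge> 0" using T by (simp add: k_def)
  have "integral {s..t} dev_P \<le> integral {s..t} (\<lambda>_. k * (\<eta> * real n))"
    using dev_P_small st dev_P_integrable[of s t] unfolding k_def by (intro integral_le) auto
  also have "\<dots> = k * (\<eta> * real n) * (t - s)" using st by simp
  finally have I: "integral {s..t} dev_P \<le> k * (\<eta> * real n) * (t - s)" .
  have mi: "mu i \<le> sum mu UNIV" using mu by (intro member_le_sum) (auto intro: less_imp_le)
  have x: "0 \<le> k * (\<eta> * real n) * (t - s)" using k eta st by simp
  have "mu i * integral {s..t} dev_P \<le> mu i * (k * (\<eta> * real n) * (t - s))"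
    using I mu[of i] by (intro mult_left_mono) auto
  also have "\<dots> \<le> sum mu UNIV * (k * (\<eta> * real n) * (t - s))" using mi x by (intro mult_right_mono)
  also have "\<dots> = sum mu UNIV * k * \<eta> * (real n * (t - s))" by simp
  also have "\<dots> \<le> sum mu UNIV * k * \<eta> * (sq + real n * (t - s))"
    using k eta mi mu[of i] st by (intro mult_left_mono mult_nonneg_nonneg) auto
  finally show ?thesis
    using D_near_integral[OF st, of i] unfolding K k_def[symmetric] by (simp add: algebra_simps)
qed

end

section \<open>Diffusion-scale estimates\<close>

text \<open>Above the level a the value can be traced back in steps of length s without decreasing;
  before time s no further step is possible, so the level cannot have been exceeded.\<close>

lemma window_recursion:
  fixes f :: "real \<Rightarrow> real"
  assumes s: "s > 0"
    and step: "\<And>t. 0 \<le> t \<Longrightarrow> t \<le> T \<Longrightarrow> f t \<le> a \<or> (s \<le> t \<and> f t \<le> f (t - s))"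
    and t: "0 \<le> t" "t \<le> T"
  shows "f t \<le> a"
proof -
  have "f t \<le> a" if "0 \<le> t" "t \<le> T" "t < real k * s" for k t
    using that
  proof (induction k arbitrary: t)
    case (Suc k)
    from step[OF Suc.prems(1,2)] show ?case
    proof
      assume *: "s \<le> t \<and> f t \<le> f (t - s)"
      then have "f (t - s) \<le> a" using Suc.prems s by (intro Suc.IH) (auto simp: algebra_simps)
      then show ?thesis using * by simp
    qed
  qed auto
  moreover obtain k :: nat where "t < real k * s" using reals_Archimedean3[OF s] by blast
  ultimately show ?thesis using t by blast
qed

locale diffusive_path = noisy_path E pol n q0 \<psi>0 S \<delta> X thr dev lam \<eta> T
  for E :: "'c::{finite,linorder} counts" and pol n q0 \<psi>0 S \<delta> X thr dev lam \<eta> T +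
  assumes D_near: "\<And>i s t. 0 \<le> s \<Longrightarrow> s \<le> t \<Longrightarrow> t \<le> T \<Longrightarrow>
      \<bar>real (D i t) - real (D i s) - real n * lam i * (t - s)\<bar> \<le> \<eta> * (sqrt (real n) + real n * (t - s))"
begin

definition Qsum :: "'c set \<Rightarrow> real \<Rightarrow> real"
  where "Qsum H t = (\<Sum>k\<in>H. real (Q k t))"

lemma Qsum_UNIV: "Qsum UNIV t = total Q t"
  by (simp add: Qsum_def total_def)

lemma total_D_near:
  assumes "0 \<le> s" "s \<le> t" "t \<le> T"
  shows "\<bar>total D t - total D s - real n * sum lam UNIV * (t - s)\<bar> \<le> real CARD('c) * (\<eta> * (sq + real n * (t - s)))"
proof -
  have "total D t - total D s - real n * sum lam UNIV * (t - s)
      = (\<Sum>i\<in>UNIV. real (D i t) - real (D i s) - real n * lam i * (t - s))"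
    by (simp add: total_def sum_subtractf sum_distrib_left sum_distrib_right)
  also have "\<bar>\<dots>\<bar> \<le> (\<Sum>i\<in>(UNIV::'c set). \<eta> * (sq + real n * (t - s)))"
    by (rule order_trans[OF sum_abs]) (intro sum_mono D_near assms)
  finally show ?thesis by simp
qed

text \<open>Window lengths are measured by \<sigma> in units of \<open>1 / sqrt n\<close>. The bound
  is crude but small with \<sigma> and \<eta>, so a queue above a level was almost as long
  throughout the preceding window.\<close>

lemma total_incr_le:
  assumes st: "0 \<le> s" "s \<le> t" "t \<le> T" and w: "real n * (t - s) \<le> \<sigma> * sq"
  shows "total E t - total E s \<le> ((sum lam UNIV + real CARD('c)) * \<sigma> + real CARD('c) * \<eta>) * sq"
    and "total D t - total D s \<le> ((sum lam UNIV + real CARD('c)) * \<sigma> + real CARD('c) * \<eta>) * sq"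
proof -
  have L: "0 \<le> sum lam UNIV" using lam by (intro sum_nonneg) (auto intro: less_imp_le)
  have w0: "0 \<le> real n * (t - s)" using st by simp
  have 1: "sum lam UNIV * (real n * (t - s)) \<le> sum lam UNIV * (\<sigma> * sq)" using w L by (rule mult_left_mono)
  have "\<eta> * (real n * (t - s)) \<le> 1 * (real n * (t - s))" using w0 eta by (intro mult_right_mono) auto
  then have "\<eta> * (real n * (t - s)) \<le> 1 * (\<sigma> * sq)" using w by linarith
  then have "real CARD('c) * (\<eta> * (sq + real n * (t - s))) \<le> real CARD('c) * (\<eta> * sq + \<sigma> * sq)"
    by (intro mult_left_mono) (auto simp: distrib_left)
  with 1 have "real n * sum lam UNIV * (t - s) + real CARD('c) * (\<eta> * (sq + real n * (t - s)))
     \<le> ((sum lam UNIV + real CARD('c)) * \<sigma> + real CARD('c) * \<eta>) * sq"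
    by (simp add: algebra_simps)
  then show "total E t - total E s \<le> ((sum lam UNIV + real CARD('c)) * \<sigma> + real CARD('c) * \<eta>) * sq"
    "total D t - total D s \<le> ((sum lam UNIV + real CARD('c)) * \<sigma> + real CARD('c) * \<eta>) * sq"
    using total_E_near[OF st] total_D_near[OF st] by linarith+
qed

lemma E_incr_le_total:
  assumes "0 \<le> s" "s \<le> t"
  shows "(\<Sum>k\<in>H. real (E k t) - real (E k s)) \<le> total E t - total E s"
proof -
  have "(\<Sum>k\<in>H. real (E k t) - real (E k s)) \<le> (\<Sum>k\<in>UNIV. real (E k t) - real (E k s))"
    using E_le[OF assms] by (intro sum_mono2) auto
  then show ?thesis by (simp add: total_def sum_subtractf)
qed

lemma Qsum_ge:
  assumes st: "0 \<le> s" "s \<le> t"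
  shows "Qsum H t \<le> Qsum H s + (total E t - total E s)"
proof -
  have "Qsum H t - Qsum H s = (\<Sum>k\<in>H. real (Q k t) - real (Q k s))" by (simp add: Qsum_def sum_subtractf)
  also have "\<dots> \<le> (\<Sum>k\<in>H. real (E k t) - real (E k s))"
  proof (rule sum_mono)
    fix k
    show "real (Q k t) - real (Q k s) \<le> real (E k t) - real (E k s)"
      using queue_real[of t k] queue_real[of s k] B_le[OF st, of k] reneged_le[OF st, of \<delta> k] st by simp
  qed
  also have "\<dots> \<le> total E t - total E s" by (rule E_incr_le_total[OF st])
  finally show ?thesis by simp
qed

lemma busy_routed:
  assumes st: "0 \<le> s" "s \<le> t" and busy: "0 < total Q s" "0 < total Q t"
  shows "total B t - total B s = total D t - total D s"
proof -
  have "total P u = (\<Sum>i\<in>UNIV. real (\<psi>0 i)) + total B u - total D u" if "0 \<le> u" for u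
    using service_real[OF that] by (simp add: total_def sum.distrib sum_subtractf)
  then show ?thesis using total_P_busy[of s] total_P_busy[of t] st busy by simp
qed

lemma total_Q_busy_diff:
  assumes st: "0 \<le> s" "s \<le> t" and busy: "0 < total Q s" "0 < total Q t"
  shows "total Q t - total Q s = (total E t - total E s) - (total D t - total D s) - (total R t - total R s)"
  using balance[of s] balance[of t] total_P_busy[of s] total_P_busy[of t] st busy by simp

lemma exclusive_service:
  assumes st: "0 \<le> s" "s \<le> t" and busy: "0 < total Q s" "0 < total Q t"
    and excl: "\<And>k. k \<notin> H \<Longrightarrow> B k t = B k s"
  shows "Qsum H t - Qsum H s = (\<Sum>k\<in>H. real (E k t) - real (E k s)) - (total D t - total D s)
      - (\<Sum>k\<in>H. real (R k t) - real (R k s))"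
proof -
  have "total B t - total B s = (\<Sum>k\<in>UNIV. real (B k t) - real (B k s))" by (simp add: total_def sum_subtractf)
  also have "\<dots> = (\<Sum>k\<in>H. real (B k t) - real (B k s))"
    using excl by (intro sum.mono_neutral_right) auto
  finally have *: "(\<Sum>k\<in>H. real (B k t) - real (B k s)) = total D t - total D s" using busy_routed[OF st busy] by simp
  have "Qsum H t - Qsum H s = (\<Sum>k\<in>H. (real (E k t) - real (E k s)) - (real (B k t) - real (B k s)) - (real (R k t) - real (R k s)))"
    unfolding Qsum_def sum_subtractf[symmetric]
    using queue_real[of t] queue_real[of s] st by (intro sum.cong) auto
  also have "\<dots> = (\<Sum>k\<in>H. real (E k t) - real (E k s)) - (\<Sum>k\<in>H. real (B k t) - real (B k s)) - (\<Sum>k\<in>H. real (R k t) - real (R k s))"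
    by (simp only: sum_subtractf)
  finally show ?thesis unfolding * .
qed

text \<open>If every departure makes room for a class in H, then H loses customers at the total rate
  \<open>n * sum lam UNIV\<close> but gains only the arrivals to H. The class k outside H makes the
  difference at least \<open>n * l0\<close>.\<close>

lemma exclusive_drift:
  assumes st: "0 \<le> s" "s \<le> t" "t \<le> T" and l0: "k \<notin> H" "l0 \<le> lam k"
  shows "(\<Sum>k\<in>H. real (E k t) - real (E k s)) - (total D t - total D s)
    \<le> - l0 * (real n * (t - s)) + 2 * real CARD('c) * \<eta> * (sq + real n * (t - s))"
proof -
  define d where "d = real n * (t - s)"
  have d: "0 \<le> d" using st by (simp add: d_def)
  have "(\<Sum>k\<in>H. real (E k t) - real (E k s)) \<le> (\<Sum>k\<in>H. lam k * d + \<eta> * (sq + d))"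
    using E_near[OF st] unfolding d_def by (intro sum_mono) (smt (verit) mult.assoc mult.commute)
  also have "\<dots> = sum lam H * d + real (card H) * (\<eta> * (sq + d))" by (simp add: sum.distrib sum_distrib_right)
  also have "\<dots> \<le> sum lam H * d + real CARD('c) * (\<eta> * (sq + d))"
    using eta d by (intro add_left_mono mult_right_mono) (auto simp: card_mono)
  finally have 1: "(\<Sum>k\<in>H. real (E k t) - real (E k s)) \<le> sum lam H * d + real CARD('c) * (\<eta> * (sq + d))" .
  have "sum lam (insert k H) \<le> sum lam UNIV" using lam by (intro sum_mono2) (auto intro: less_imp_le)
  then have "sum lam H + l0 \<le> sum lam UNIV" using l0 by simp
  then have "(sum lam H + l0) * d \<le> sum lam UNIV * d" using d by (intro mult_right_mono)
  moreover have "sum lam UNIV * d - real CARD('c) * (\<eta> * (sq + d)) \<le> total D t - total D s"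
    using abs_le_D2[OF total_D_near[OF st]] by (simp add: d_def algebra_simps)
  ultimately show ?thesis using 1 unfolding d_def[symmetric] by (simp add: algebra_simps)
qed

text \<open>Over a full window of length \<open>\<sigma> / sqrt n\<close> the drift
  \<open>\<kappa> * \<sigma> * sqrt n\<close> outweighs the noise, so f did not increase. For t
  inside the very first window, f is at most the start value plus the noise, itself at most
  \<open>\<kappa> * \<sigma> * sqrt n\<close>; that is why A exceeds \<open>Az\<close> by
  \<open>\<kappa> * \<sigma>\<close>.\<close>

lemma drift_bound:
  assumes \<sigma>: "\<sigma> > 0" and \<kappa>: "0 \<le> \<kappa>" and \<epsilon>: "0 \<le> \<epsilon>" "\<epsilon> * (1 + \<sigma>) \<le> \<kappa> * \<sigma>"
    and f0: "f 0 \<le> Az * sq" and A: "Az + \<kappa> * \<sigma> \<le> A"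
    and step: "\<And>a t. 0 \<le> a \<Longrightarrow> a \<le> t \<Longrightarrow> t \<le> T \<Longrightarrow> real n * (t - a) \<le> \<sigma> * sq \<Longrightarrow> f t > A * sq \<Longrightarrow>
        f t \<le> f a - \<kappa> * (real n * (t - a)) + \<epsilon> * (sq + real n * (t - a))"
    and t: "0 \<le> t" "t \<le> T"
  shows "f t \<le> A * sq"
proof (rule window_recursion[OF _ _ t])
  let ?s = "\<sigma> / sq"
  have sq0: "sq > 0" using sq(1) by linarith
  then show "?s > 0" using \<sigma> by simp
  have ns: "real n * ?s = \<sigma> * sq" using sq0 sq(3) by (simp add: field_simps)
  fix t assume t: "0 \<le> t" "t \<le> T"
  have small: "\<epsilon> * (sq + real n * d) \<le> \<kappa> * \<sigma> * sq" if "real n * d \<le> \<sigma> * sq" for d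
  proof -
    have "\<epsilon> * (sq + real n * d) \<le> \<epsilon> * (sq + \<sigma> * sq)" using that \<epsilon>(1) by (intro mult_left_mono) auto
    also have "\<dots> = \<epsilon> * (1 + \<sigma>) * sq" by (simp add: algebra_simps)
    also have "\<dots> \<le> \<kappa> * \<sigma> * sq" using \<epsilon>(2) sq0 by (intro mult_right_mono) auto
    finally show ?thesis .
  qed
  show "f t \<le> A * sq \<or> (?s \<le> t \<and> f t \<le> f (t - ?s))"
  proof (cases "f t \<le> A * sq")
    case False
    show ?thesis
    proof (cases "?s \<le> t")
      case True
      have "f t \<le> f (t - ?s) - \<kappa> * (real n * ?s) + \<epsilon> * (sq + real n * ?s)"
        by (rule order_trans[OF step[of "t - ?s" t]]) (use True False t \<sigma> sq0 ns in auto)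
      also have "\<dots> \<le> f (t - ?s)" using small[of ?s] unfolding ns by (simp add: algebra_simps)
      finally show ?thesis using True by simp
    next
      case F: False
      have nt: "real n * t \<le> \<sigma> * sq" using F mult_left_mono[of t ?s "real n"] ns by simp
      have "f t \<le> f 0 - \<kappa> * (real n * t) + \<epsilon> * (sq + real n * t)" using step[of 0 t] t False nt by simp
      also have "\<dots> \<le> Az * sq - 0 + \<kappa> * \<sigma> * sq"
        using f0 small[OF nt] \<kappa> t by (intro add_mono diff_mono) auto
      also have "\<dots> = (Az + \<kappa> * \<sigma>) * sq" by (simp add: algebra_simps)
      also have "\<dots> \<le> A * sq" using A sq0 by (intro mult_right_mono) auto
      finally show ?thesis by simp
    qed
  qed simp
qed

lemma Qsum_0: "Qsum H 0 \<le> real CARD('c) * \<eta> * sq"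
proof -
  have "Qsum H 0 \<le> Qsum UNIV 0" unfolding Qsum_def by (intro sum_mono2) auto
  then show ?thesis using total_0 by (simp add: Qsum_UNIV mult.assoc)
qed

section \<open>State space collapse\<close>

text \<open>Arrivals and departures over a window are at most \<open>g / 2 * sqrt n\<close> each,
  and drift beats noise there. The drift is taken as \<open>l0 / CARD('c)\<close> instead of
  \<open>l0\<close> because subtracting the average queue dilutes it under SLQ.\<close>

definition collapse_params :: "real \<Rightarrow> real \<Rightarrow> real \<Rightarrow> bool"
  where "collapse_params l0 g \<sigma> \<longleftrightarrow> 0 < l0 \<and> (\<forall>i. l0 \<le> lam i) \<and> 0 < g \<and> 0 < \<sigma> \<and>
    (sum lam UNIV + real CARD('c)) * \<sigma> + real CARD('c) * \<eta> \<le> g / 2 \<and>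
    2 * real CARD('c) * \<eta> * (1 + \<sigma>) \<le> l0 / real CARD('c) * \<sigma>"

lemma collapse_paramsD:
  assumes "collapse_params l0 g \<sigma>"
  shows "l0 / real CARD('c) \<le> l0" "real CARD('c) * \<eta> + l0 * \<sigma> \<le> g" "0 \<le> l0 / real CARD('c)"
    "real CARD('c) * \<eta> + l0 / real CARD('c) * \<sigma> \<le> g"
proof -
  note a = assms[unfolded collapse_params_def]
  show 1: "l0 / real CARD('c) \<le> l0" using a c_ge_1 divide_left_mono[of 1 "real CARD('c)" l0] by simp
  show "0 \<le> l0 / real CARD('c)" using a by simp
  have "l0 \<le> lam undefined" using a by blast
  also have "\<dots> \<le> sum lam UNIV" using lam by (intro member_le_sum) (auto intro: less_imp_le)
  finally have "l0 * \<sigma> \<le> (sum lam UNIV + real CARD('c)) * \<sigma>" using a by (intro mult_right_mono) auto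
  then show 2: "real CARD('c) * \<eta> + l0 * \<sigma> \<le> g" using a by linarith
  have "l0 / real CARD('c) * \<sigma> \<le> l0 * \<sigma>" using 1 a by (intro mult_right_mono) auto
  then show "real CARD('c) * \<eta> + l0 / real CARD('c) * \<sigma> \<le> g" using 2 by linarith
qed

text \<open>While the classes before the last one hold more than \<open>g * sqrt n\<close>
  customers, they are not all empty at any time of the preceding window. So the last class is not
  served and \<open>exclusive_drift\<close> drains the others; refusals only help.\<close>

lemma priority_collapse:
  assumes pol: "pol = FP" and ok: "collapse_params l0 g \<sigma>" and t: "0 \<le> t" "t \<le> T"
  shows "Qsum {..<Max UNIV} t \<le> g * sq"
proof (rule drift_bound[where f="Qsum {..<Max UNIV}" and \<kappa>="l0" and \<epsilon>="2 * real CARD('c) * \<eta>" and Az="real CARD('c) * \<eta>" and \<sigma>=\<sigma>])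
  note a = ok[unfolded collapse_params_def]
  let ?H = "{..<Max UNIV} :: 'c set"
  show "2 * real CARD('c) * \<eta> * (1 + \<sigma>) \<le> l0 * \<sigma>"
    using a collapse_paramsD(1)[OF ok] mult_right_mono[of "l0 / real CARD('c)" l0 \<sigma>] by linarith
  show "Qsum ?H 0 \<le> real CARD('c) * \<eta> * sq" by (rule Qsum_0)
  show "real CARD('c) * \<eta> + l0 * \<sigma> \<le> g" by (rule collapse_paramsD(2)[OF ok])
  fix s t assume st: "0 \<le> s" "s \<le> t" "t \<le> T" and w: "real n * (t - s) \<le> \<sigma> * sq" and big: "g * sq < Qsum ?H t"
  have pos: "\<exists>k\<in>?H. 0 < Q k u" if u: "s \<le> u" "u \<le> t" for u
  proof -
    have "real n * (t - u) \<le> real n * (t - s)" using u by (intro mult_left_mono) auto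
    then have "total E t - total E u \<le> ((sum lam UNIV + real CARD('c)) * \<sigma> + real CARD('c) * \<eta>) * sq"
      using u st w by (intro total_incr_le(1)) auto
    also have "\<dots> \<le> g / 2 * sq" using a by (intro mult_right_mono) auto
    finally have "Qsum ?H u \<ge> Qsum ?H t - g / 2 * sq" using Qsum_ge[of u t ?H] u st by simp
    moreover have "g * sq > 0" using a sq(1) by (intro mult_pos_pos) auto
    ultimately have "0 < Qsum ?H u" using big by linarith
    then obtain k where "k \<in> ?H" "0 < real (Q k u)"
      unfolding Qsum_def using sum_nonpos[of ?H "\<lambda>k. real (Q k u)"] by (meson not_less)
    then show ?thesis by auto
  qed
  have B: "B k t = B k s" if "k \<notin> ?H" for k
  proof (rule priority_const[OF pol st(1,2)])
    have "k \<le> Max UNIV" by (rule Max_ge) auto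
    then have "k = Max UNIV" using that by (metis lessThan_iff order_le_less)
    then show "\<exists>j<k. 0 < Q j u" if "s < u" "u \<le> t" for u using pos[of u] that by auto
  qed
  have busy: "0 < total Q s" "0 < total Q t" using pos[of s] pos[of t] st by (auto simp: total_pos_iff)
  have "0 \<le> (\<Sum>k\<in>?H. real (R k t) - real (R k s))" using reneged_le[OF st(1,2), of \<delta>] by (intro sum_nonneg) auto
  then show "Qsum ?H t \<le> Qsum ?H s - l0 * (real n * (t - s)) + 2 * real CARD('c) * \<eta> * (sq + real n * (t - s))"
    using exclusive_service[OF st(1,2) busy, of ?H, OF B] exclusive_drift[OF st, of "Max UNIV" ?H l0] a by simp
qed (use ok t eta in \<open>auto simp: collapse_params_def\<close>)

text \<open>The penalty \<open>m * (CARD('c) - m)\<close> on sets of size \<open>m\<close> is strictly concave, so every queue of a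
  maximising set exceeds every queue outside it by at least \<open>2 * g * sq\<close>.\<close>

definition excess :: "real \<Rightarrow> 'c set \<Rightarrow> real \<Rightarrow> real"
  where "excess g H t = Qsum H t - real (card H) / real CARD('c) * total Q t
    - real (card H) * (real CARD('c) - real (card H)) * (g * sq)"

lemma excess_gap:
  assumes max: "\<And>H'. excess g H' t \<le> excess g H t" and jk: "j \<in> H" "k \<notin> H"
  shows "real (Q j t) \<ge> real (Q k t) + 2 * (g * sq)"
proof -
  let ?c = "real CARD('c)" and ?m = "real (card H)"
  have H: "card (H - {j}) = card H - 1" "card (insert k H) = card H + 1" "1 \<le> card H"
    using jk by (auto simp: card_Diff_singleton Suc_le_eq card_gt_0_iff)
  have Q: "Qsum (H - {j}) t = Qsum H t - real (Q j t)" "Qsum (insert k H) t = Qsum H t + real (Q k t)"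
    using jk by (auto simp: Qsum_def sum_diff1)
  have "excess g (H - {j}) t = Qsum H t - real (Q j t) - (?m - 1) / ?c * total Q t - (?m - 1) * (?c - (?m - 1)) * (g * sq)"
    unfolding excess_def Q H using H(3) by (simp add: of_nat_diff)
  then have 1: "real (Q j t) \<ge> total Q t / ?c + (?c - 2 * ?m + 1) * (g * sq)"
    using max[of "H - {j}"] unfolding excess_def by (simp add: algebra_simps diff_divide_distrib)
  have "excess g (insert k H) t = Qsum H t + real (Q k t) - (?m + 1) / ?c * total Q t - (?m + 1) * (?c - (?m + 1)) * (g * sq)"
    unfolding excess_def Q H by (simp add: add.commute)
  then have 2: "real (Q k t) \<le> total Q t / ?c + (?c - 2 * ?m - 1) * (g * sq)"
    using max[of "insert k H"] unfolding excess_def by (simp add: algebra_simps add_divide_distrib)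
  show ?thesis using 1 2 by (simp add: algebra_simps)
qed

text \<open>Going back from t, a queue is lower by at most the arrivals since then and higher by at
  most the customers routed since then, each at most \<open>g / 2 * sqrt n\<close>. A gap of
  \<open>2 * g * sqrt n\<close> at t thus stays positive in the whole window, where no class outside
  H is a longest one.\<close>

lemma longest_exclusive:
  assumes pol: "pol = SLQ tie" and st: "0 \<le> s" "s \<le> t" "t \<le> T" and w: "real n * (t - s) \<le> \<sigma> * sq"
    and g: "0 < g" "(sum lam UNIV + real CARD('c)) * \<sigma> + real CARD('c) * \<eta> \<le> g / 2"
    and H: "H \<noteq> {}" and gap: "\<And>j k. j \<in> H \<Longrightarrow> k \<notin> H \<Longrightarrow> real (Q j t) \<ge> real (Q k t) + 2 * (g * sq)" and ne: "\<exists>k. k \<notin> H"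
  shows "\<And>u. s \<le> u \<Longrightarrow> u \<le> t \<Longrightarrow> 0 < total Q u" and "\<And>k. k \<notin> H \<Longrightarrow> B k t = B k s"
proof -
  have gsq: "g * sq > 0" using g(1) sq(1) by (intro mult_pos_pos) auto
  have inc: "total E t - total E u \<le> g * sq / 2" "total D t - total D u \<le> g * sq / 2" if u: "s \<le> u" "u \<le> t" for u
  proof -
    have "real n * (t - u) \<le> real n * (t - s)" using u by (intro mult_left_mono) auto
    moreover have "((sum lam UNIV + real CARD('c)) * \<sigma> + real CARD('c) * \<eta>) * sq \<le> g / 2 * sq"
      using g by (intro mult_right_mono) auto
    ultimately show "total E t - total E u \<le> g * sq / 2" "total D t - total D u \<le> g * sq / 2"
      using total_incr_le[of u t \<sigma>] u st w by linarith+
  qed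
  have Qj: "real (Q j u) \<ge> real (Q j t) - g * sq / 2" if "s \<le> u" "u \<le> t" for j u
    using Qsum_ge[of u t "{j}"] inc(1)[OF that] st that by (simp add: Qsum_def)
  obtain j0 k0 where jk: "j0 \<in> H" "k0 \<notin> H" using H ne by blast
  show busy: "0 < total Q u" if "s \<le> u" "u \<le> t" for u
  proof -
    have "0 < real (Q j0 u)" using gap[OF jk] Qj[OF that, of j0] gsq by linarith
    then show ?thesis using le_total[of Q j0 u] by linarith
  qed
  have Qk: "real (Q k u) \<le> real (Q k t) + g * sq / 2" if u: "s \<le> u" "u \<le> t" for k u
  proof -
    have u0: "0 \<le> u" using u st by simp
    have "real (B k t) - real (B k u) \<le> (\<Sum>k\<in>UNIV. real (B k t) - real (B k u))"
      using B_le[OF u0 u(2)] by (intro member_le_sum[where f="\<lambda>k. real (B k t) - real (B k u)"]) auto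
    also have "\<dots> = total D t - total D u"
      using busy_routed[OF u0 u(2) busy[OF u] busy[OF st(2) order.refl]] by (simp add: total_def sum_subtractf)
    finally have "real (B k t) - real (B k u) \<le> g * sq / 2" using inc(2)[OF u] by simp
    then show ?thesis
      using queue_real[of t k] queue_real[of u k] u0 u reneged_incr_le[OF u0 u(2), of \<delta> k] by simp
  qed
  have gap_u: "Q k u < Q j u" if "s \<le> u" "u \<le> t" "j \<in> H" "k \<notin> H" for j k u
    using gap[OF that(3,4)] Qj[OF that(1,2), of j] Qk[OF that(1,2), of k] gsq by linarith
  show "B k t = B k s" if k: "k \<notin> H" for k
  proof (rule longest_const[OF pol st(1,2)])
    fix v assume v: "s < v" "v \<le> t"
    then have "v > 0" using st by simp
    obtain s' where "0 \<le> s'" and s': "s' < v"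
      and "\<And>i u. s' \<le> u \<Longrightarrow> u < v \<Longrightarrow> E i u = E i s' \<and> B i u = B i s' \<and> Q i u = Q i s' \<and> R i u = R i s'"
      and lim: "\<And>i u. s' \<le> u \<Longrightarrow> u < v \<Longrightarrow> left_lim (Q i) v = Q i u"
      by (rule left_const[OF \<open>v > 0\<close>], rule that)
    have "left_lim (Q i) v = Q i (max s s')" for i by (rule lim) (use s' v in auto)
    then show "\<exists>j. left_lim (Q k) v < left_lim (Q j) v"
      using gap_u[of "max s s'" j0 k] k jk v s' by auto
  qed
qed

text \<open>The Lyapunov function is the maximum of the excess over all H. A maximiser with positive
  excess is neither empty nor the set of all classes, since there the excess is 0. So it is served
  exclusively, and its excess at s is at most the maximum at s.\<close>

lemma longest_excess:
  assumes pol: "pol = SLQ tie" and ok: "collapse_params l0 g \<sigma>" and t: "0 \<le> t" "t \<le> T"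
  shows "excess g H t \<le> g * sq"
proof -
  let ?c = "real CARD('c)"
  note a = ok[unfolded collapse_params_def]
  have gsq: "g * sq > 0" using a sq(1) by (intro mult_pos_pos) auto
  define f where "f t = Max (range (\<lambda>H. excess g H t))" for t
  have f: "excess g H t \<le> f t" for H t unfolding f_def by (intro Max_ge) auto
  have "f t \<le> g * sq"
  proof (rule drift_bound[where f=f and \<kappa>="l0 / ?c" and \<epsilon>="2 * ?c * \<eta>" and Az="?c * \<eta>" and \<sigma>=\<sigma>])
    show "?c * \<eta> + l0 / ?c * \<sigma> \<le> g" by (rule collapse_paramsD(4)[OF ok])
    show "f 0 \<le> ?c * \<eta> * sq"
    proof -
      have "excess g H 0 \<le> ?c * \<eta> * sq" for H
      proof -
        have "0 \<le> real (card H) / ?c * total Q 0" using total_nonneg[of Q 0] by simp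
        moreover have "0 \<le> real (card H) * (?c - real (card H)) * (g * sq)"
          by (intro mult_nonneg_nonneg[OF _ less_imp_le[OF gsq]] mult_nonneg_nonneg) (auto simp: card_mono)
        ultimately show ?thesis using Qsum_0[of H] by (simp add: excess_def)
      qed
      then show ?thesis unfolding f_def by (subst Max_le_iff) auto
    qed
    fix s t assume st: "0 \<le> s" "s \<le> t" "t \<le> T" and w: "real n * (t - s) \<le> \<sigma> * sq" and big: "g * sq < f t"
    have "f t \<in> range (\<lambda>H. excess g H t)" unfolding f_def by (intro Max_in) auto
    then obtain H where H: "f t = excess g H t" by blast
    have ne: "H \<noteq> {}" "H \<noteq> UNIV"
      using H big gsq by (auto simp: excess_def Qsum_def[of "{}"] Qsum_UNIV)
    then obtain k0 where k0: "k0 \<notin> H" by blast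
    have "excess g H' t \<le> excess g H t" for H' using f[of H' t] H by simp
    then have gap: "real (Q j t) \<ge> real (Q k t) + 2 * (g * sq)" if "j \<in> H" "k \<notin> H" for j k
      using that by (rule excess_gap)
    have busy: "0 < total Q u" if "s \<le> u" "u \<le> t" for u
      using longest_exclusive(1)[OF pol st w _ _ ne(1) gap _ that] a k0 by blast
    have B: "B k t = B k s" if "k \<notin> H" for k
      using longest_exclusive(2)[OF pol st w _ _ ne(1) gap _ that] a k0 by blast
    define m where "m = real (card H)"
    define x where "x = (\<Sum>k\<in>H. real (E k t) - real (E k s)) - (total D t - total D s)"
    define rH where "rH = (\<Sum>k\<in>H. real (R k t) - real (R k s))"
    define rL where "rL = (\<Sum>k\<in>-H. real (R k t) - real (R k s))"
    define eL where "eL = (\<Sum>k\<in>-H. real (E k t) - real (E k s))"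
    have split: "(\<Sum>k\<in>UNIV. h k) = sum h H + sum h (-H)" for h :: "'c \<Rightarrow> real"
      using sum.subset_diff[of H UNIV h] by (simp add: Compl_eq_Diff_UNIV)
    have m: "m \<le> ?c - 1" "0 \<le> m"
    proof -
      have "card H < CARD('c)" using ne by (intro psubset_card_mono) auto
      then show "m \<le> ?c - 1" "0 \<le> m" by (auto simp: m_def)
    qed
    have dH: "Qsum H t - Qsum H s = x - rH"
      unfolding x_def rH_def by (rule exclusive_service[OF st(1,2) busy busy B]) (use st in auto)
    have dZ: "total Q t - total Q s = x + eL - rH - rL"
      using total_Q_busy_diff[OF st(1,2) busy busy] st split[of "\<lambda>k. real (E k t) - real (E k s)"] split[of "\<lambda>k. real (R k t) - real (R k s)"]
      by (simp add: x_def rH_def rL_def eL_def total_def sum_subtractf)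
    have rL: "rL \<le> eL" unfolding rL_def eL_def
    proof (rule sum_mono)
      fix k show "real (R k t) - real (R k s) \<le> real (E k t) - real (E k s)"
        using reneged_incr_le[OF st(1,2), of \<delta> k] by simp
    qed
    have rH: "0 \<le> rH" unfolding rH_def using reneged_le[OF st(1,2), of \<delta>] by (intro sum_nonneg) auto
    have mc: "0 \<le> m / ?c" "m / ?c \<le> 1" "1 / ?c \<le> 1 - m / ?c"
      using m c_ge_1 by (auto simp: field_simps)
    have "excess g H t - excess g H s = (Qsum H t - Qsum H s) - m / ?c * (total Q t - total Q s)"
      unfolding excess_def m_def by (simp add: algebra_simps diff_divide_distrib)
    \<comment> \<open>Refusals cannot push the excess up: those in H lower it, and those outside H
      are at most the arrivals \<open>eL\<close> there.\<close>
    also have "\<dots> = (1 - m / ?c) * x - (1 - m / ?c) * rH - m / ?c * (eL - rL)"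
    proof -
      have "(x - rH) - y * (x + eL - rH - rL) = (1 - y) * x - (1 - y) * rH - y * (eL - rL)" for y :: real
        by (simp add: algebra_simps)
      then show ?thesis unfolding dH dZ .
    qed
    also have "\<dots> \<le> (1 - m / ?c) * x"
    proof -
      have "0 \<le> (1 - m / ?c) * rH" "0 \<le> m / ?c * (eL - rL)"
        using mc rH rL by (intro mult_nonneg_nonneg; simp)+
      then show ?thesis by linarith
    qed
    also have "\<dots> \<le> (1 - m / ?c) * (- l0 * (real n * (t - s)) + 2 * ?c * \<eta> * (sq + real n * (t - s)))"
      unfolding x_def using exclusive_drift[OF st k0, of l0] a mc by (intro mult_left_mono) auto
    also have "\<dots> = - ((1 - m / ?c) * (l0 * (real n * (t - s)))) + (1 - m / ?c) * (2 * ?c * \<eta> * (sq + real n * (t - s)))"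
      by (simp add: algebra_simps)
    also have "\<dots> \<le> - (1 / ?c * (l0 * (real n * (t - s)))) + 1 * (2 * ?c * \<eta> * (sq + real n * (t - s)))"
      using mc a st eta by (intro add_mono le_imp_neg_le mult_right_mono mult_nonneg_nonneg) auto
    finally have "excess g H t \<le> excess g H s - l0 / ?c * (real n * (t - s)) + 2 * ?c * \<eta> * (sq + real n * (t - s))"
      by simp
    then show "f t \<le> f s - l0 / ?c * (real n * (t - s)) + 2 * ?c * \<eta> * (sq + real n * (t - s))"
      using H f[of H s] by simp
  qed (use a t eta collapse_paramsD[OF ok] in auto)
  then show ?thesis using f[of H t] by simp
qed

text \<open>The asymptotic share of class k in the total queue.\<close>

definition weight :: "'c \<Rightarrow> real"
  where "weight k = (case pol of FP \<Rightarrow> if k = Max UNIV then 1 else 0 | SLQ _ \<Rightarrow> 1 / real CARD('c))"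

lemma weight: "0 \<le> weight k" "weight k \<le> 1" "weight k = 0 \<or> 1 / real CARD('c) \<le> weight k"
  using c_ge_1 by (auto simp: weight_def divide_le_eq_1 split: policy.split)

text \<open>Under SLQ a singleton H bounds each queue from above by the average plus
  \<open>CARD('c) * g * sqrt n\<close>. As the deviations from the average add up to 0, the upper
  bounds of the other classes give the lower bound, at the cost of another factor
  \<open>CARD('c)\<close>.\<close>

lemma collapse:
  assumes ok: "collapse_params l0 g \<sigma>" and t: "0 \<le> t" "t \<le> T"
  shows "\<bar>real (Q k t) - weight k * total Q t\<bar> \<le> (real CARD('c))\<^sup>2 * g * sq"
proof -
  let ?c = "real CARD('c)"
  note a = ok[unfolded collapse_params_def]
  have gsq: "g * sq > 0" using a sq(1) by (intro mult_pos_pos) auto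
  have c2: "?c \<le> ?c\<^sup>2" "1 \<le> ?c\<^sup>2" using c_ge_1 by (auto simp: self_le_power one_le_power)
  show ?thesis
  proof (cases pol)
    case FP
    let ?H = "{..<Max UNIV} :: 'c set"
    have wt: "weight j = (if j = Max UNIV then 1 else 0)" for j unfolding weight_def by (simp add: FP)
    have "j \<le> Max UNIV" for j :: 'c by (rule Max_ge) auto
    then have top: "-?H = {Max UNIV}" by (auto simp: antisym not_less)
    have Z: "total Q t = Qsum ?H t + real (Q (Max UNIV) t)"
      using sum.subset_diff[of ?H UNIV "\<lambda>k. real (Q k t)"] top
      by (simp add: Qsum_def total_def Compl_eq_Diff_UNIV)
    have H: "Qsum ?H t \<le> g * sq" by (rule priority_collapse[OF FP ok t])
    have H0: "0 \<le> Qsum ?H t" by (simp add: Qsum_def sum_nonneg)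
    have "\<bar>real (Q k t) - weight k * total Q t\<bar> \<le> Qsum ?H t"
    proof (cases "k = Max UNIV")
      case True
      then show ?thesis unfolding wt using Z H0 by simp
    next
      case False
      then have "k \<in> ?H" by (metis Compl_iff singletonD top)
      then have "real (Q k t) \<le> Qsum ?H t" unfolding Qsum_def by (intro member_le_sum) auto
      then show ?thesis unfolding wt using False by simp
    qed
    also have "\<dots> \<le> 1 * (g * sq)" using H by simp
    also have "\<dots> \<le> ?c\<^sup>2 * (g * sq)" using c2 gsq by (intro mult_right_mono) auto
    finally show ?thesis by (simp add: mult.assoc)
  next
    case (SLQ tie)
    have up: "real (Q k t) - total Q t / ?c \<le> ?c * (g * sq)" for k
      using longest_excess[OF SLQ ok t, of "{k}"] by (simp add: excess_def Qsum_def algebra_simps)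
    have lo: "- (?c * ?c * (g * sq)) \<le> real (Q k t) - total Q t / ?c"
    proof -
      have "(\<Sum>j\<in>UNIV. real (Q j t) - total Q t / ?c) = 0" by (simp add: total_def sum_subtractf)
      then have "real (Q k t) - total Q t / ?c = - (\<Sum>j\<in>UNIV - {k}. real (Q j t) - total Q t / ?c)"
        by (simp add: sum.remove[of UNIV k])
      moreover have "(\<Sum>j\<in>UNIV - {k}. real (Q j t) - total Q t / ?c) \<le> (\<Sum>j\<in>UNIV - {k}. ?c * (g * sq))"
        using up by (intro sum_mono)
      moreover have "(\<Sum>j\<in>UNIV - {k}. ?c * (g * sq)) \<le> ?c * (?c * (g * sq))"
      proof -
        have "(\<Sum>j\<in>UNIV - {k}. ?c * (g * sq)) = real (card (UNIV - {k})) * (?c * (g * sq))" by simp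
        also have "\<dots> \<le> ?c * (?c * (g * sq))"
        proof (rule mult_right_mono)
          show "real (card (UNIV - {k})) \<le> ?c" by (simp add: card_mono)
          show "0 \<le> ?c * (g * sq)" by (intro mult_nonneg_nonneg[OF _ less_imp_le[OF gsq]]) auto
        qed
        finally show ?thesis .
      qed
      ultimately show ?thesis unfolding mult.assoc by linarith
    qed
    have "?c * (g * sq) \<le> ?c\<^sup>2 * (g * sq)" using c2 gsq by (intro mult_right_mono) auto
    then have "\<bar>real (Q k t) - total Q t / ?c\<bar> \<le> ?c\<^sup>2 * (g * sq)"
      using up[of k] lo unfolding abs_le_iff power2_eq_square by linarith
    moreover have "weight k = 1 / ?c" unfolding weight_def by (simp add: SLQ)
    ultimately show ?thesis by (simp add: mult.assoc)
  qed
qed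

end

section \<open>Oscillation over short windows\<close>

context diffusive_path
begin

text \<open>Above this level the share of class k exceeds its threshold throughout the window, so
  class k refuses all its arrivals, \<open>dev\<close> possibly excepted. What still enters is the
  input of the other classes, and the total falls as if these were served exclusively.\<close>

lemma upper_level:
  assumes ok: "collapse_params l0 g \<sigma>" and k: "0 < weight k"
    and thr: "\<And>q. real q > \<beta> * sq \<Longrightarrow> \<not> thr k q" and \<beta>: "0 \<le> \<beta>"
    and \<gamma>: "g \<le> \<gamma>" "2 * ((real CARD('c))\<^sup>2 * g) \<le> weight k * \<gamma>"
    and \<eta>: "(2 * real CARD('c) + 1) * \<eta> * (1 + \<sigma>) \<le> l0 * \<sigma>" and t: "0 \<le> t" "t \<le> T"
  shows "total Q t \<le> (\<beta> / weight k + \<gamma>) * sq"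
proof (rule drift_bound[where f="total Q" and \<kappa>=l0 and \<epsilon>="(2 * real CARD('c) + 1) * \<eta>" and Az="real CARD('c) * \<eta>" and \<sigma>=\<sigma>])
  note a = ok[unfolded collapse_params_def]
  let ?c = "real CARD('c)" and ?a = "weight k"
  show "(2 * ?c + 1) * \<eta> * (1 + \<sigma>) \<le> l0 * \<sigma>" by fact
  show "total Q 0 \<le> ?c * \<eta> * sq" using total_0 by (simp add: mult.assoc)
  have "0 \<le> \<beta> / ?a" using \<beta> k by simp
  then show "?c * \<eta> + l0 * \<sigma> \<le> \<beta> / ?a + \<gamma>" using collapse_paramsD(2)[OF ok] \<gamma> by linarith
  fix s t assume st: "0 \<le> s" "s \<le> t" "t \<le> T" and w: "real n * (t - s) \<le> \<sigma> * sq"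
    and big: "(\<beta> / ?a + \<gamma>) * sq < total Q t"
  have sq0: "0 < sq" using sq(1) by linarith
  have Zu: "(\<beta> / ?a + \<gamma> / 2) * sq < total Q u" if u: "s \<le> u" "u \<le> t" for u
  proof -
    have "real n * (t - u) \<le> real n * (t - s)" using u by (intro mult_left_mono) auto
    then have "total E t - total E u \<le> ((sum lam UNIV + ?c) * \<sigma> + ?c * \<eta>) * sq"
      using u st w by (intro total_incr_le(1)) auto
    also have "\<dots> \<le> \<gamma> / 2 * sq" using a \<gamma> sq0 by (intro mult_right_mono) auto
    finally have "total Q u \<ge> total Q t - \<gamma> / 2 * sq" using Qsum_ge[of u t UNIV] u st by (simp add: Qsum_UNIV)
    then show ?thesis using big by (simp add: distrib_right)
  qed
  have busy: "0 < total Q u" if "s \<le> u" "u \<le> t" for u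
  proof -
    have "0 \<le> (\<beta> / ?a + \<gamma> / 2) * sq" using \<beta> k a \<gamma> sq0 by (intro mult_nonneg_nonneg add_nonneg_nonneg) auto
    then show ?thesis using Zu[OF that] by linarith
  qed
  have no: "\<not> thr k (Q k u)" if u: "s \<le> u" "u < t" for u
  proof (rule thr)
    have "?a * ((\<beta> / ?a + \<gamma> / 2) * sq) < ?a * total Q u" using Zu[of u] u k by (intro mult_strict_left_mono) auto
    moreover have "?a * ((\<beta> / ?a + \<gamma> / 2) * sq) = \<beta> * sq + ?a * \<gamma> / 2 * sq" using k by (simp add: algebra_simps)
    moreover have "?c\<^sup>2 * g * sq \<le> ?a * \<gamma> / 2 * sq" using \<gamma>(2) sq0 by (intro mult_right_mono) auto
    moreover have "?a * total Q u - ?c\<^sup>2 * g * sq \<le> real (Q k u)"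
      using abs_le_D2[OF collapse[OF ok, of u k]] u st by simp
    ultimately show "\<beta> * sq < real (Q k u)" by linarith
  qed
  have rk: "real (E k t) - real (E k s) - 1 \<le> real (R k t) - real (R k s)"
    using all_renege[OF st(1,2) no] by simp
  have "real (R k t) - real (R k s) \<le> (\<Sum>j\<in>UNIV. real (R j t) - real (R j s))"
    using reneged_le[OF st(1,2), of \<delta>] by (intro member_le_sum[where f="\<lambda>j. real (R j t) - real (R j s)"]) auto
  then have R: "real (E k t) - real (E k s) - 1 \<le> total R t - total R s"
    using rk by (simp add: total_def sum_subtractf)
  have E: "total E t - total E s = (real (E k t) - real (E k s)) + (\<Sum>j\<in>UNIV - {k}. real (E j t) - real (E j s))"
    by (simp add: total_def sum_subtractf[symmetric] sum.remove[of UNIV k])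
  have "total Q t - total Q s = (total E t - total E s) - (total D t - total D s) - (total R t - total R s)"
    using busy st by (intro total_Q_busy_diff) auto
  also have "\<dots> \<le> (\<Sum>j\<in>UNIV - {k}. real (E j t) - real (E j s)) - (total D t - total D s) + 1"
    using R E by simp
  also have "\<dots> \<le> - l0 * (real n * (t - s)) + 2 * ?c * \<eta> * (sq + real n * (t - s)) + \<eta> * (sq + real n * (t - s))"
  proof (intro add_mono exclusive_drift st)
    have "0 \<le> \<eta> * (real n * (t - s))" using eta st by simp
    then show "1 \<le> \<eta> * (sq + real n * (t - s))" using n(2) by (simp add: distrib_left)
  qed (use a in auto)
  finally show "total Q t \<le> total Q s - l0 * (real n * (t - s)) + (2 * ?c + 1) * \<eta> * (sq + real n * (t - s))"
    by (simp add: algebra_simps)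
qed (use ok t eta in \<open>auto simp: collapse_params_def\<close>)

lemma net_input_small:
  assumes st: "0 \<le> s" "s \<le> t" "t \<le> T" and w: "real n * (t - s) \<le> w * sq"
  shows "\<bar>(total E t - total E s) - (total D t - total D s)\<bar> \<le> 2 * real CARD('c) * \<eta> * (1 + w) * sq"
proof -
  have "\<eta> * (sq + real n * (t - s)) \<le> \<eta> * (sq + w * sq)" using w eta by (intro mult_left_mono) auto
  then have "real CARD('c) * (\<eta> * (sq + real n * (t - s))) \<le> real CARD('c) * (\<eta> * (sq + w * sq))"
    by (rule mult_left_mono) simp
  moreover have "real CARD('c) * (\<eta> * (sq + w * sq)) + real CARD('c) * (\<eta> * (sq + w * sq)) = 2 * real CARD('c) * \<eta> * (1 + w) * sq"
    by (simp add: algebra_simps)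
  ultimately show ?thesis using total_E_near[OF st] total_D_near[OF st] by linarith
qed

text \<open>At the last refusal in the window the total queue is near the level
  \<open>\<beta> k / weight k\<close>; at s it cannot be much higher, by \<open>upper_level\<close>.
  With all servers busy at that refusal, balance leaves no room for many refusals in between. The
  queues follow, since the total is a Lipschitz function of the number in the system and each class
  holds its share.\<close>

lemma window_bounds:
  fixes \<beta> :: "'c \<Rightarrow> real" and g :: real
  defines "G \<equiv> (real CARD('c))\<^sup>2 * g"
  assumes ok: "collapse_params l0 g \<sigma>"
    and thr: "\<And>k. (\<forall>q. thr k q) \<or> (G < \<beta> k \<and> (\<forall>q. thr k q \<longleftrightarrow> real q \<le> \<beta> k * sq))"
    and \<gamma>: "g \<le> \<gamma>" "2 * real CARD('c) * G \<le> \<gamma>"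
    and \<eta>: "(2 * real CARD('c) + 1) * \<eta> * (1 + \<sigma>) \<le> l0 * \<sigma>"
    and st: "0 \<le> s" "s \<le> t" "t \<le> T" and w: "real n * (t - s) \<le> w * sq" "0 \<le> w"
    and V: "V = 2 * real CARD('c) * \<eta> * (1 + w) + 2 * \<gamma> + real CARD('c) * \<eta> + \<eta>"
  shows "total R t - total R s \<le> V * sq"
    and "\<bar>real (Q k t) - real (Q k s)\<bar> \<le> (2 * V + \<gamma>) * sq"
proof -
  let ?c = "real CARD('c)"
  note a = ok[unfolded collapse_params_def]
  have sq0: "0 < sq" using sq(1) by linarith
  have g0: "0 < g" using a by simp
  have c2: "1 \<le> ?c\<^sup>2" using c_ge_1 by (simp add: one_le_power)
  have G0: "0 \<le> G" using a by (simp add: G_def)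
  have cG: "G \<le> ?c * G" using c_ge_1 G0 mult_right_mono[of 1 ?c G] by simp
  have pos: "0 \<le> ?c * \<eta>" "0 \<le> 2 * ?c * \<eta> * (1 + w)" "0 \<le> \<gamma>" "0 \<le> \<eta>"
    using eta w(2) \<gamma>(1) g0 by auto
  have c': "\<bar>real (Q k u) - weight k * total Q u\<bar> \<le> G * sq" if "0 \<le> u" "u \<le> T" for k u
    using collapse[OF ok that] by (simp add: G_def)
  show R: "total R t - total R s \<le> V * sq"
  proof (cases "total R t \<le> total R s + 1")
    case True
    have "\<eta> * sq \<le> V * sq" unfolding V using pos sq0 by (intro mult_right_mono) auto
    then show ?thesis using n(2) True by linarith
  next
    case False
    then obtain v k where v: "s < v" "v \<le> t" "\<not> thr k (left_lim (Q k) v)" "total R t \<le> total R v + 1"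
      using last_renege[OF st(1,2)] by blast
    have \<beta>: "G < \<beta> k" "\<And>q. thr k q \<longleftrightarrow> real q \<le> \<beta> k * sq" using thr[of k] v(3) by auto
    have "v > 0" using v st by simp
    obtain s' where s': "0 \<le> s'" "s' < v"
      and const: "\<And>i u. s' \<le> u \<Longrightarrow> u < v \<Longrightarrow> E i u = E i s' \<and> B i u = B i s' \<and> Q i u = Q i s' \<and> R i u = R i s'"
      and lim: "\<And>i u. s' \<le> u \<Longrightarrow> u < v \<Longrightarrow> left_lim (Q i) v = Q i u"
      by (rule left_const[OF \<open>v > 0\<close>], rule that)
    define u where "u = max s s'"
    have u: "0 \<le> u" "s \<le> u" "s' \<le> u" "u < v" "u \<le> T" using st v s' by (auto simp: u_def)
    have "left_lim (Q k) v = Q k u" by (rule lim) (use u in auto)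
    then have Qu: "\<beta> k * sq < real (Q k u)" using v(3) \<beta>(2) by (simp add: not_le)
    then have "0 < total Q u" using le_total[of Q k u] \<beta>(1) G0 sq0 mult_pos_pos[of "\<beta> k" sq] by linarith
    then have Pu: "total P u = real n" using total_P_busy u by simp
    have Rv: "total R v \<le> total R u + ?c * (\<eta> * sq)"
    proof (rule R_jump)
      show "E i x = E i u" if "u \<le> x" "x < v" for i x
        using const[of x i] const[of u i] that u by linarith
    qed (use u v st in auto)
    \<comment> \<open>A class of asymptotic share 0 cannot have refused: its queue is at most
      \<open>G * sqrt n\<close>, which is below its threshold.\<close>
    have wk: "weight k \<noteq> 0"
    proof
      assume "weight k = 0"
      then have "real (Q k u) \<le> G * sq" using c'[of u k] u by simp
      moreover have "G * sq \<le> \<beta> k * sq" using \<beta>(1) sq0 by (intro mult_right_mono) auto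
      ultimately show False using Qu by linarith
    qed
    then have wk': "0 < weight k" "1 / ?c \<le> weight k" using weight(1,3)[of k] by auto
    have iw: "1 / weight k \<le> ?c" using wk' c_ge_1 by (simp add: field_simps)
    have Zs: "total Q s \<le> (\<beta> k / weight k + \<gamma>) * sq"
    proof (rule upper_level[OF ok wk'(1)])
      show "2 * (?c\<^sup>2 * g) \<le> weight k * \<gamma>"
      proof -
        have "2 * G = 1 / ?c * (2 * ?c * G)" using c_ge_1 by simp
        also have "\<dots> \<le> weight k * \<gamma>" using wk' \<gamma>(2) pos G0 by (intro mult_mono) auto
        finally show ?thesis by (simp add: G_def)
      qed
    qed (use \<beta> \<gamma> \<eta> st G0 in auto)
    have Zu: "(\<beta> k / weight k) * sq - ?c * G * sq \<le> total Q u"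
    proof -
      have "\<beta> k * sq - G * sq \<le> weight k * total Q u" using Qu abs_le_D1[OF c'[of u k]] u by simp
      then have "(\<beta> k * sq - G * sq) / weight k \<le> total Q u" using wk' by (simp add: field_simps)
      moreover have "G * sq * (1 / weight k) \<le> G * sq * ?c" using iw G0 sq0 by (intro mult_left_mono) auto
      ultimately show ?thesis by (simp add: diff_divide_distrib algebra_simps)
    qed
    have "0 \<le> ?c * G" using G0 by simp
    then have cGs: "?c * G * sq \<le> \<gamma> * sq" using \<gamma>(2) sq0 by (intro mult_right_mono) auto
    have wu: "real n * (u - s) \<le> w * sq"
      using w(1) u v mult_left_mono[of "u - s" "t - s" "real n"] by simp
    \<comment> \<open>All servers are busy at u, so the number in service was not higher at s and
      its change has the favourable sign.\<close>
    have "total R u - total R s \<le> (total E u - total E s) - (total D u - total D s) - total Q u + total Q s"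
      using balance[of u] balance[of s] Pu total_P_le[of s] u st by simp
    also have "\<dots> \<le> 2 * ?c * \<eta> * (1 + w) * sq + 2 * \<gamma> * sq"
      using abs_le_D1[OF net_input_small[OF st(1) u(2) u(5) wu]] Zs Zu cGs by (simp add: distrib_right)
    finally have "total R t - total R s \<le> 2 * ?c * \<eta> * (1 + w) * sq + 2 * \<gamma> * sq + ?c * (\<eta> * sq) + \<eta> * sq"
      using Rv v(4) n(2) by linarith
    then show ?thesis unfolding V by (simp add: algebra_simps)
  qed
  have "\<bar>(total Q t + total P t - real n) - (total Q s + total P s - real n)\<bar>
      \<le> 2 * ?c * \<eta> * (1 + w) * sq + (total R t - total R s)"
    using net_input_small[OF st w(1)] balance[of t] balance[of s] st total_R_le[OF st(1,2)] by linarith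
  also have "\<dots> \<le> 2 * ?c * \<eta> * (1 + w) * sq + V * sq" using R by simp
  also have "\<dots> \<le> 2 * V * sq"
  proof -
    have "2 * ?c * \<eta> * (1 + w) * sq \<le> V * sq" unfolding V using pos sq0 by (intro mult_right_mono) auto
    then show ?thesis by simp
  qed
  finally have "\<bar>(total Q t + total P t - real n) - (total Q s + total P s - real n)\<bar> \<le> 2 * V * sq" .
  then have Z: "\<bar>total Q t - total Q s\<bar> \<le> 2 * V * sq"
    using total_Q_eq[of t] total_Q_eq[of s] st by linarith
  have "\<bar>weight k * total Q t - weight k * total Q s\<bar> = weight k * \<bar>total Q t - total Q s\<bar>"
    using weight(1)[of k] by (simp add: abs_mult right_diff_distrib[symmetric])
  also have "\<dots> \<le> 1 * \<bar>total Q t - total Q s\<bar>" using weight(2)[of k] by (intro mult_right_mono) auto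
  finally have "\<bar>weight k * total Q t - weight k * total Q s\<bar> \<le> 2 * V * sq" using Z by simp
  moreover have "2 * (G * sq) \<le> \<gamma> * sq"
    using \<gamma>(2) cG sq0 mult_right_mono[of "2 * G" \<gamma> sq] by simp
  ultimately show "\<bar>real (Q k t) - real (Q k s)\<bar> \<le> (2 * V + \<gamma>) * sq"
    using c'[of t k] c'[of s k] st unfolding distrib_right by linarith
qed

lemma routed_near:
  assumes st: "0 \<le> s" "s \<le> t" "t \<le> T" and w: "real n * (t - s) \<le> w * sq"
    and R: "total R t - total R s \<le> V * sq" and Q: "\<bar>real (Q k t) - real (Q k s)\<bar> \<le> W * sq"
  shows "\<bar>real (B k t) - real (B k s) - lam k * (real n * (t - s))\<bar> \<le> (\<eta> * (1 + w) + V + W) * sq"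
proof -
  have "real (R k t) - real (R k s) \<le> (\<Sum>j\<in>UNIV. real (R j t) - real (R j s))"
    using reneged_le[OF st(1,2), of \<delta>] by (intro member_le_sum[where f="\<lambda>j. real (R j t) - real (R j s)"]) auto
  then have R': "real (R k t) - real (R k s) \<le> V * sq" "0 \<le> real (R k t) - real (R k s)"
    using R reneged_le[OF st(1,2), of \<delta> k] by (auto simp: total_def sum_subtractf)
  have "\<eta> * (sq + real n * (t - s)) \<le> \<eta> * (sq + w * sq)" using w eta by (intro mult_left_mono) auto
  then have E: "\<bar>real (E k t) - real (E k s) - lam k * (real n * (t - s))\<bar> \<le> \<eta> * (1 + w) * sq"
    using E_near[OF st, of k] by (simp add: algebra_simps)
  have "real (B k t) - real (B k s) - lam k * (real n * (t - s)) =
    (real (E k t) - real (E k s) - lam k * (real n * (t - s))) - (real (R k t) - real (R k s)) - (real (Q k t) - real (Q k s))"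
    using queue_real[of t k] queue_real[of s k] st by simp
  then have "\<bar>real (B k t) - real (B k s) - lam k * (real n * (t - s))\<bar> \<le> \<eta> * (1 + w) * sq + V * sq + W * sq"
    using E R' Q by linarith
  then show ?thesis by (simp add: distrib_right)
qed

end

section \<open>Waiting times\<close>

context queueing_path
begin

lemma joining_time_at_arrival:
  assumes v: "0 < v" and j: "j \<le> E i v" "\<And>u. 0 \<le> u \<Longrightarrow> u < v \<Longrightarrow> E i u < j" and join: "\<delta> i j"
  shows "joining_time (joined E \<delta> i) v = ereal v"
proof -
  \<comment> \<open>Customers who join are those who refuse under the opposite decisions, so the
    facts on refusals carry over.\<close>
  have J: "joined E \<delta> = reneged E (\<lambda>i j. \<not> \<delta> i j)" by (simp add: joined_def reneged_def fun_eq_iff)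
  obtain s where s: "0 \<le> s" "s < v"
    and const: "\<And>i u. s \<le> u \<Longrightarrow> u < v \<Longrightarrow> E i u = E i s \<and> B i u = B i s \<and> Q i u = Q i s \<and> R i u = R i s"
    and "\<And>i u. s \<le> u \<Longrightarrow> u < v \<Longrightarrow> left_lim (Q i) v = Q i u"
    by (rule left_const[OF v], rule that)
  have "joined E \<delta> i u = joined E \<delta> i s" if "s \<le> u" "u < v" for u
    using const[OF that, of i] by (simp add: joined_def)
  then have lim: "left_lim (joined E \<delta> i) v = joined E \<delta> i s" by (rule left_lim_const[OF s(2)])
  have "j \<in> {j\<in>{E i s<..E i v}. \<not> \<not> \<delta> i j}" using j(1) j(2)[of s] s join by auto
  then have "0 < card {j\<in>{E i s<..E i v}. \<not> \<not> \<delta> i j}" by (auto simp: card_gt_0_iff)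
  then have "joined E \<delta> i s < joined E \<delta> i v"
    using reneged_diff[of s v "\<lambda>i j. \<not> \<delta> i j" i] s unfolding J by simp
  then show ?thesis unfolding joining_time_def lim using v
    by (intro antisym Inf_lower Inf_greatest) auto
qed

lemma waiting_time_le:
  assumes JT: "joining_time J v = ereal v" and x: "0 < x" "b v + q v \<le> b (v + x)"
  obtains y where "waiting_time J b q v = ereal y" "0 \<le> y" "y \<le> x"
proof -
  let ?A = "ereal ` {s. v < s \<and> b v + q v \<le> b s}"
  have RT: "routing_time J b q v = Inf ?A" by (simp add: routing_time_def JT)
  have up: "Inf ?A \<le> ereal (v + x)" using x by (intro Inf_lower) auto
  have lo: "ereal v \<le> Inf ?A" by (intro Inf_greatest) auto
  obtain z where z: "Inf ?A = ereal z" using up lo by (cases "Inf ?A") auto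
  show ?thesis using that[of "z - v"] up lo by (simp add: waiting_time_def RT JT z)
qed

lemma waiting_time_ge:
  assumes JT: "joining_time J v = ereal v" and x: "\<And>s. v < s \<Longrightarrow> s < v + x \<Longrightarrow> b s < b v + q v"
  shows "ereal x \<le> waiting_time J b q v"
proof -
  let ?A = "ereal ` {s. v < s \<and> b v + q v \<le> b s}"
  have RT: "routing_time J b q v = Inf ?A" by (simp add: routing_time_def JT)
  have "ereal (v + x) \<le> Inf ?A" using x by (intro Inf_greatest) (force simp: not_le[symmetric])
  then show ?thesis unfolding waiting_time_def RT JT by (cases "Inf ?A") auto
qed

end

lemma extend_infinity_le:
  assumes mono: "strict_mono_on {0..} h" and y: "WT = ereal y" "0 \<le> y" "y \<le> x" and sq: "0 \<le> sq"
  shows "extend_infinity h (ereal sq * WT) \<le> ereal (h (sq * x))"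
proof -
  have "sq * y \<le> sq * x" "0 \<le> sq * y" using y sq by (auto intro: mult_left_mono)
  then have "h (sq * y) \<le> h (sq * x)" using strict_mono_on_leD[OF mono, of "sq * y" "sq * x"] by auto
  then show ?thesis using y by (simp add: extend_infinity_def)
qed

text \<open>The waiting time may be infinite here; it then costs the supremum of h, which is above
  every value of h.\<close>

lemma extend_infinity_ge:
  assumes mono: "strict_mono_on {0..} h" and x: "ereal x \<le> WT" "0 \<le> x" and sq: "0 < sq"
  shows "ereal (h (sq * x)) \<le> extend_infinity h (ereal sq * WT)"
proof (cases WT)
  case (real y)
  then have "sq * x \<le> sq * y" "0 \<le> sq * x" using x sq by (auto intro: mult_left_mono)
  then have "h (sq * x) \<le> h (sq * y)" using strict_mono_on_leD[OF mono, of "sq * x" "sq * y"] by auto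
  then show ?thesis using real by (simp add: extend_infinity_def)
next
  case PInf
  moreover have "ereal (h (sq * x)) \<le> (SUP y\<in>{0..}. ereal (h y))" using sq x by (intro SUP_upper) auto
  ultimately show ?thesis using sq by (simp add: extend_infinity_def)
qed (use x in auto)

section \<open>Waiting times near the thresholds\<close>

text \<open>The auxiliary constants are hidden behind an existential quantifier, so that only
  \<eta>, the window length w in units of \<open>1 / sqrt n\<close> and the final error \<gamma>0
  stay visible. The last inequality adds up the errors of arrivals, refusals and queues; the bound
  on refusals occurs three times because it enters the change of a queue twice.\<close>

definition window_params :: "('c::finite \<Rightarrow> real) \<Rightarrow> ('c \<Rightarrow> real) \<Rightarrow> real \<Rightarrow> real \<Rightarrow> real \<Rightarrow> bool"
  where "window_params lam \<beta> w \<gamma>0 \<eta> \<longleftrightarrow> (\<exists>l0 g \<sigma> \<gamma>. 0 < l0 \<and> (\<forall>i. l0 \<le> lam i) \<and> 0 < g \<and> 0 < \<sigma> \<and>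
    (sum lam UNIV + real CARD('c)) * \<sigma> + real CARD('c) * \<eta> \<le> g / 2 \<and>
    2 * real CARD('c) * \<eta> * (1 + \<sigma>) \<le> l0 / real CARD('c) * \<sigma> \<and>
    (\<forall>k. (real CARD('c))\<^sup>2 * g < \<beta> k) \<and> g \<le> \<gamma> \<and> 2 * real CARD('c) * ((real CARD('c))\<^sup>2 * g) \<le> \<gamma> \<and>
    (2 * real CARD('c) + 1) * \<eta> * (1 + \<sigma>) \<le> l0 * \<sigma> \<and>
    \<eta> * (1 + w) + 3 * (2 * real CARD('c) * \<eta> * (1 + w) + 2 * \<gamma> + real CARD('c) * \<eta> + \<eta>) + \<gamma> \<le> \<gamma>0)"

lemma window_params_exist:
  fixes lam \<beta> :: "'c::finite \<Rightarrow> real"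
  assumes lam: "\<And>i. 0 < lam i" and \<beta>: "\<And>i. 0 < \<beta> i" and w: "0 \<le> w" and \<gamma>0: "0 < \<gamma>0"
  obtains \<eta>0 where "0 < \<eta>0" "\<And>\<eta>. 0 < \<eta> \<Longrightarrow> \<eta> \<le> \<eta>0 \<Longrightarrow> window_params lam \<beta> w \<gamma>0 \<eta>"
proof -
  let ?c = "real CARD('c)"
  have c: "1 \<le> ?c" using zero_less_card_finite[where 'a='c] by linarith
  define L where "L = sum lam UNIV + ?c"
  have L: "0 < L" unfolding L_def using lam c by (intro add_nonneg_pos sum_nonneg) (auto intro: less_imp_le)
  define l0 where "l0 = Min (range lam)"
  have l0: "0 < l0" "\<And>i. l0 \<le> lam i" unfolding l0_def using lam by auto
  \<comment> \<open>The last requirement contains \<gamma> seven times; this choice gives it half of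
    \<gamma>0 and leaves the other half to \<eta>.\<close>
  define \<gamma> where "\<gamma> = \<gamma>0 / 14"
  have \<gamma>: "0 < \<gamma>" using \<gamma>0 by (simp add: \<gamma>_def)
  define b where "b = min \<gamma> (Min (range \<beta>))"
  have b: "0 < b" "b \<le> \<gamma>" "\<And>k. b \<le> \<beta> k"
    using \<gamma> \<beta> by (auto simp: b_def intro: min.coboundedI2)
  define g where "g = b / (2 * ?c ^ 3)"
  have g: "0 < g" using b c by (simp add: g_def)
  have c2g: "?c\<^sup>2 * g = b / (2 * ?c)" using c by (simp add: g_def power2_eq_square power3_eq_cube)
  have cg: "2 * ?c * (?c\<^sup>2 * g) = b" unfolding c2g using c by simp
  have "1 \<le> 2 * ?c" "1 \<le> ?c\<^sup>2" using c one_le_power[OF c, of 2] by linarith+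
  then have "1 * 1 \<le> 2 * ?c * ?c\<^sup>2" by (intro mult_mono) auto
  then have c2: "1 \<le> 2 * ?c * ?c\<^sup>2" by simp
  have gb: "g \<le> b"
  proof -
    have "1 * g \<le> 2 * ?c * ?c\<^sup>2 * g" using c2 g by (intro mult_right_mono) auto
    also have "\<dots> = b" using cg by (simp only: mult.assoc)
    finally show ?thesis by simp
  qed
  have less_b: "?c\<^sup>2 * g < b" 
  proof -
    have "1 < 2 * ?c" using c by linarith
    then have "b * 1 < b * (2 * ?c)" using b(1) by (intro mult_strict_left_mono)
    then show ?thesis unfolding c2g using c by (simp add: field_simps)
  qed
  \<comment> \<open>\<sigma> takes half of the allowance \<open>g / 2\<close>; the other half is
    left to \<eta>, which must be small against \<sigma> and is therefore chosen last.\<close>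
  define \<sigma> where "\<sigma> = g / (4 * L)"
  have \<sigma>: "0 < \<sigma>" "L * \<sigma> = g / 4" using g L by (auto simp: \<sigma>_def)
  define K where "K = (1 + w) + 6 * ?c * (1 + w) + 3 * ?c + 3"
  have K: "0 < K" unfolding K_def using w c by (intro add_nonneg_pos add_nonneg_nonneg) auto
  define \<eta>0 where "\<eta>0 = Min {g / (4 * ?c), l0 / ?c * \<sigma> / (2 * ?c * (1 + \<sigma>)), l0 * \<sigma> / ((2 * ?c + 1) * (1 + \<sigma>)), \<gamma>0 / (2 * K)}"
  have pos: "0 < 2 * ?c * (1 + \<sigma>)" "0 < (2 * ?c + 1) * (1 + \<sigma>)" using c \<sigma> by (auto intro!: mult_pos_pos)
  have "0 < \<eta>0" unfolding \<eta>0_def using g l0 \<sigma> K \<gamma>0 c pos by auto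
  moreover have "window_params lam \<beta> w \<gamma>0 \<eta>" if "0 < \<eta>" "\<eta> \<le> \<eta>0" for \<eta>
  proof -
    have div: "\<eta> \<le> g / (4 * ?c)" "\<eta> \<le> l0 / ?c * \<sigma> / (2 * ?c * (1 + \<sigma>))"
      "\<eta> \<le> l0 * \<sigma> / ((2 * ?c + 1) * (1 + \<sigma>))" "\<eta> \<le> \<gamma>0 / (2 * K)"
      using that by (auto simp: \<eta>0_def)
    have mul: "\<eta> * y \<le> x" if "\<eta> \<le> x / y" "0 < y" for x y :: real
      using that by (simp add: pos_le_divide_eq)
    have 1: "\<eta> * (4 * ?c) \<le> g" "\<eta> * (2 * ?c * (1 + \<sigma>)) \<le> l0 / ?c * \<sigma>"
      "\<eta> * ((2 * ?c + 1) * (1 + \<sigma>)) \<le> l0 * \<sigma>" "\<eta> * (2 * K) \<le> \<gamma>0"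
      using mul[OF div(1)] mul[OF div(2) pos(1)] mul[OF div(3) pos(2)] mul[OF div(4)] c K by linarith+
    have eqK: "\<eta> * (1 + w) + 3 * (2 * ?c * \<eta> * (1 + w) + 2 * \<gamma> + ?c * \<eta> + \<eta>) + \<gamma> = \<eta> * K + 7 * \<gamma>"
      by (simp add: K_def algebra_simps)
    have 2: "\<eta> * (1 + w) + 3 * (2 * ?c * \<eta> * (1 + w) + 2 * \<gamma> + ?c * \<eta> + \<eta>) + \<gamma> \<le> \<gamma>0"
      unfolding eqK using 1(4) by (simp add: \<gamma>_def)
    show ?thesis unfolding window_params_def
    proof (intro exI conjI)
      show "(sum lam UNIV + ?c) * \<sigma> + ?c * \<eta> \<le> g / 2"
        using \<sigma>(2) 1(1) by (simp add: L_def mult.commute)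
      show "2 * ?c * ((real CARD('c))\<^sup>2 * g) \<le> \<gamma>" using cg b by simp
      show "\<forall>k. ?c\<^sup>2 * g < \<beta> k" using less_b b(3) by (meson less_le_trans)
      show "2 * ?c * \<eta> * (1 + \<sigma>) \<le> l0 / ?c * \<sigma>" using 1(2) by (simp add: algebra_simps)
      show "(2 * ?c + 1) * \<eta> * (1 + \<sigma>) \<le> l0 * \<sigma>" using 1(3) by (simp add: algebra_simps)
      show "\<eta> * (1 + w) + 3 * (2 * ?c * \<eta> * (1 + w) + 2 * \<gamma> + ?c * \<eta> + \<eta>) + \<gamma> \<le> \<gamma>0" by (rule 2)
    qed (use l0 g \<sigma> gb b in auto)
  qed
  ultimately show ?thesis using that by blast
qed

context diffusive_path
begin

lemma windows:
  assumes par: "window_params lam \<beta> w \<gamma>0 \<eta>" and w: "0 \<le> w"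
    and thr: "\<And>k. (\<forall>q. thr k q) \<or> (\<forall>q. thr k q \<longleftrightarrow> real q \<le> \<beta> k * sq)"
    and st: "0 \<le> s" "s \<le> t" "t \<le> T" "real n * (t - s) \<le> w * sq"
  shows "\<bar>real (Q k t) - real (Q k s)\<bar> \<le> \<gamma>0 * sq"
    and "\<bar>real (B k t) - real (B k s) - lam k * (real n * (t - s))\<bar> \<le> \<gamma>0 * sq"
proof -
  let ?c = "real CARD('c)"
  obtain l0 g \<sigma> \<gamma> where p: "collapse_params l0 g \<sigma>" "\<And>k. ?c\<^sup>2 * g < \<beta> k" "g \<le> \<gamma>" "2 * ?c * (?c\<^sup>2 * g) \<le> \<gamma>"
    "(2 * ?c + 1) * \<eta> * (1 + \<sigma>) \<le> l0 * \<sigma>"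
    "\<eta> * (1 + w) + 3 * (2 * ?c * \<eta> * (1 + w) + 2 * \<gamma> + ?c * \<eta> + \<eta>) + \<gamma> \<le> \<gamma>0"
    using par unfolding window_params_def collapse_params_def by blast
  define V where "V = 2 * ?c * \<eta> * (1 + w) + 2 * \<gamma> + ?c * \<eta> + \<eta>"
  have g0: "0 < g" using p(1) by (simp add: collapse_params_def)
  have V: "0 \<le> V" "0 \<le> \<eta> * (1 + w)" "0 \<le> \<gamma>" unfolding V_def using eta w p(3) g0 by auto
  have b: "total R t - total R s \<le> V * sq" "\<bar>real (Q k t) - real (Q k s)\<bar> \<le> (2 * V + \<gamma>) * sq" for k
  proof -
    have thr': "(\<forall>q. thr k q) \<or> (?c\<^sup>2 * g < \<beta> k \<and> (\<forall>q. thr k q \<longleftrightarrow> real q \<le> \<beta> k * sq))" for k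
      using thr[of k] p(2)[of k] by simp
    note bounds = window_bounds[where \<beta>=\<beta> and g=g and \<gamma>=\<gamma> and w=w and V=V and s=s and t=t,
        OF p(1) thr' p(3,4,5) st w V_def]
    show "total R t - total R s \<le> V * sq" by (rule bounds(1))
    show "\<bar>real (Q k t) - real (Q k s)\<bar> \<le> (2 * V + \<gamma>) * sq" for k by (rule bounds(2))
  qed
  have le: "\<eta> * (1 + w) + V + (2 * V + \<gamma>) \<le> \<gamma>0" using p(6)[folded V_def] by simp
  have mono: "x * sq \<le> \<gamma>0 * sq" if "x \<le> \<gamma>0" for x using that sq(1) by (intro mult_right_mono) auto
  show "\<bar>real (Q k t) - real (Q k s)\<bar> \<le> \<gamma>0 * sq"
    using b(2)[of k] mono[of "2 * V + \<gamma>"] le V by linarith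
  show "\<bar>real (B k t) - real (B k s) - lam k * (real n * (t - s))\<bar> \<le> \<gamma>0 * sq"
    using routed_near[OF st b(1) b(2)[of k]] mono[OF le] by linarith
qed

text \<open>Decisions look at the queue just before the arrival, waiting times at the queue just
  after it. A time u shortly before v makes the window estimates available for the former; the
  arrivals at v itself add at most \<open>\<eta> * sqrt n\<close> to the latter.\<close>

lemma left_limit_nearby:
  assumes v: "0 < v" "v \<le> T" and w: "0 < w"
  obtains u where "0 \<le> u" "u < v" "real n * (v - u) \<le> w * sq" "\<And>i. left_lim (Q i) v = Q i u"
    "\<And>i. real (Q i v) \<le> real (Q i u) + \<eta> * sq"
proof -
  obtain s where s: "0 \<le> s" "s < v"
    and const: "\<And>i u. s \<le> u \<Longrightarrow> u < v \<Longrightarrow> E i u = E i s \<and> B i u = B i s \<and> Q i u = Q i s \<and> R i u = R i s"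
    and lim: "\<And>i u. s \<le> u \<Longrightarrow> u < v \<Longrightarrow> left_lim (Q i) v = Q i u"
    by (rule left_const[OF v(1)], rule that)
  have sq0: "0 < sq" using sq(1) by linarith
  define u where "u = max s (v - w / sq)"
  have u: "s \<le> u" "u < v" "v - u \<le> w / sq" using s w sq0 by (auto simp: u_def)
  have "real n * (v - u) \<le> real n * (w / sq)" using u(3) by (intro mult_left_mono) auto
  also have "\<dots> = w * sq" using sq0 sq(3) by (simp add: field_simps)
  finally have nw: "real n * (v - u) \<le> w * sq" .
  have "real (Q i v) \<le> real (Q i u) + \<eta> * sq" for i
  proof -
    have eq: "E i x = E i u" if "u \<le> x" "x < v" for x using const[of x i] const[of u i] that u by linarith
    have u0: "0 \<le> u" using s u by simp
    have "real (E i v) - real (E i u) \<le> \<eta> * sq" by (rule E_jump[OF u0 u(2) v(2) eq])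
    then show ?thesis
      using queue_real[of v i] queue_real[of u i] B_le[of u v i] reneged_le[of u v \<delta> i] s u v by simp
  qed
  then show ?thesis using that[of u] s u nw lim[OF u(1,2)] by auto
qed

text \<open>At least \<open>(lam i * x - \<gamma>0) * sqrt n\<close> customers are routed within
  time \<open>x / sqrt n\<close>, which covers the queue after the arrival, at most
  \<open>(\<beta> i + \<eta>) * sqrt n\<close>.\<close>

lemma wait_upper:
  assumes par: "window_params lam \<beta> w \<gamma>0 \<eta>"
    and thr: "\<And>k. (\<forall>q. thr k q) \<or> (\<forall>q. thr k q \<longleftrightarrow> real q \<le> \<beta> k * sq)"
    and v: "0 < v" "v + w \<le> T" and JT: "joining_time J v = ereal v"
    and x: "0 < x" "x \<le> w" and q: "real (left_lim (Q i) v) \<le> \<beta> i * sq" and room: "\<beta> i + \<eta> + \<gamma>0 \<le> lam i * x"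
  obtains y where "waiting_time J (B i) (Q i) v = ereal y" "0 \<le> y" "y \<le> x / sq"
proof -
  have sq0: "0 < sq" using sq(1) by linarith
  have nx: "real n * (x / sq) = x * sq" using sq0 sq(3) by (simp add: field_simps)
  have vT: "v \<le> T" using v x by simp
  obtain u where "0 \<le> u" "u < v" "real n * (v - u) \<le> 1 * sq"
    and u: "\<And>i. left_lim (Q i) v = Q i u" "\<And>i. real (Q i v) \<le> real (Q i u) + \<eta> * sq"
    by (rule left_limit_nearby[OF v(1) vT zero_less_one], rule that)
  have xs: "x / sq \<le> x" using sq(1) x divide_left_mono[of 1 sq x] by simp
  have xw: "x * sq \<le> w * sq" using x sq0 by (intro mult_right_mono) auto
  have d: "real n * (v + x / sq - v) = x * sq" using nx by simp
  have "\<bar>real (B i (v + x / sq)) - real (B i v) - lam i * (real n * (v + x / sq - v))\<bar> \<le> \<gamma>0 * sq"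
    by (rule windows(2)[OF par _ thr]) (use v x xs sq0 xw d in auto)
  then have "lam i * (x * sq) - \<gamma>0 * sq \<le> real (B i (v + x / sq)) - real (B i v)"
    unfolding d by linarith
  moreover have "(\<beta> i + \<eta> + \<gamma>0) * sq \<le> lam i * x * sq" using room sq0 by (intro mult_right_mono) auto
  ultimately have "real (B i v) + real (Q i v) \<le> real (B i (v + x / sq))"
    using u(2)[of i] q unfolding u(1) by (simp add: algebra_simps)
  then have "B i v + Q i v \<le> B i (v + x / sq)" by linarith
  then show ?thesis
    using waiting_time_le[OF JT, of "x / sq" "B i" "Q i"] x sq0 that by auto
qed

text \<open>One \<gamma>0 in the hypothesis on x is for the change of the queue at the arrival, the
  other for the routing error.\<close>

lemma wait_lower:
  assumes par: "window_params lam \<beta> w \<gamma>0 \<eta>"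
    and thr: "\<And>k. (\<forall>q. thr k q) \<or> (\<forall>q. thr k q \<longleftrightarrow> real q \<le> \<beta> k * sq)"
    and v: "0 < v" "v + w \<le> T" and JT: "joining_time J v = ereal v"
    and x: "0 < x" "x \<le> w" and q: "\<beta> i * sq < real (left_lim (Q i) v)" and room: "lam i * x + 2 * \<gamma>0 \<le> \<beta> i"
  shows "ereal (x / sq) \<le> waiting_time J (B i) (Q i) v"
proof (rule waiting_time_ge[OF JT])
  have sq0: "0 < sq" using sq(1) by linarith
  have nx: "real n * (x / sq) = x * sq" using sq0 sq(3) by (simp add: field_simps)
  have w0: "0 < w" "v \<le> T" using x v by auto
  obtain u where u: "0 \<le> u" "u < v" "real n * (v - u) \<le> w * sq" "\<And>i. left_lim (Q i) v = Q i u"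
    and "\<And>i. real (Q i v) \<le> real (Q i u) + \<eta> * sq"
    by (rule left_limit_nearby[OF v(1) w0(2,1)], rule that)
  have Qv: "real (Q i u) - \<gamma>0 * sq \<le> real (Q i v)"
  proof -
    have "\<bar>real (Q i v) - real (Q i u)\<bar> \<le> \<gamma>0 * sq"
      by (rule windows(1)[OF par _ thr u(1) _ _ u(3)]) (use u(2) w0 in auto)
    then show ?thesis by linarith
  qed
  fix s assume s: "v < s" "s < v + x / sq"
  have xs: "x / sq \<le> x" using sq(1) x divide_left_mono[of 1 sq x] by simp
  have ns: "real n * (s - v) \<le> x * sq" using mult_left_mono[of "s - v" "x / sq" "real n"] s nx by simp
  have xw: "x * sq \<le> w * sq" using x sq0 by (intro mult_right_mono) auto
  have "real (B i s) - real (B i v) \<le> lam i * (real n * (s - v)) + \<gamma>0 * sq"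
  proof -
    have "\<bar>real (B i s) - real (B i v) - lam i * (real n * (s - v))\<bar> \<le> \<gamma>0 * sq"
      by (rule windows(2)[OF par _ thr]) (use v x xs s ns xw in auto)
    then show ?thesis by linarith
  qed
  also have "\<dots> \<le> lam i * (x * sq) + \<gamma>0 * sq" using ns lam[of i] by (intro add_right_mono mult_left_mono) auto
  finally have "real (B i s) - real (B i v) \<le> lam i * (x * sq) + \<gamma>0 * sq" .
  moreover have "(lam i * x + 2 * \<gamma>0) * sq \<le> \<beta> i * sq" using room sq0 by (intro mult_right_mono) auto
  ultimately have "real (B i s) < real (B i v) + real (Q i v)" using Qv q unfolding u(4) by (simp add: algebra_simps)
  then show "B i s < B i v + Q i v" by linarith
qed

end

text \<open>Departures are known with K times the original error; the other bounds are relaxed to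
  \<open>K * \<eta>\<close> as well, so that the second stage works with a single constant.\<close>

lemma (in fluid_path) diffusive:
  assumes K: "K = 1 + sum mu UNIV * (32 * real CARD('c) * (1 + T) * exp (6 * sum mu UNIV * T))" and \<eta>': "K * \<eta> \<le> 1"
  shows "diffusive_path E pol n q0 \<psi>0 S \<delta> X thr dev lam (K * \<eta>) T"
proof -
  have "0 \<le> sum mu UNIV" using mu by (intro sum_nonneg) (auto intro: less_imp_le)
  then have "0 \<le> sum mu UNIV * (32 * real CARD('c) * (1 + T) * exp (6 * sum mu UNIV * T))"
    using T by (intro mult_nonneg_nonneg) auto
  then have K1: "1 \<le> K" unfolding K by linarith
  have le: "\<eta> * y \<le> K * \<eta> * y" if "0 \<le> y" for y
    using mult_right_mono[OF K1, of "\<eta> * y"] eta that by (simp add: mult.assoc)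
  show ?thesis
  proof unfold_locales
    show "0 < K * \<eta>" using K1 eta by simp
    show "1 \<le> K * \<eta> * sqrt (real n)" using le[of sq] n(2) by simp
    fix i s t assume st: "0 \<le> s" "s \<le> t" "t \<le> T"
    show "\<bar>real (E i t) - real (E i s) - real n * lam i * (t - s)\<bar> \<le> K * \<eta> * (sqrt (real n) + real n * (t - s))"
      using E_near[OF st, of i] le[of "sq + real n * (t - s)"] st by simp
    show "\<bar>real (D i t) - real (D i s) - real n * lam i * (t - s)\<bar> \<le> K * \<eta> * (sqrt (real n) + real n * (t - s))"
      using D_near[OF st K] .
  next
    show "real (q0 i) \<le> K * \<eta> * sqrt (real n)" for i using q0_small[of i] le[of sq] by simp
  qed (use \<eta>' lam n T in auto)
qed

section \<open>Best responses\<close>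

text \<open>A function h that never exceeds r belongs to a class that always joins; otherwise the
  intermediate value theorem yields the threshold.\<close>

lemma threshold_exists:
  fixes h :: "real \<Rightarrow> real"
  assumes cont: "continuous_on {0..} h" and mono: "strict_mono_on {0..} h" and zero: "h 0 = 0" and r: "0 < r"
  obtains "\<And>x. 0 \<le> x \<Longrightarrow> h x \<le> r"
  | \<theta> where "0 < \<theta>" "h \<theta> = r" "\<And>x. 0 \<le> x \<Longrightarrow> h x \<le> r \<longleftrightarrow> x \<le> \<theta>"
proof (cases "\<forall>x\<ge>0. h x \<le> r")
  case False
  then obtain x where x: "0 \<le> x" "r < h x" by (auto simp: not_le)
  have "\<exists>\<theta>. 0 \<le> \<theta> \<and> \<theta> \<le> x \<and> h \<theta> = r"
    using x zero r by (intro IVT' continuous_on_subset[OF cont]) auto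
  then obtain \<theta> where \<theta>: "0 \<le> \<theta>" "h \<theta> = r" by blast
  have "0 < \<theta>" using \<theta> zero r by (cases "\<theta> = 0") auto
  moreover have "h y \<le> r \<longleftrightarrow> y \<le> \<theta>" if "0 \<le> y" for y
    using strict_mono_on_leD[OF mono, of y \<theta>] strict_mono_onD[OF mono, of \<theta> y] \<theta> that
    by (metis atLeast_iff linorder_not_le)
  ultimately show ?thesis using that(2) \<theta> by blast
qed (use that in blast)

lemma threshold_slack:
  fixes h :: "real \<Rightarrow> real"
  assumes cont: "continuous_on {0..} h" and \<theta>: "0 < \<theta>" and eps: "0 < \<epsilon>"
  obtains d where "0 < d" "\<And>x. \<bar>x - \<theta>\<bar> < d \<Longrightarrow> \<bar>h x - h \<theta>\<bar> < \<epsilon>"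
proof -
  have "continuous_on {0<..} h" by (rule continuous_on_subset[OF cont]) auto
  then have "isCont h \<theta>" using \<theta> by (simp add: continuous_on_eq_continuous_at)
  then show ?thesis using that eps unfolding isCont_def LIM_eq by (metis abs_zero real_norm_def right_minus_eq)
qed

lemma left_lim_agree:
  assumes "queueing_path E pol n q0 \<psi>0 S \<delta> X" "queueing_path E pol n q0 \<psi>0 S \<delta>' X'"
    and a: "0 < a" "\<And>u. 0 \<le> u \<Longrightarrow> u < a \<Longrightarrow> agree X X' u"
  shows "left_lim (queue X k) a = left_lim (queue X' k) a"
proof -
  interpret X: queueing_path E pol n q0 \<psi>0 S \<delta> X by fact
  interpret X': queueing_path E pol n q0 \<psi>0 S \<delta>' X' by fact
  obtain s where s: "0 \<le> s" "s < a"
    and "\<And>i u. s \<le> u \<Longrightarrow> u < a \<Longrightarrow> E i u = E i s \<and> X.B i u = X.B i s \<and> X.Q i u = X.Q i s \<and> X.R i u = X.R i s"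
    and lim: "\<And>i u. s \<le> u \<Longrightarrow> u < a \<Longrightarrow> left_lim (X.Q i) a = X.Q i u"
    by (rule X.left_const[OF a(1)], rule that)
  obtain s' where s': "0 \<le> s'" "s' < a"
    and "\<And>i u. s' \<le> u \<Longrightarrow> u < a \<Longrightarrow> E i u = E i s' \<and> X'.B i u = X'.B i s' \<and> X'.Q i u = X'.Q i s' \<and> X'.R i u = X'.R i s'"
    and lim': "\<And>i u. s' \<le> u \<Longrightarrow> u < a \<Longrightarrow> left_lim (X'.Q i) a = X'.Q i u"
    by (rule X'.left_const[OF a(1)], rule that)
  define u where "u = max s s'"
  have u: "s \<le> u" "s' \<le> u" "u < a" "0 \<le> u" using s s' by (auto simp: u_def)
  have "X.Q k u = X'.Q k u" using a(2)[OF u(4,3)] by (simp add: agree_def)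
  then show ?thesis using lim[OF u(1,3), of k] lim'[OF u(2,3), of k] by simp
qed

text \<open>If rule and deviation lead to the same decision, the costs are equal. Otherwise one of
  the two costs is \<open>r i\<close>, and the cost of joining is at most \<epsilon> on the wrong
  side of \<open>r i\<close>. When the rule refuses, the waiting time to be bounded arises in the
  system with the deviation; hence \<open>diff\<close> covers every path with at most one deviating
  customer.\<close>

lemma best_response:
  fixes E :: "'c::{finite,linorder} counts"
  assumes E: "arrival_path E"
    and n: "1 \<le> n"
    and h_mono: "\<And>k. strict_mono_on {0..} (h k)" and h_zero: "\<And>k. h k 0 = 0" and r: "\<And>k. 0 < r k"
    and lam: "\<And>k. 0 < lam k"
    and X: "played pol n q0 \<psi>0 E S (threshold_profile h r lam n) X"
    and X': "played pol n q0 \<psi>0 E S (deviate (threshold_profile h r lam n) i j \<tau>) X'"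
    and diff: "\<And>Y \<delta>. game_path E pol n q0 \<psi>0 S \<delta> Y (\<lambda>k. threshold_profile h r lam n k 0) (i, j) \<Longrightarrow>
        diffusive_path E pol n q0 \<psi>0 S \<delta> Y (\<lambda>k. threshold_profile h r lam n k 0) (i, j) lam \<eta> T"
    and par: "window_params lam (\<lambda>k. lam k * \<theta> k) w \<kappa> \<eta>"
    and \<theta>: "\<And>k. (\<forall>x\<ge>0. h k x \<le> r k) \<or> (h k (\<theta> k) = r k \<and> (\<forall>x\<ge>0. h k x \<le> r k \<longleftrightarrow> x \<le> \<theta> k) \<and>
        h k (\<theta> k + d) \<le> r k + \<epsilon> \<and> r k - \<epsilon> \<le> h k (\<theta> k - d))"
    and d: "0 < d" "\<And>k. d < \<theta> k" "\<And>k. \<theta> k + d \<le> w" and \<kappa>: "\<eta> \<le> \<kappa>" "\<And>k. 2 * \<kappa> \<le> lam k * d"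
    and T: "Tbar + w \<le> T" and j: "1 \<le> j" and eps: "0 < \<epsilon>"
  shows "cost h r Tbar n E (threshold_profile h r lam n) X i j
    \<le> cost h r Tbar n E (deviate (threshold_profile h r lam n) i j \<tau>) X' i j + ereal \<epsilon>"
proof -
  define \<sigma> where "\<sigma> = threshold_profile h r lam n"
  define \<sigma>' where "\<sigma>' = deviate \<sigma> i j \<tau>"
  \<comment> \<open>The customer number 0 is a placeholder, as the rule depends on the class
    only.\<close>
  define thr where "thr k = \<sigma> k 0" for k
  define \<delta> where "\<delta> = decisions E X \<sigma>"
  define \<delta>' where "\<delta>' = decisions E X' \<sigma>'"
  have \<sigma>: "\<sigma> k l = thr k" for k l by (simp add: thr_def \<sigma>_def threshold_profile_def fun_eq_iff)
  have \<sigma>'_other: "\<sigma>' k l = thr k" if "(k, l) \<noteq> (i, j)" for k l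
    using that by (auto simp: \<sigma>'_def deviate_def \<sigma>)
  have \<sigma>'_dev: "\<sigma>' i j = \<tau>" by (simp add: \<sigma>'_def deviate_def)
  interpret arrival_path E by (rule E)
  have qp: "queueing_path E pol n q0 \<psi>0 S \<delta> X"
    using X by unfold_locales (simp add: played_def \<delta>_def \<sigma>_def)
  have qp': "queueing_path E pol n q0 \<psi>0 S \<delta>' X'"
    using X' by unfold_locales (simp add: played_def \<delta>'_def \<sigma>'_def \<sigma>_def)
  interpret X: queueing_path E pol n q0 \<psi>0 S \<delta> X by (rule qp)
  interpret X': queueing_path E pol n q0 \<psi>0 S \<delta>' X' by (rule qp')
  have thr0: "thr k 0" for k using r[of k] by (simp add: thr_def \<sigma>_def threshold_profile_def h_zero less_imp_le)
  have thr_eq: "(\<lambda>k. threshold_profile h r lam n k 0) = thr" by (simp add: thr_def \<sigma>_def fun_eq_iff)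
  have gp: "game_path E pol n q0 \<psi>0 S \<delta> X thr (i, j)"
    using thr0 by unfold_locales (simp_all add: \<delta>_def decisions_def \<sigma>)
  have gp': "game_path E pol n q0 \<psi>0 S \<delta>' X' thr (i, j)"
    using thr0 by unfold_locales (simp_all add: \<delta>'_def decisions_def \<sigma>'_other)
  interpret G: diffusive_path E pol n q0 \<psi>0 S \<delta> X thr "(i, j)" lam \<eta> T
    using diff[of \<delta> X] gp unfolding thr_eq by blast
  interpret G': diffusive_path E pol n q0 \<psi>0 S \<delta>' X' thr "(i, j)" lam \<eta> T
    using diff[of \<delta>' X'] gp' unfolding thr_eq by blast
  have sq0: "0 < sqrt (real n)" using n by simp
  have thr_iff: "(\<forall>q. thr k q) \<or> (\<forall>q. thr k q \<longleftrightarrow> real q \<le> lam k * \<theta> k * sqrt (real n))" for k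
  proof -
    have arg: "0 \<le> real q / (sqrt (real n) * lam k)" for q using lam[of k] by simp
    have "real q / (sqrt (real n) * lam k) \<le> \<theta> k \<longleftrightarrow> real q \<le> lam k * \<theta> k * sqrt (real n)" for q
      using sq0 lam[of k] by (simp add: pos_divide_le_eq algebra_simps)
    then show ?thesis using \<theta>[of k] arg unfolding thr_def \<sigma>_def threshold_profile_def by meson
  qed
  show ?thesis
  proof (cases "arrival_time E i j \<le> ereal Tbar")
    case False
    then show ?thesis using eps by (simp add: cost_def Let_def)
  next
    case True
    have "{t. 0 \<le> t \<and> j \<le> E i t} \<noteq> {}"
    proof
      assume "{t. 0 \<le> t \<and> j \<le> E i t} = {}"
      then have "arrival_time E i j = \<infinity>" unfolding arrival_time_def by (simp only: image_empty Inf_empty top_ereal_def)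
      then show False using True by simp
    qed
    then obtain t where t: "0 \<le> t" "j \<le> E i t" by blast
    obtain v where v: "arrival_time E i j = ereal v" "0 < v" "v \<le> t" "j \<le> E i v"
      "\<And>u. 0 \<le> u \<Longrightarrow> u < v \<Longrightarrow> E i u < j"
      by (rule arrival_timeE[OF j t], rule that)
    have vT: "v \<le> Tbar" using True v by simp
    have same: "\<delta> k l = \<delta>' k l" if kl: "(k, l) \<noteq> (i, j)" "0 \<le> u" "1 \<le> l" "l \<le> E k u"
      and ag: "\<forall>x\<in>{0..<u}. agree X X' x" for k l u
    proof -
      obtain a where a: "arrival_time E k l = ereal a" "0 < a" "a \<le> u"
        by (rule arrival_timeE[OF kl(3,2,4)], rule that)
      have "left_lim (X.Q k) a = left_lim (X'.Q k) a"
        by (rule left_lim_agree[OF qp qp' a(2)]) (use ag a in auto)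
      then show ?thesis using kl(1) a by (simp add: \<delta>_def \<delta>'_def decisions_def \<sigma> \<sigma>'_other)
    qed
    have before: "agree X X' u" if "0 \<le> u" "u < v" for u
    proof (rule dynamics_unique[OF qp qp', of "ereal v"])
      fix x k l assume x: "0 \<le> x" "ereal x < ereal v" "\<forall>y\<in>{0..<x}. agree X X' y" "1 \<le> l" "l \<le> E k x"
      have "(k, l) \<noteq> (i, j)" using v(5)[of x] x by auto
      then show "\<delta> k l = \<delta>' k l" using same x by blast
    qed (use that in auto)
    define q where "q = left_lim (X.Q i) v"
    have q': "left_lim (X'.Q i) v = q"
      unfolding q_def using left_lim_agree[OF qp qp' v(2) before] by simp
    have dec: "\<delta> i j = thr i q" "\<delta>' i j = \<tau> q"
      using v q' by (simp_all add: \<delta>_def \<delta>'_def decisions_def \<sigma> \<sigma>'_dev q_def)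
    let ?WT = "waiting_time (joined E \<delta> i) (X.B i) (X.Q i) v"
    let ?WT' = "waiting_time (joined E \<delta>' i) (X'.B i) (X'.Q i) v"
    have C: "cost h r Tbar n E \<sigma> X i j = (if \<delta> i j then extend_infinity (h i) (ereal (sqrt (real n)) * ?WT) else ereal (r i))"
      using True v by (simp add: cost_def Let_def \<delta>_def)
    have C': "cost h r Tbar n E \<sigma>' X' i j = (if \<delta>' i j then extend_infinity (h i) (ereal (sqrt (real n)) * ?WT') else ereal (r i))"
      using True v by (simp add: cost_def Let_def \<delta>'_def)
    have add_eps: "x \<le> x + ereal \<epsilon>" for x :: ereal using eps by (simp add: ereal_le_add_self)
    have "cost h r Tbar n E \<sigma> X i j \<le> cost h r Tbar n E \<sigma>' X' i j + ereal \<epsilon>"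
    proof (cases "\<delta> i j = \<delta>' i j")
      case eq: True
      have "cost h r Tbar n E \<sigma> X i j = cost h r Tbar n E \<sigma>' X' i j"
      proof (cases "\<delta> i j")
        case True
        \<comment> \<open>With equal decisions of customer \<open>(i, j)\<close> the two systems
          never separate, so the time horizon is infinite here.\<close>
        have all: "agree X X' u" if "0 \<le> u" for u
        proof (rule dynamics_unique[OF qp qp', of \<infinity>])
          fix x k l assume x: "0 \<le> x" "\<forall>y\<in>{0..<x}. agree X X' y" "1 \<le> l" "l \<le> E k x"
          show "\<delta> k l = \<delta>' k l" using same[OF _ x(1,3,4,2)] eq by (cases "(k, l) = (i, j)") auto
        qed (use that in auto)
        have JT: "joining_time (joined E \<delta> i) v = ereal v" "joining_time (joined E \<delta>' i) v = ereal v"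
          using X.joining_time_at_arrival[OF v(2,4,5)] X'.joining_time_at_arrival[OF v(2,4,5)] True eq by auto
        have "{s. v < s \<and> X.B i v + X.Q i v \<le> X.B i s} = {s. v < s \<and> X'.B i v + X'.Q i v \<le> X'.B i s}"
          using all v(2) by (auto simp: agree_def)
        then have "?WT = ?WT'" by (simp add: waiting_time_def routing_time_def JT)
        then show ?thesis unfolding C C' using eq by simp
      next
        case False
        then show ?thesis unfolding C C' using eq by simp
      qed
      then show ?thesis using add_eps by simp
    next
      case ne: False
      show ?thesis
      proof (cases "\<delta> i j")
        case True
        then have c': "cost h r Tbar n E \<sigma>' X' i j = ereal (r i)" unfolding C' using ne by simp
        have JT: "joining_time (joined E \<delta> i) v = ereal v" by (rule X.joining_time_at_arrival[OF v(2,4,5) True])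
        from \<theta>[of i] show ?thesis
        proof
          assume le: "\<forall>x\<ge>0. h i x \<le> r i"
          \<comment> \<open>If h never exceeds r, joining costs at most r even with an infinite
            waiting time, whose cost is a supremum of values of h.\<close>
          have WT0: "ereal 0 \<le> ?WT" by (rule X.waiting_time_ge[OF JT]) simp
          have "extend_infinity (h i) (ereal (sqrt (real n)) * ?WT) \<le> ereal (r i)"
          proof (cases ?WT)
            case (real y)
            then show ?thesis using WT0 le by (simp add: extend_infinity_def)
          next
            case PInf
            have "(SUP y\<in>{0..}. ereal (h i y)) \<le> ereal (r i)" using le by (intro SUP_least) auto
            then show ?thesis using PInf sq0 by (simp add: extend_infinity_def)
          qed (use WT0 in auto)
          then show ?thesis unfolding C c' using True add_eps order_trans by fastforce
        next
          assume th: "h i (\<theta> i) = r i \<and> (\<forall>x\<ge>0. h i x \<le> r i \<longleftrightarrow> x \<le> \<theta> i) \<and>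
            h i (\<theta> i + d) \<le> r i + \<epsilon> \<and> r i - \<epsilon> \<le> h i (\<theta> i - d)"
          have arg: "0 \<le> real q / (sqrt (real n) * lam i)" using lam[of i] by simp
          have "real q / (sqrt (real n) * lam i) \<le> \<theta> i"
            using True arg th unfolding dec thr_def \<sigma>_def threshold_profile_def by blast
          then have qle: "real q \<le> lam i * \<theta> i * sqrt (real n)"
            using sq0 lam[of i] by (simp add: pos_divide_le_eq algebra_simps)
          obtain y where y: "?WT = ereal y" "0 \<le> y" "y \<le> (\<theta> i + d) / sqrt (real n)"
          proof (rule G.wait_upper[OF par thr_iff v(2) _ JT])
            show "v + w \<le> T" using vT T by simp
            show "real (left_lim (X.Q i) v) \<le> lam i * \<theta> i * sqrt (real n)" using qle by (simp add: q_def)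
            show "0 < \<theta> i + d" "\<theta> i + d \<le> w" using d(1) d(2)[of i] d(3)[of i] by auto
            have "0 < lam i * d" using lam[of i] d by simp
            then show "lam i * \<theta> i + \<eta> + \<kappa> \<le> lam i * (\<theta> i + d)"
              using \<kappa>(1) \<kappa>(2)[of i] by (simp add: distrib_left)
          qed
          have "extend_infinity (h i) (ereal (sqrt (real n)) * ?WT) \<le> ereal (h i (sqrt (real n) * ((\<theta> i + d) / sqrt (real n))))"
            by (rule extend_infinity_le[OF h_mono y]) simp
          also have "sqrt (real n) * ((\<theta> i + d) / sqrt (real n)) = \<theta> i + d" using sq0 by simp
          also have "ereal (h i (\<theta> i + d)) \<le> ereal (r i) + ereal \<epsilon>" using th by simp
          finally show ?thesis unfolding C c' using True by simp
        qed
      next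
        case False
        then have J': "\<delta>' i j" using ne by simp
        have JT: "joining_time (joined E \<delta>' i) v = ereal v" by (rule X'.joining_time_at_arrival[OF v(2,4,5) J'])
        have arg: "0 \<le> real q / (sqrt (real n) * lam i)" using lam[of i] by simp
        have nle: "\<not> h i (real q / (sqrt (real n) * lam i)) \<le> r i"
          using False unfolding dec thr_def \<sigma>_def threshold_profile_def .
        then have th: "\<forall>x\<ge>0. h i x \<le> r i \<longleftrightarrow> x \<le> \<theta> i" "r i - \<epsilon> \<le> h i (\<theta> i - d)"
          using \<theta>[of i] arg by blast+
        have "\<theta> i < real q / (sqrt (real n) * lam i)" using nle th(1) arg by force
        then have qgt: "lam i * \<theta> i * sqrt (real n) < real q"
          using sq0 lam[of i] by (simp add: pos_less_divide_eq algebra_simps)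
        have "ereal ((\<theta> i - d) / sqrt (real n)) \<le> ?WT'"
        proof (rule G'.wait_lower[OF par thr_iff v(2) _ JT])
          show "v + w \<le> T" using vT T by simp
          show "lam i * \<theta> i * sqrt (real n) < real (left_lim (X'.Q i) v)" using qgt q' by simp
          show "0 < \<theta> i - d" "\<theta> i - d \<le> w" using d(1) d(2)[of i] d(3)[of i] by auto
          show "lam i * (\<theta> i - d) + 2 * \<kappa> \<le> lam i * \<theta> i" using \<kappa>(2)[of i] by (simp add: right_diff_distrib)
        qed
        then have "ereal (h i (sqrt (real n) * ((\<theta> i - d) / sqrt (real n)))) \<le> extend_infinity (h i) (ereal (sqrt (real n)) * ?WT')"
          using d(2)[of i] sq0 by (intro extend_infinity_ge h_mono) auto
        then have "ereal (h i (\<theta> i - d)) \<le> cost h r Tbar n E \<sigma>' X' i j" unfolding C' using J' sq0 by simp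
        then have "ereal (r i - \<epsilon>) \<le> cost h r Tbar n E \<sigma>' X' i j" using th(2) by (meson ereal_less_eq(3) order_trans)
        then have "ereal (r i - \<epsilon>) + ereal \<epsilon> \<le> cost h r Tbar n E \<sigma>' X' i j + ereal \<epsilon>" by (rule add_right_mono)
        then show ?thesis unfolding C using False by simp
      qed
    qed
    then show ?thesis by (simp add: \<sigma>_def \<sigma>'_def)
  qed
qed

section \<open>Choice of the constants and of the event\<close>

lemma (in prob_space) indep_vars_section:
  assumes "indep_vars (\<lambda>_. N) (\<lambda>(i, k). X i k) (UNIV \<times> K)"
  shows "indep_vars (\<lambda>_. N) (X i) K"
proof -
  have rv: "random_variable N (X i k)" if "k \<in> K" for k
    using assms that by (auto simp: indep_vars_def)
  have ind: "indep_sets (\<lambda>(i, k). {X i k -` A \<inter> space M | A. A \<in> sets N}) (UNIV \<times> K)"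
    using assms unfolding indep_vars_def2 by (simp add: case_prod_unfold)
  have "indep_sets (\<lambda>k. {X i k -` A \<inter> space M | A. A \<in> sets N}) K"
  proof (rule indep_setsI)
    show "{X i k -` A \<inter> space M | A. A \<in> sets N} \<subseteq> events" if "k \<in> K" for k
      using rv[OF that] by (auto simp: measurable_sets)
    fix A J assume J: "J \<noteq> {}" "J \<subseteq> K" "finite J" "\<forall>j\<in>J. A j \<in> {X i j -` B \<inter> space M | B. B \<in> sets N}"
    have "prob (\<Inter>p\<in>Pair i ` J. A (snd p)) = (\<Prod>p\<in>Pair i ` J. prob (A (snd p)))"
      by (rule indep_setsD[OF ind]) (use J in auto)
    then show "prob (\<Inter> (A ` J)) = (\<Prod>j\<in>J. prob (A j))"
      by (simp add: prod.reindex inj_on_def image_image)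
  qed
  then show ?thesis using rv unfolding indep_vars_def2 by auto
qed

text \<open>The corrections of order \<open>sqrt n\<close> to the arrival rates are harmless: over
  windows of length of order \<open>1 / sqrt n\<close> they change the counts by a bounded number
  only.\<close>

lemma rates_near:
  fixes lamn :: "nat \<Rightarrow> real"
  assumes "(\<lambda>n. lamn n - (real n * lam + sqrt (real n) * lamhat)) \<in> o(\<lambda>n. sqrt (real n))" and eta: "0 < \<eta>"
  shows "\<forall>\<^sub>F n in sequentially. \<bar>lamn n - real n * lam\<bar> \<le> \<eta> * real n"
proof -
  have "\<forall>\<^sub>F n in sequentially. \<bar>lamn n - (real n * lam + sqrt (real n) * lamhat)\<bar> \<le> 1 * \<bar>sqrt (real n)\<bar>"
    using landau_o.smallD[OF assms(1), of 1] by simp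
  moreover have "filterlim (\<lambda>n. \<eta> * sqrt (real n)) at_top sequentially" using eta by real_asymp
  then have "\<forall>\<^sub>F n in sequentially. 1 + \<bar>lamhat\<bar> \<le> \<eta> * sqrt (real n)" unfolding filterlim_at_top by blast
  ultimately show ?thesis
  proof eventually_elim
    case (elim n)
    have "\<bar>lamn n - real n * lam\<bar> \<le> sqrt (real n) + \<bar>sqrt (real n) * lamhat\<bar>" using elim(1) by simp
    also have "\<dots> = (1 + \<bar>lamhat\<bar>) * sqrt (real n)" by (simp add: abs_mult algebra_simps)
    also have "\<dots> \<le> \<eta> * sqrt (real n) * sqrt (real n)" using elim(2) by (intro mult_right_mono) auto
    finally show ?case by (simp only: mult.assoc real_sqrt_mult_self abs_of_nat)
  qed
qed

lemma sqrt_eventually_ge: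
  assumes "0 < (\<eta>::real)"
  shows "\<forall>\<^sub>F n in sequentially. 1 \<le> \<eta> * sqrt (real n)"
proof -
  have "filterlim (\<lambda>n. \<eta> * sqrt (real n)) at_top sequentially" using assms by real_asymp
  then show ?thesis unfolding filterlim_at_top by blast
qed

theorem theorem2p1:
  fixes M :: "'a measure"
    and L :: "'b measure"
    and lam mu lamhat r :: "'c::{finite,linorder} \<Rightarrow> real"
    and lamn :: "nat \<Rightarrow> 'c \<Rightarrow> real"
    and IA :: "'c \<Rightarrow> nat \<Rightarrow> 'a \<Rightarrow> real"
    and S :: "'c \<Rightarrow> real \<Rightarrow> 'a \<Rightarrow> nat"
    and Q0 Psi0 :: "nat \<Rightarrow> 'c \<Rightarrow> 'a \<Rightarrow> nat"
    and PsiLim :: "'b \<Rightarrow> (real, 'c) vec"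
    and h :: "'c \<Rightarrow> real \<Rightarrow> real"
    and Tbar \<epsilon> :: real
    and pol :: "'c policy"
    and X :: "nat \<Rightarrow> 'c profile \<Rightarrow> 'a \<Rightarrow> 'c paths"
  defines "E \<equiv> \<lambda>n. arrivals IA (lamn n)"
  defines "C \<equiv> \<lambda>n \<sigma> i j \<omega>. cost h r Tbar n (E n \<omega>) \<sigma> (X n \<sigma> \<omega>) i j"
  assumes M: "prob_space M" and L: "prob_space L"
    \<comment> \<open>rates\<close>
    and lam: "\<And>i. lam i > 0" and mu: "\<And>i. mu i > 0"
    and critical: "(\<Sum>i\<in>UNIV. lam i / mu i) = 1"
    and lamn_pos: "\<And>n i. n \<ge> 1 \<Longrightarrow> lamn n i > 0"
    and lamn: "\<And>i. (\<lambda>n. lamn n i - (real n * lam i + sqrt (real n) * lamhat i)) \<in> o(\<lambda>n. sqrt (real n))"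
    \<comment> \<open>inter-arrival times\<close>
    and IA_indep: "prob_space.indep_vars M (\<lambda>_. borel) (\<lambda>(i, k). IA i k) (UNIV \<times> {1..})"
    and IA_ident: "\<And>i k. k \<ge> 1 \<Longrightarrow> distr M borel (IA i k) = distr M borel (IA i 1)"
    and IA_pos: "\<And>i k. k \<ge> 1 \<Longrightarrow> AE \<omega> in M. IA i k \<omega> > 0"
    and IA_mean: "\<And>i k. k \<ge> 1 \<Longrightarrow> integrable M (IA i k) \<and> (\<integral>\<omega>. IA i k \<omega> \<partial>M) = 1"
    and IA_var: "\<And>i k. k \<ge> 1 \<Longrightarrow> integrable M (\<lambda>\<omega>. (IA i k \<omega>)\<^sup>2)"
    \<comment> \<open>service processes\<close>
    and S: "\<And>i. poisson_process M (mu i) (S i)"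
    and S_indep: "prob_space.indep_sets M (\<lambda>i. generated_sigma M {0..} (S i)) UNIV"
    \<comment> \<open>initial conditions\<close>
    and Q0: "\<And>n i. n \<ge> 1 \<Longrightarrow> Q0 n i \<in> measurable M (count_space UNIV)"
    and Psi0: "\<And>n i. n \<ge> 1 \<Longrightarrow> Psi0 n i \<in> measurable M (count_space UNIV)"
    and Psi0_le: "\<And>n. n \<ge> 1 \<Longrightarrow> AE \<omega> in M. (\<Sum>i\<in>UNIV. Psi0 n i \<omega>) \<le> n"
    and init_nonidling: "\<And>n. n \<ge> 1 \<Longrightarrow>
      AE \<omega> in M. (\<Sum>i\<in>UNIV. Q0 n i \<omega>) > 0 \<longrightarrow> (\<Sum>i\<in>UNIV. Psi0 n i \<omega>) = n"
    and indep: "\<And>n. n \<ge> 1 \<Longrightarrow> prob_space.indep_sets M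
      ((!) [generated_sigma M (UNIV \<times> {0..}) (\<lambda>(i, t) \<omega>. E n \<omega> i t),
            generated_sigma M (UNIV \<times> {0..}) (\<lambda>(i, t). S i t),
            generated_sigma M UNIV (case_sum (Q0 n) (Psi0 n))]) {..<3}"
    and PsiLim: "PsiLim \<in> borel_measurable L"
    and PsiLim_le: "AE \<omega> in L. (\<Sum>i\<in>UNIV. PsiLim \<omega> $ i) \<le> 0"
    and init_conv: "converges_in_distribution (\<lambda>_. M)
      (\<lambda>n \<omega>. ((\<chi> i. real (Q0 n i \<omega>) / sqrt (real n)) :: (real, 'c) vec,
               (\<chi> i. (real (Psi0 n i \<omega>) - real n * (lam i / mu i)) / sqrt (real n)) :: (real, 'c) vec))
      L (\<lambda>\<omega>. (0, PsiLim \<omega>))"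
    \<comment> \<open>costs\<close>
    and Tbar: "Tbar > 0" and r: "\<And>i. r i > 0"
    and h_cont: "\<And>i. continuous_on {0..} (h i)"
    and h_mono: "\<And>i. strict_mono_on {0..} (h i)"
    and h_zero: "\<And>i. h i 0 = 0"
    \<comment> \<open>the processes that result when a profile is played\<close>
    and X_meas: "\<And>n \<sigma> i t. n \<ge> 1 \<Longrightarrow> t \<ge> 0 \<Longrightarrow>
      (\<lambda>\<omega>. queue (X n \<sigma> \<omega>) i t) \<in> measurable M (count_space UNIV) \<and>
      (\<lambda>\<omega>. in_service (X n \<sigma> \<omega>) i t) \<in> measurable M (count_space UNIV) \<and>
      (\<lambda>\<omega>. routed (X n \<sigma> \<omega>) i t) \<in> measurable M (count_space UNIV) \<and>
      (\<lambda>\<omega>. departed (X n \<sigma> \<omega>) i t) \<in> measurable M (count_space UNIV)"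
    and X_played: "AE \<omega> in M. \<forall>n\<ge>1. \<forall>\<sigma>.
      played pol n (\<lambda>i. Q0 n i \<omega>) (\<lambda>i. Psi0 n i \<omega>) (E n \<omega>) (\<lambda>i t. S i t \<omega>) \<sigma> (X n \<sigma> \<omega>)"
    and eps: "\<epsilon> > 0"
  shows "\<exists>\<Omega>hat :: nat \<Rightarrow> 'a set. (\<forall>n. \<Omega>hat n \<in> sets M) \<and>
    (\<lambda>n. measure M (\<Omega>hat n)) \<longlonglongrightarrow> 1 \<and>
    (\<forall>n\<ge>1. \<forall>\<omega>\<in>\<Omega>hat n. \<forall>i. \<forall>j\<ge>1. \<forall>\<tau>.
       C n (threshold_profile h r lam n) i j \<omega>
         \<le> C n (deviate (threshold_profile h r lam n) i j \<tau>) i j \<omega> + ereal \<epsilon>)"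
proof -
  interpret prob_space M by (rule M)
  have "\<exists>\<theta>>0. (\<forall>x\<ge>0. h k x \<le> r k) \<or> (h k \<theta> = r k \<and> (\<forall>x\<ge>0. h k x \<le> r k \<longleftrightarrow> x \<le> \<theta>))" for k
    using threshold_exists[OF h_cont h_mono h_zero r, of k] zero_less_one by metis
  then obtain \<theta> where \<theta>: "\<And>k. 0 < \<theta> k"
    "\<And>k. (\<forall>x\<ge>0. h k x \<le> r k) \<or> (h k (\<theta> k) = r k \<and> (\<forall>x\<ge>0. h k x \<le> r k \<longleftrightarrow> x \<le> \<theta> k))" by metis
  have "\<exists>d>0. \<forall>x. \<bar>x - \<theta> k\<bar> < d \<longrightarrow> \<bar>h k x - h k (\<theta> k)\<bar> < \<epsilon>" for k
    using threshold_slack[OF h_cont \<theta>(1) eps, of k] by metis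
  then obtain dd where dd: "\<And>k. 0 < dd k" "\<And>k x. \<bar>x - \<theta> k\<bar> < dd k \<Longrightarrow> \<bar>h k x - h k (\<theta> k)\<bar> < \<epsilon>" by metis
  \<comment> \<open>A waiting time, in units of \<open>1 / sqrt n\<close>, that is off a threshold
    by d changes the cost there by less than \<epsilon>; d also stays below every threshold.\<close>
  define d where "d = min (Min (range dd)) (Min (range \<theta>)) / 2"
  have d0: "0 < d" using dd(1) \<theta>(1) by (simp add: d_def)
  have d: "d < dd k" "d < \<theta> k" for k
  proof -
    have "Min (range dd) \<le> dd k" "Min (range \<theta>) \<le> \<theta> k" by (auto intro: Min_le)
    moreover have "2 * d \<le> Min (range dd)" "2 * d \<le> Min (range \<theta>)" by (auto simp: d_def)
    ultimately show "d < dd k" "d < \<theta> k" using d0 by linarith+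
  qed
  have slack: "h k (\<theta> k + d) \<le> h k (\<theta> k) + \<epsilon>" "h k (\<theta> k) - \<epsilon> \<le> h k (\<theta> k - d)" for k
    using dd(2)[of "\<theta> k + d" k] dd(2)[of "\<theta> k - d" k] d(1)[of k] d0 by (auto simp: abs_less_iff)
  \<comment> \<open>Windows must contain every wait near a threshold, at most
    \<open>\<theta> k + d\<close>; the horizon T leaves room for a wait that starts at
    \<open>Tbar\<close>.\<close>
  define w where "w = Max (range \<theta>) + d + 1"
  have wk: "\<theta> k + d + 1 \<le> w" for k unfolding w_def by (auto intro: Max_ge)
  have w1: "1 \<le> w" using wk[of undefined] \<theta>(1)[of undefined] d0 by linarith
  define T where "T = Tbar + w"
  have T1: "1 \<le> T" using w1 Tbar by (simp add: T_def)
  \<comment> \<open>Small enough that an error of \<open>2 * \<gamma>0 * sqrt n\<close> customers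
    shifts the waiting time of any class by at most \<open>d / sqrt n\<close>.\<close>
  define \<gamma>0 where "\<gamma>0 = Min (range lam) * d / 2"
  have "0 < Min (range lam)" using lam by simp
  then have \<gamma>0: "0 < \<gamma>0" using d0 by (simp add: \<gamma>0_def)
  have \<gamma>0_le: "2 * \<gamma>0 \<le> lam k * d" for k
  proof -
    have "Min (range lam) \<le> lam k" by (auto intro: Min_le)
    then show ?thesis using d0 by (simp add: \<gamma>0_def)
  qed
  have \<beta>0: "0 < lam k * \<theta> k" for k using lam \<theta>(1) by simp
  have w0: "0 \<le> w" using w1 by simp
  obtain \<eta>0 where \<eta>0: "0 < \<eta>0" "\<And>\<eta>. 0 < \<eta> \<Longrightarrow> \<eta> \<le> \<eta>0 \<Longrightarrow> window_params lam (\<lambda>k. lam k * \<theta> k) w \<gamma>0 \<eta>"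
    by (rule window_params_exist[OF lam \<beta>0 w0 \<gamma>0], rule that)
  define \<eta>1 where "\<eta>1 = min (min \<eta>0 \<gamma>0) 1"
  have \<eta>1: "0 < \<eta>1" "\<eta>1 \<le> \<eta>0" "\<eta>1 \<le> \<gamma>0" "\<eta>1 \<le> 1" using \<eta>0 \<gamma>0 by (auto simp: \<eta>1_def)
  define K where "K = 1 + sum mu UNIV * (32 * real CARD('c) * (1 + T) * exp (6 * sum mu UNIV * T))"
  have "0 \<le> sum mu UNIV" using mu by (intro sum_nonneg) (auto intro: less_imp_le)
  then have "0 \<le> sum mu UNIV * (32 * real CARD('c) * (1 + T) * exp (6 * sum mu UNIV * T))"
    using T1 by (intro mult_nonneg_nonneg) auto
  then have K1: "1 \<le> K" unfolding K_def by linarith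
  \<comment> \<open>Errors are fixed backwards: the diffusive stage needs \<eta>1, the fluid stage
    loses the factor K, and inverting sums of inter-arrival times loses
    \<open>2 * lam i + 5\<close>.\<close>
  define \<eta> where "\<eta> = \<eta>1 / K"
  have \<eta>: "0 < \<eta>" "K * \<eta> = \<eta>1" "\<eta> \<le> 1"
    using \<eta>1 K1 divide_left_mono[of 1 K \<eta>1] by (auto simp: \<eta>_def)
  define \<eta>2 where "\<eta>2 i = \<eta> / (2 * lam i + 5)" for i
  have \<eta>2: "0 < \<eta>2 i" "\<eta>2 i \<le> 1 / 4" "(2 * lam i + 5) * \<eta>2 i = \<eta>" for i
  proof -
    have p: "4 \<le> 2 * lam i + 5" using lam[of i] by simp
    show "0 < \<eta>2 i" "(2 * lam i + 5) * \<eta>2 i = \<eta>" using p \<eta>(1) by (auto simp: \<eta>2_def)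
    have "\<eta> / (2 * lam i + 5) \<le> \<eta> / 4" using p \<eta>(1) by (intro divide_left_mono) auto
    then show "\<eta>2 i \<le> 1 / 4" using \<eta>(3) by (simp add: \<eta>2_def)
  qed
  define A where "A i = Suc (nat \<lceil>2 * (lam i + 1) * T\<rceil>)" for i
  have A: "2 * (lam i + 1) * T < real (A i)" "1 \<le> A i" for i unfolding A_def by linarith+
  have IAi: "indep_vars (\<lambda>_. borel) (IA i) {1..}" for i by (rule indep_vars_section[OF IA_indep])
  have m1: "integrable M (IA i 1)" "expectation (IA i 1) = 1" "integrable M (\<lambda>\<omega>. (IA i 1 \<omega>)\<^sup>2)" for i
    using IA_mean[of 1 i] IA_var[of 1 i] by auto
  have whp_IA: "whp (\<lambda>n \<omega>. \<forall>i\<in>UNIV. \<forall>k l. k + l \<le> A i * n \<longrightarrow>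
      \<bar>(\<Sum>j\<in>{k<..k+l}. IA i j \<omega>) - 1 * real l\<bar> \<le> \<eta>2 i * (sqrt (real n) + real l))"
    by (intro whp_all_finite partial_sums_window[OF IAi IA_ident m1 \<eta>2(1)]) auto
  have whp_S: "whp (\<lambda>n \<omega>. \<forall>i\<in>UNIV. \<forall>u v. 0 \<le> u \<longrightarrow> u \<le> v \<longrightarrow> v \<le> real (nat \<lceil>T\<rceil> * n) \<longrightarrow>
      \<bar>real (S i v \<omega>) - real (S i u \<omega>) - mu i * (v - u)\<bar> \<le> \<eta> * (sqrt (real n) + (v - u)))"
    by (intro whp_all_finite poisson_window[OF S mu \<eta>(1)]) auto
  have whp_Q0: "whp (\<lambda>n \<omega>. \<forall>i\<in>UNIV. real (Q0 n i \<omega>) \<le> \<eta> * sqrt (real n))"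
    by (intro whp_all_finite initial_queue_small[where X="\<lambda>n \<omega> i. Q0 n i \<omega>", OF init_conv Q0 \<eta>(1)]) auto
  have whp_Psi0: "whp (\<lambda>n \<omega>. \<forall>i\<in>UNIV. \<bar>real (Psi0 n i \<omega>) - real n * (lam i / mu i)\<bar> \<le> \<eta> * real n)"
    by (intro whp_all_finite initial_service_near[where X="\<lambda>n \<omega> i. Psi0 n i \<omega>" and \<rho>="\<lambda>i. lam i / mu i",
          OF init_conv Psi0 \<eta>(1) L PsiLim]) auto
  have "AE \<omega> in M. \<forall>k. 1 \<le> k \<longrightarrow> 0 < IA i k \<omega>" for i
    unfolding AE_all_countable using IA_pos by auto
  then have whp_pos: "whp (\<lambda>n \<omega>. \<forall>i\<in>UNIV. \<forall>k. 1 \<le> k \<longrightarrow> 0 < IA i k \<omega>)"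
    by (intro whp_all_finite whp_AE) auto
  have whp_unb: "whp (\<lambda>n \<omega>. \<forall>i\<in>UNIV. \<forall>x. \<exists>l. x < (\<Sum>k=1..l. IA i k \<omega>))"
    by (intro whp_all_finite whp_AE renewal_unbounded_AE[OF IAi IA_ident m1]) auto
  have "AE \<omega> in M. S i 0 \<omega> = 0" for i using poisson_mono_AE[OF S mu, of i] by eventually_elim simp
  then have whp_S0: "whp (\<lambda>n \<omega>. \<forall>i\<in>UNIV. S i 0 \<omega> = 0)" by (intro whp_all_finite whp_AE) auto
  \<comment> \<open>Profiles occur only in the last clause, which speaks of all of them at once; so
    one event serves all deviations.\<close>
  define good where "good n \<omega> \<longleftrightarrow>
      (\<forall>i\<in>UNIV. \<forall>k l. k + l \<le> A i * n \<longrightarrow>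
        \<bar>(\<Sum>j\<in>{k<..k+l}. IA i j \<omega>) - 1 * real l\<bar> \<le> \<eta>2 i * (sqrt (real n) + real l)) \<and>
      (\<forall>i\<in>UNIV. \<forall>u v. 0 \<le> u \<longrightarrow> u \<le> v \<longrightarrow> v \<le> real (nat \<lceil>T\<rceil> * n) \<longrightarrow>
        \<bar>real (S i v \<omega>) - real (S i u \<omega>) - mu i * (v - u)\<bar> \<le> \<eta> * (sqrt (real n) + (v - u))) \<and>
      (\<forall>i\<in>UNIV. real (Q0 n i \<omega>) \<le> \<eta> * sqrt (real n)) \<and>
      (\<forall>i\<in>UNIV. \<bar>real (Psi0 n i \<omega>) - real n * (lam i / mu i)\<bar> \<le> \<eta> * real n) \<and>
      (\<forall>i\<in>UNIV. \<forall>k. 1 \<le> k \<longrightarrow> 0 < IA i k \<omega>) \<and>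
      (\<forall>i\<in>UNIV. \<forall>x. \<exists>l. x < (\<Sum>k=1..l. IA i k \<omega>)) \<and>
      (\<forall>i\<in>UNIV. S i 0 \<omega> = 0) \<and>
      (\<forall>n\<ge>1. \<forall>\<sigma>. played pol n (\<lambda>i. Q0 n i \<omega>) (\<lambda>i. Psi0 n i \<omega>) (E n \<omega>) (\<lambda>i t. S i t \<omega>) \<sigma> (X n \<sigma> \<omega>))" for n \<omega>
  have whp_good: "whp good"
    unfolding good_def
    by (rule whp_conj[OF whp_IA whp_conj[OF whp_S whp_conj[OF whp_Q0 whp_conj[OF whp_Psi0
          whp_conj[OF whp_pos whp_conj[OF whp_unb whp_conj[OF whp_S0 whp_AE[OF X_played]]]]]]]])
  define stable where "stable n \<omega> \<longleftrightarrow> (\<forall>i. \<forall>j\<ge>1. \<forall>\<tau>. C n (threshold_profile h r lam n) i j \<omega>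
      \<le> C n (deviate (threshold_profile h r lam n) i j \<tau>) i j \<omega> + ereal \<epsilon>)" for n \<omega>
  have "whp (\<lambda>n \<omega>. 1 \<le> n \<longrightarrow> stable n \<omega>)"
    using whp_good
  proof (rule whp_eventually)
    have ev: "\<forall>\<^sub>F n in sequentially. \<forall>i\<in>UNIV. 1 \<le> \<eta>2 i * sqrt (real n) \<and> \<bar>lamn n i - real n * lam i\<bar> \<le> \<eta>2 i * real n"
      by (intro eventually_ball_finite ballI eventually_conj sqrt_eventually_ge rates_near[OF lamn] \<eta>2(1)) auto
    show "\<forall>\<^sub>F n in sequentially. \<forall>\<omega>. good n \<omega> \<longrightarrow> 1 \<le> n \<longrightarrow> stable n \<omega>"
      using ev sqrt_eventually_ge[OF \<eta>(1)] unfolding stable_def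
    proof (eventually_elim, intro allI impI)
      fix n \<omega> i j \<tau>
      assume n_large: "\<forall>i\<in>UNIV. 1 \<le> \<eta>2 i * sqrt (real n) \<and> \<bar>lamn n i - real n * lam i\<bar> \<le> \<eta>2 i * real n"
        "1 \<le> \<eta> * sqrt (real n)" and n: "1 \<le> n" and j: "(1::nat) \<le> j" and good: "good n \<omega>"
      note good = good[unfolded good_def]
      note gIA = good[THEN conjunct1] and rest = good[THEN conjunct2]
      note gS = rest[THEN conjunct1] and rest = rest[THEN conjunct2]
      note gQ = rest[THEN conjunct1] and rest = rest[THEN conjunct2]
      note gPsi = rest[THEN conjunct1] and rest = rest[THEN conjunct2]
      note gpos = rest[THEN conjunct1] and rest = rest[THEN conjunct2]
      note gunb = rest[THEN conjunct1] and rest = rest[THEN conjunct2]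
      note gS0 = rest[THEN conjunct1] and gplayed = rest[THEN conjunct2]
      have ren: "renewal (\<lambda>k. IA i k \<omega>) (lamn n i)" for i
        using gpos gunb lamn_pos[OF n] by unfold_locales auto
      have E_eq: "E n \<omega> i = (\<lambda>t. Sup {l. (\<Sum>k=1..l. IA i k \<omega> / lamn n i) \<le> t})" for i
        by (simp add: E_def arrivals_def fun_eq_iff)
      have arr: "arrival_path (E n \<omega>)"
      proof
        show "mono_on {0..} (E n \<omega> i)" for i unfolding E_eq by (rule renewal.count_mono[OF ren])
        show "continuous (at_right t) (E n \<omega> i)" if "0 \<le> t" for i t
          unfolding E_eq by (rule renewal.count_right_cont[OF ren that])
        show "E n \<omega> i 0 = 0" for i unfolding E_eq by (rule renewal.count_0[OF ren])
      qed
      have E_near: "\<bar>real (E n \<omega> i t) - real (E n \<omega> i s) - real n * lam i * (t - s)\<bar> \<le> \<eta> * (sqrt (real n) + real n * (t - s))"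
        if st: "0 \<le> s" "s \<le> t" "t \<le> T" for i s t
        unfolding E_eq \<eta>2(3)[of i, symmetric]
        by (rule renewal.count_window[where A="A i", OF ren]) (use gIA \<eta>2 n n_large lam A st in auto)
      \<comment> \<open>The integrated number in service up to T is at most \<open>n * T\<close>, so
        the Poisson processes are controlled up to an integer multiple of n above it.\<close>
      have nT: "real n * T \<le> real (nat \<lceil>T\<rceil> * n)"
        using mult_left_mono[of T "real (nat \<lceil>T\<rceil>)" "real n"] T1 by (simp add: mult.commute real_nat_ceiling_ge)
      have diff: "diffusive_path (E n \<omega>) pol n (\<lambda>i. Q0 n i \<omega>) (\<lambda>i. Psi0 n i \<omega>) (\<lambda>i t. S i t \<omega>) \<delta> Y thr dev lam \<eta>1 T"
        if gp: "game_path (E n \<omega>) pol n (\<lambda>i. Q0 n i \<omega>) (\<lambda>i. Psi0 n i \<omega>) (\<lambda>i t. S i t \<omega>) \<delta> Y thr dev" for \<delta> Y thr dev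
      proof -
        interpret game_path "E n \<omega>" pol n "\<lambda>i. Q0 n i \<omega>" "\<lambda>i. Psi0 n i \<omega>" "\<lambda>i t. S i t \<omega>" \<delta> Y thr dev by (rule gp)
        interpret fluid_path "E n \<omega>" pol n "\<lambda>i. Q0 n i \<omega>" "\<lambda>i. Psi0 n i \<omega>" "\<lambda>i t. S i t \<omega>" \<delta> Y thr dev lam \<eta> T mu
        proof unfold_locales
          show "\<bar>real (S i v \<omega>) - real (S i u \<omega>) - mu i * (v - u)\<bar> \<le> \<eta> * (sqrt (real n) + (v - u))"
            if "0 \<le> u" "u \<le> v" "v \<le> real n * T" for i u v
            using gS that nT by auto
        qed (use lam \<eta> n n_large T1 E_near gQ mu critical gS0 gPsi in auto)
        show ?thesis using diffusive[OF K_def] \<eta> \<eta>1 by simp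
      qed
      show "C n (threshold_profile h r lam n) i j \<omega> \<le> C n (deviate (threshold_profile h r lam n) i j \<tau>) i j \<omega> + ereal \<epsilon>"
        unfolding C_def
      proof (rule best_response[where \<theta>=\<theta> and d=d and w=w and \<kappa>=\<gamma>0 and \<eta>=\<eta>1 and T=T,
            OF arr n h_mono h_zero r lam gplayed[rule_format, OF n] gplayed[rule_format, OF n] diff])
        show "window_params lam (\<lambda>k. lam k * \<theta> k) w \<gamma>0 \<eta>1" by (rule \<eta>0(2)) (use \<eta>1 in auto)
        show "(\<forall>x\<ge>0. h k x \<le> r k) \<or> (h k (\<theta> k) = r k \<and> (\<forall>x\<ge>0. h k x \<le> r k \<longleftrightarrow> x \<le> \<theta> k) \<and>
          h k (\<theta> k + d) \<le> r k + \<epsilon> \<and> r k - \<epsilon> \<le> h k (\<theta> k - d))" for k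
          using \<theta>(2)[of k] slack[of k] by metis
        show "\<theta> k + d \<le> w" for k using wk[of k] by simp
      qed (use d0 d \<gamma>0_le \<eta>1 j eps in \<open>auto simp: T_def\<close>)
    qed
  qed
  then obtain G where G: "\<And>n. G n \<in> events" "(\<lambda>n. prob (G n)) \<longlonglongrightarrow> 1"
    "\<And>n \<omega>. \<omega> \<in> G n \<Longrightarrow> 1 \<le> n \<Longrightarrow> stable n \<omega>"
    unfolding whp_def by blast
  show ?thesis by (rule exI[of _ G]) (use G in \<open>auto simp: stable_def\<close>)
qed

end
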